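(* Let $(n_k)_{k\ge1}$ be a sequence of positive integers satisfying the Hadamard gap condition $n_{k+1}/n_k\ge q>1$ for all $k\ge1$ and some constant $q$. Assume moreover that for any fixed integers $a\neq0$, $b\neq0$, $c$ there is a constant $K(a,b)$, independent of $c$ and $N$, such that for every $N\ge1$ the number of solutions $(k,l)$ with $1\le k,l\le N$ of the Diophantine equation $a n_k+b n_l=c$ is at most $K(a,b)$, where in the case $c=0$ only solutions with $k\neq l$ are counted. Let $f:\mathbb{R}\to\mathbb{R}$ be a measurable function with $f(x+1)=f(x)$, $\int_0^1 f(x)\,dx=0$, and $\operatorname{Var}_{[0,1]}f<\infty$. Then for every permutation $\sigma:\mathbb{N}\to\mathbb{N}$, $$\limsup_{N\to\infty}\frac{\sum_{k=1}^N f(n_{\sigma(k)}x)}{\sqrt{2N\log\log N}}=\|f\|$$ for Lebesgue-almost every $x\in(0,1)$.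
   Context: $\|f\|$ denotes the $L^2(0,1)$ norm of $f$, i.e. $\|f\|=(\int_0^1 f(x)^2dx)^{1/2}$. $\operatorname{Var}_{[0,1]}f$ is the total variation of $f$ on $[0,1]$. *)

theory Defs
  imports "HOL-Analysis.Analysis"
begin

definition total_variation :: "(real \<Rightarrow> real) \<Rightarrow> real \<Rightarrow> real \<Rightarrow> ereal" where
  "total_variation f a b =
     (SUP p \<in> {(n, t). t 0 = a \<and> t n = b \<and> (\<forall>i<n. t i \<le> t (Suc i))}.
        ereal (\<Sum>i<fst p. \<bar>f (snd p (Suc i)) - f (snd p i)\<bar>))"

definition L2_01_norm :: "(real \<Rightarrow> real) \<Rightarrow> real" where
  "L2_01_norm f = sqrt (LBINT x:{0..1}. (f x)\<^sup>2)"

end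

theory Submission
  imports Defs "HOL-Probability.Probability" "HOL-Real_Asymp.Real_Asymp"
begin

text \<open>
  For weights \<open>w\<close> and a trigonometric polynomial \<open>p\<close> consider the Laplace transform of
  \<open>S = (\<Sum>k. w k * p (m k * x))\<close>. Since the terms of a finite sum may be listed in the order of
  increasing frequencies, a permutation of the sequence is just another choice of weights.
  Going through the frequencies in increasing order, \<open>exp S\<close> is compensated by the exponential of
  the low-frequency part \<open>Q\<close> of the quadratic variation, so that the integral of \<open>exp (S - Q)\<close>
  changes very little in each step: what is left after Taylor expansion has frequencies far above
  those of \<open>exp (S - Q)\<close> a few indices earlier and is killed by an integration by parts. The Diophantine
  condition makes the nonconstant part of \<open>Q\<close> small in mean square, which yields the Gaussian value
  \<open>exp (\<parallel>p\<parallel>\<^sup>2 * (\<Sum>k. (w k)\<^sup>2) / 2)\<close>; without it, one still gets a sub-Gaussian bound whose constant is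
  \<open>O(1 / D)\<close> for the part of a Fourier series beyond the degree \<open>D\<close>.

  The upper half of the law of the iterated logarithm follows by Markov's inequality on a grid and
  dyadic chaining in between. For the lower half, the exponentials of long blocks, truncated to the
  event that the block sum has its tilted mean value, have expectation, and pairwise products have
  expectation, close to 1; hence their averages tend to 1 in mean square. Finally \<open>f\<close> is
  approximated by partial sums of its Fourier series, whose coefficients are \<open>O(1 / j)\<close>.
\<close>

section \<open>The unit interval and its characters\<close>

text \<open>A ratio \<open>q\<close> barely above 1 leaves products of neighbouring terms with low,
  even zero, frequencies, and a permutation destroys any martingale order in the summation index; so
  only quantities invariant under reordering (sums of squares, sums of moduli, suprema of the
  weights) may enter the bounds. A second obstacle is that the Diophantine constant
  \<open>K(a,b)\<close> is not uniform in \<open>a\<close> and \<open>b\<close>. The exact transform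
  is therefore available only for a fixed degree \<open>D\<close>, and at scale \<open>N\<close>
  about \<open>2 ^ a\<close> the function is cut into three pieces: degrees up to \<open>D\<close>,
  which carry the sharp constant; degrees between \<open>D\<close> and \<open>2 ^ (8 * a)\<close>,
  where the crude bound suffices; and the rest, which is summably small in \<open>L^1\<close>. The
  middle range can be that long because the crude constant depends on the sum of
  \<open>|c j| / |j|\<close>, which converges, whereas the sum of \<open>|c j|\<close> grows like
  \<open>a\<close> and enters only the error terms. Those are damped by weights of size
  \<open>(19/20) ^ a\<close>, a bound that the Chernoff parameters of exponentially long blocks
  satisfy.\<close>

definition U :: "real measure" where
  "U = density lborel (\<lambda>x. ennreal (indicator {0..1} x))"

lemma space_U [simp]: "space U = UNIV"
  and sets_U [measurable_cong, simp]: "sets U = sets borel"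
  by (auto simp: U_def)

lemma emeasure_U_UNIV: "emeasure U UNIV = 1"
  unfolding U_def by (subst emeasure_density) (auto simp: ennreal_indicator)

interpretation U: prob_space U
  by (rule prob_spaceI) (simp add: emeasure_U_UNIV)

lemma integral_U:
  fixes g :: "real \<Rightarrow> 'a::{banach, second_countable_topology}"
  assumes "g \<in> borel_measurable borel"
  shows "integral\<^sup>L U g = (LBINT x:{0..1}. g x)"
  unfolding U_def set_lebesgue_integral_def
  by (subst integral_density) (use assms in auto)

lemma AE_U: "(AE x in U. P x) \<longleftrightarrow> (AE x in lborel. x \<in> {0..1} \<longrightarrow> P x)"
  unfolding U_def by (subst AE_density) (auto simp: indicator_def)

lemma integrable_U_cont:
  fixes g :: "real \<Rightarrow> 'a::{banach, second_countable_topology}"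
  assumes g: "continuous_on UNIV g"
  shows "integrable U g"
proof -
  have gm: "g \<in> borel_measurable borel" using g by (rule borel_measurable_continuous_onI)
  have "integrable lborel (\<lambda>x. indicator {0..1} x *\<^sub>R g x)"
    by (rule borel_integrable_compact) (auto intro: continuous_on_subset[OF g])
  then show ?thesis unfolding U_def by (subst integrable_density) (use gm in auto)
qed

lemma integral_U_mono_cont:
  fixes g h :: "real \<Rightarrow> real"
  assumes "continuous_on UNIV g" "continuous_on UNIV h" "\<And>x. g x \<le> h x"
  shows "integral\<^sup>L U g \<le> integral\<^sup>L U h"
  by (rule integral_mono) (use assms in \<open>auto intro: integrable_U_cont\<close>)

lemma integral_U_deriv:
  fixes F f :: "real \<Rightarrow> 'a::euclidean_space"
  assumes "\<And>x. (F has_vector_derivative f x) (at x)" and f: "continuous_on UNIV f"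
  shows "integral\<^sup>L U f = F 1 - F 0"
proof -
  have "integral\<^sup>L U f = (\<integral>x. indicator {0..1} x *\<^sub>R f x \<partial>lborel)"
    using integral_U[of f] borel_measurable_continuous_onI[OF f] by (simp add: set_lebesgue_integral_def)
  also have "\<dots> = F 1 - F 0"
    by (rule integral_FTC_atLeastAtMost)
       (use assms in \<open>auto intro: has_vector_derivative_at_within continuous_on_subset\<close>)
  finally show ?thesis .
qed

definition ee :: "int \<Rightarrow> real \<Rightarrow> complex" where
  "ee v x = cis (2 * pi * of_int v * x)"

lemma norm_ee [simp]: "cmod (ee v x) = 1"
  by (simp add: ee_def)

lemma ee_0 [simp]: "ee 0 x = 1"
  by (simp add: ee_def)

lemma ee_add: "ee (u + v) x = ee u x * ee v x"
  by (simp add: ee_def cis_mult algebra_simps)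

lemma cnj_ee: "cnj (ee v x) = ee (- v) x"
  by (simp add: ee_def flip: cis_cnj)

lemma ee_scale_nat: "ee v (of_nat u * x) = ee (v * int u) x"
  by (simp add: ee_def mult.assoc)

lemma ee_int [simp]: "x \<in> \<int> \<Longrightarrow> ee v x = 1"
proof -
  assume "x \<in> \<int>"
  then have "of_int v * x \<in> \<int>" by simp
  then have "cis (2 * pi * (of_int v * x)) = 1" by (rule cis_multiple_2pi)
  then show ?thesis by (simp add: ee_def mult.assoc)
qed

lemma ee_periodic: "ee v (x + 1) = ee v x"
  using ee_int[of 1 v] by (simp add: ee_def algebra_simps flip: cis_mult)

lemma has_vector_derivative_ee [derivative_intros]:
  "((ee v) has_vector_derivative (2 * pi * of_int v * \<i> * ee v x)) (at x within S)"
proof -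
  have "((\<lambda>z. exp (2 * pi * of_int v * \<i> * z)) has_field_derivative
      (2 * pi * of_int v * \<i> * exp (2 * pi * of_int v * \<i> * of_real x))) (at (of_real x))"
    by (auto intro!: derivative_eq_intros)
  from has_vector_derivative_real_field[OF this, of S]
  moreover have "ee v = (\<lambda>x. exp (2 * pi * of_int v * \<i> * of_real x))"
    by (simp add: ee_def cis_conv_exp mult_ac fun_eq_iff)
  ultimately show ?thesis by simp
qed

lemma continuous_on_ee [continuous_intros]: "continuous_on S (ee v)"
  unfolding ee_def cis_conv_exp by (intro continuous_intros)

lemma measurable_ee [measurable]: "ee v \<in> borel_measurable borel"
  by (intro borel_measurable_continuous_onI continuous_intros)

lemma integral_ee: "integral\<^sup>L U (ee v) = (if v = 0 then 1 else 0)"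
proof (cases "v = 0")
  case True
  then have "integral\<^sup>L U (ee v) = (\<integral>x. 1 \<partial>U)" by (intro Bochner_Integration.integral_cong) auto
  then show ?thesis using True U.prob_space by simp
next
  case False
  define F where "F = (\<lambda>x. ee v x / (2 * pi * of_int v * \<i>))"
  have "integral\<^sup>L U (ee v) = F 1 - F 0"
  proof (rule integral_U_deriv)
    show "(F has_vector_derivative ee v x) (at x)" for x
      unfolding F_def using has_vector_derivative_mult_left[OF has_vector_derivative_ee[of v x UNIV], of "1 / (2 * pi * of_int v * \<i>)"] False
      by simp
  qed (intro continuous_intros)
  then show ?thesis using False by (simp add: F_def)
qed

text \<open>Integration by parts: a weight with small logarithmic derivative does not correlate with
  high frequencies.\<close>

lemma integral_exp_ee_le:
  fixes psi psi' :: "real \<Rightarrow> real"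
  assumes psi: "\<And>x. (psi has_real_derivative psi' x) (at x)" and cont: "continuous_on UNIV psi'"
    and B: "\<And>x. \<bar>psi' x\<bar> \<le> B" and per: "psi 1 = psi 0" and v: "v \<noteq> 0"
  shows "cmod (\<integral>x. of_real (exp (psi x)) * ee v x \<partial>U) \<le> B / (2 * pi * \<bar>of_int v\<bar>) * (\<integral>x. exp (psi x) \<partial>U)"
proof -
  have cpsi: "continuous_on UNIV psi"
    using psi DERIV_isCont by (auto simp: continuous_on_eq_continuous_at)
  let ?w = "2 * pi * of_int v * \<i> :: complex"
  let ?G = "\<lambda>x. of_real (exp (psi x)) :: complex"
  have w: "?w \<noteq> 0" "cmod ?w = 2 * pi * \<bar>of_int v\<bar>" using v by (auto simp: norm_mult)
  define F where "F = (\<lambda>x. ?G x * ee v x)"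
  define A where "A = (\<lambda>x. of_real (psi' x) * ?G x * ee v x)"
  have cA: "continuous_on UNIV A" and cF: "continuous_on UNIV F"
    unfolding A_def F_def by (intro continuous_intros cont cpsi)+
  have "(\<integral>x. A x + ?w * F x \<partial>U) = F 1 - F 0"
  proof (rule integral_U_deriv)
    fix x
    have "(?G has_vector_derivative of_real (exp (psi x) * psi' x)) (at x)"
      by (rule has_vector_derivative_of_real[OF DERIV_fun_exp[OF psi]])
    from has_vector_derivative_mult[OF this has_vector_derivative_ee[of v x UNIV]]
    show "(F has_vector_derivative A x + ?w * F x) (at x)"
      unfolding F_def A_def by (simp add: algebra_simps)
  qed (intro continuous_intros cA cF)
  also have "F 1 - F 0 = 0" using per by (simp add: F_def)
  also have "(\<integral>x. A x + ?w * F x \<partial>U) = integral\<^sup>L U A + ?w * integral\<^sup>L U F"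
    by (subst Bochner_Integration.integral_add) (auto intro!: integrable_U_cont cA cF continuous_intros)
  finally have "?w * integral\<^sup>L U F = - integral\<^sup>L U A"
    by (simp add: algebra_simps add_eq_0_iff)
  then have "cmod ?w * cmod (integral\<^sup>L U F) = cmod (integral\<^sup>L U A)"
    by (metis norm_minus_cancel norm_mult)
  also have "\<dots> \<le> (\<integral>x. cmod (A x) \<partial>U)" by simp
  also have "\<dots> \<le> (\<integral>x. B * exp (psi x) \<partial>U)"
  proof (rule integral_U_mono_cont)
    show "cmod (A x) \<le> B * exp (psi x)" for x
      using B[of x] by (auto simp: A_def norm_mult)
  qed (intro continuous_intros cA cpsi)+
  also have "\<dots> = B * (\<integral>x. exp (psi x) \<partial>U)" by simp
  finally show ?thesis using w v unfolding F_def by (simp add: field_simps)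
qed

lemma exp_taylor2: "\<bar>exp z - 1 - z - z\<^sup>2 / 2\<bar> \<le> \<bar>z\<bar> ^ 3" if "\<bar>z\<bar> \<le> 1" for z :: real
proof -
  from Maclaurin_exp_le[of z 3] obtain t where t: "\<bar>t\<bar> \<le> \<bar>z\<bar>"
    "exp z = (\<Sum>m<3. z ^ m / fact m) + exp t / fact 3 * z ^ 3" by blast
  have "exp t \<le> exp 1" using t that by simp
  also have "exp 1 \<le> (3::real)" by (rule exp_le)
  finally have e: "exp t \<le> 3" .
  have "exp z - 1 - z - z\<^sup>2 / 2 = exp t / 6 * z ^ 3"
    using t(2) by (simp add: eval_nat_numeral field_simps)
  also have "\<bar>\<dots>\<bar> = exp t / 6 * \<bar>z\<bar> ^ 3" by (simp add: abs_mult power_abs)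
  also have "\<dots> \<le> 1 * \<bar>z\<bar> ^ 3" using e by (intro mult_right_mono) auto
  finally show ?thesis by simp
qed

text \<open>With \<open>A = R - Q\<close> and \<open>y = X - q\<close> the first term is
  \<open>exp (A + y) - exp A\<close>, and both exponentials are expanded to second order. Since
  \<open>Q\<close> and \<open>q\<close> are already quadratic in \<open>u\<close>, every product
  containing one of them is cubic. The Taylor remainders cost 64 + 8 and the five stray products at
  most 4.5, whence 80.\<close>

lemma exp_increment_expansion:
  fixes R X q Q u :: real
  assumes R: "\<bar>R\<bar> \<le> u" and X: "\<bar>X\<bar> \<le> u" and q: "\<bar>q\<bar> \<le> u\<^sup>2" and Q: "\<bar>Q\<bar> \<le> u\<^sup>2" and u: "u \<le> 1/4"
  shows "\<bar>exp (R - Q) * (exp (X - q) - 1) - (X + X * R + X\<^sup>2 / 2 - q)\<bar> \<le> 80 * u ^ 3"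
proof -
  have u0: "0 \<le> u" using R by linarith
  have u2: "u\<^sup>2 \<le> u" using u u0 by (simp add: power2_eq_square mult_left_le)
  define A where "A = R - Q"
  define y where "y = X - q"
  have A: "\<bar>A\<bar> \<le> 2 * u" and y: "\<bar>y\<bar> \<le> 2 * u" using assms u2 by (auto simp: A_def y_def)
  have "\<bar>exp (A + y) - 1 - (A + y) - (A + y)\<^sup>2 / 2\<bar> \<le> \<bar>A + y\<bar> ^ 3"
    by (rule exp_taylor2) (use A y u in linarith)
  also have "\<dots> \<le> (4 * u) ^ 3" by (rule power_mono) (use A y in auto)
  finally have 1: "\<bar>exp (A + y) - 1 - (A + y) - (A + y)\<^sup>2 / 2\<bar> \<le> 64 * u ^ 3"
    by (simp add: power_mult_distrib)
  have "\<bar>exp A - 1 - A - A\<^sup>2 / 2\<bar> \<le> \<bar>A\<bar> ^ 3"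
    by (rule exp_taylor2) (use A u in linarith)
  also have "\<dots> \<le> (2 * u) ^ 3" by (rule power_mono) (use A in auto)
  finally have 2: "\<bar>exp A - 1 - A - A\<^sup>2 / 2\<bar> \<le> 8 * u ^ 3" by (simp add: power_mult_distrib)
  have m: "\<bar>a * b\<bar> \<le> u ^ 3" if "\<bar>a\<bar> \<le> u" "\<bar>b\<bar> \<le> u\<^sup>2" for a b
  proof -
    have "\<bar>a * b\<bar> \<le> u * u\<^sup>2" unfolding abs_mult by (rule mult_mono) (use that u0 in auto)
    then show ?thesis by (simp add: eval_nat_numeral)
  qed
  have 3: "\<bar>R * q\<bar> \<le> u ^ 3" "\<bar>X * Q\<bar> \<le> u ^ 3" "\<bar>X * q\<bar> \<le> u ^ 3"
    using assms by (auto intro!: m)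
  have 4: "\<bar>Q * q\<bar> \<le> u ^ 3" "\<bar>q * q\<bar> \<le> u ^ 3"
    using m[of Q q] m[of q q] assms u2 by auto
  have 5: "exp A * (exp y - 1) = exp (A + y) - exp A"
    by (simp only: exp_add algebra_simps mult_1_right)
  have 6: "(A + y) + (A + y)\<^sup>2 / 2 - A - A\<^sup>2 / 2 - (X + X * R + X\<^sup>2 / 2 - q)
      = - (R * q) - X * Q + Q * q - X * q + q * q / 2"
    by (simp add: A_def y_def power2_eq_square field_simps)
  have "\<bar>exp A * (exp y - 1) - (X + X * R + X\<^sup>2 / 2 - q)\<bar> \<le> 80 * u ^ 3"
    unfolding 5 using 1 2 3 4 6 by linarith
  then show ?thesis unfolding A_def y_def .
qed

section \<open>Trigonometric polynomials along lacunary sequences\<close>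

text \<open>Packages the hypotheses of \<open>integral_exp_ee_le\<close> in a form closed under
  sums, so that derivative bounds for composite exponents are assembled without writing the
  derivatives down.\<close>

definition per_bd :: "real \<Rightarrow> (real \<Rightarrow> real) \<Rightarrow> bool" where
  "per_bd B g \<longleftrightarrow> (\<exists>g'. (\<forall>x. (g has_real_derivative g' x) (at x)) \<and> continuous_on UNIV g' \<and>
     (\<forall>x. \<bar>g' x\<bar> \<le> B)) \<and> g 1 = g 0"

lemma per_bd_const: "per_bd 0 (\<lambda>_. a)"
  unfolding per_bd_def by (auto intro!: exI[of _ "\<lambda>_. 0"])

lemma per_bd_add:
  assumes "per_bd B g" "per_bd C h" shows "per_bd (B + C) (\<lambda>x. g x + h x)"
proof -
  from assms obtain g' h' where *: "\<forall>x. (g has_real_derivative g' x) (at x)" "continuous_on UNIV g'"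
     "\<forall>x. \<bar>g' x\<bar> \<le> B" "\<forall>x. (h has_real_derivative h' x) (at x)" "continuous_on UNIV h'"
     "\<forall>x. \<bar>h' x\<bar> \<le> C" "g 1 = g 0" "h 1 = h 0"
    unfolding per_bd_def by metis
  have "\<bar>g' x + h' x\<bar> \<le> B + C" for x
    using *(3,6)[rule_format, of x] by linarith
  then show ?thesis using * unfolding per_bd_def
    by (auto intro!: exI[of _ "\<lambda>x. g' x + h' x"] derivative_intros continuous_intros)
qed

lemma per_bd_mono: "per_bd B g \<Longrightarrow> B \<le> C \<Longrightarrow> per_bd C g"
  unfolding per_bd_def by (meson order_trans)

lemma per_bd_minus: "per_bd B g \<Longrightarrow> per_bd B (\<lambda>x. - g x)"
proof -
  assume "per_bd B g"
  then obtain g' where "\<forall>x. (g has_real_derivative g' x) (at x)" "continuous_on UNIV g'"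
     "\<forall>x. \<bar>g' x\<bar> \<le> B" "g 1 = g 0"
    unfolding per_bd_def by metis
  then show ?thesis unfolding per_bd_def
    by (auto intro!: exI[of _ "\<lambda>x. - g' x"] derivative_eq_intros continuous_intros)
qed

lemma per_bd_sum:
  assumes "finite A" "\<And>a. a \<in> A \<Longrightarrow> per_bd (B a) (g a)"
  shows "per_bd (\<Sum>a\<in>A. B a) (\<lambda>x. \<Sum>a\<in>A. g a x)"
  using assms by (induction rule: finite_induct) (auto intro: per_bd_const per_bd_add)

lemma per_bd_ee: "per_bd (2 * pi * \<bar>of_int v\<bar> * cmod z) (\<lambda>x. Re (z * ee v x))"
  unfolding per_bd_def
proof (intro conjI exI[of _ "\<lambda>x. Re (z * (2 * pi * of_int v * \<i> * ee v x))"] allI)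
  show "((\<lambda>x. Re (z * ee v x)) has_real_derivative Re (z * (2 * pi * of_int v * \<i> * ee v x))) (at x)" for x
    unfolding has_real_derivative_iff_has_vector_derivative
    by (intro bounded_linear.has_vector_derivative[OF bounded_linear_Re] has_vector_derivative_mult_right
          has_vector_derivative_ee)
  show "\<bar>Re (z * (2 * pi * of_int v * \<i> * ee v x))\<bar> \<le> 2 * pi * \<bar>of_int v\<bar> * cmod z" for x
    by (rule order_trans[OF abs_Re_le_cmod]) (simp add: norm_mult)
  show "continuous_on UNIV (\<lambda>x. Re (z * (2 * pi * of_int v * \<i> * ee v x)))"
    by (intro continuous_intros)
qed simp

lemma per_bd_trig:
  assumes "finite A" "\<And>a. a \<in> A \<Longrightarrow> \<bar>of_int (v a)\<bar> \<le> V"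
  shows "per_bd (2 * pi * V * (\<Sum>a\<in>A. cmod (z a))) (\<lambda>x. Re (\<Sum>a\<in>A. z a * ee (v a) x))"
proof -
  have "per_bd (\<Sum>a\<in>A. 2 * pi * \<bar>of_int (v a)\<bar> * cmod (z a)) (\<lambda>x. \<Sum>a\<in>A. Re (z a * ee (v a) x))"
    by (intro per_bd_sum assms per_bd_ee)
  moreover have "(\<Sum>a\<in>A. 2 * pi * \<bar>of_int (v a)\<bar> * cmod (z a)) \<le> 2 * pi * V * (\<Sum>a\<in>A. cmod (z a))"
    unfolding sum_distrib_left by (intro sum_mono mult_right_mono mult_left_mono assms) auto
  ultimately show ?thesis unfolding Re_sum by (rule per_bd_mono)
qed

lemma per_bd_cont: "per_bd B g \<Longrightarrow> continuous_on UNIV g"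
  unfolding per_bd_def by (metis DERIV_isCont continuous_at_imp_continuous_on)

text \<open>Integration by parts is applied to each character separately; \<open>\<theta>\<close>
  bounds the ratio between the slope of \<open>psi\<close> and every single frequency, and the
  coefficients are summed in modulus.\<close>

lemma corr_trig:
  assumes psi: "per_bd B psi" and A: "finite A"
    and v: "\<And>a. a \<in> A \<Longrightarrow> v a \<noteq> 0 \<and> B \<le> 2 * pi * \<bar>of_int (v a)\<bar> * \<theta>"
  shows "\<bar>\<integral>x. exp (psi x) * Re (\<Sum>a\<in>A. z a * ee (v a) x) \<partial>U\<bar>
     \<le> \<theta> * (\<Sum>a\<in>A. cmod (z a)) * (\<integral>x. exp (psi x) \<partial>U)"
proof -
  note c = per_bd_cont[OF psi]
  let ?I = "\<integral>x. exp (psi x) \<partial>U"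
  have I0: "0 \<le> ?I" by (rule Bochner_Integration.integral_nonneg) auto
  have one: "cmod (\<integral>x. of_real (exp (psi x)) * ee (v a) x \<partial>U) \<le> \<theta> * ?I" if "a \<in> A" for a
  proof -
    from psi obtain psi' where p: "\<And>x. (psi has_real_derivative psi' x) (at x)" "continuous_on UNIV psi'"
      "\<And>x. \<bar>psi' x\<bar> \<le> B" "psi 1 = psi 0" unfolding per_bd_def by metis
    have "cmod (\<integral>x. of_real (exp (psi x)) * ee (v a) x \<partial>U) \<le> B / (2 * pi * \<bar>of_int (v a)\<bar>) * ?I"
      using v[OF that] by (intro integral_exp_ee_le[OF p]) auto
    also have "\<dots> \<le> \<theta> * ?I"
      using v[OF that] I0 by (intro mult_right_mono) (auto simp: field_simps)
    finally show ?thesis .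
  qed
  have "(\<integral>x. exp (psi x) * Re (\<Sum>a\<in>A. z a * ee (v a) x) \<partial>U)
      = (\<integral>x. Re (\<Sum>a\<in>A. z a * (of_real (exp (psi x)) * ee (v a) x)) \<partial>U)"
  proof (intro Bochner_Integration.integral_cong refl)
    fix x
    have "exp (psi x) * Re (\<Sum>a\<in>A. z a * ee (v a) x) = Re (of_real (exp (psi x)) * (\<Sum>a\<in>A. z a * ee (v a) x))"
      by simp
    also have "of_real (exp (psi x)) * (\<Sum>a\<in>A. z a * ee (v a) x) = (\<Sum>a\<in>A. z a * (of_real (exp (psi x)) * ee (v a) x))"
      by (simp only: sum_distrib_left mult.left_commute)
    finally show "exp (psi x) * Re (\<Sum>a\<in>A. z a * ee (v a) x) = Re (\<Sum>a\<in>A. z a * (of_real (exp (psi x)) * ee (v a) x))" .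
  qed
  also have "\<dots> = Re (\<integral>x. (\<Sum>a\<in>A. z a * (of_real (exp (psi x)) * ee (v a) x)) \<partial>U)"
    by (intro integral_Re integrable_U_cont continuous_intros c)
  also have "(\<integral>x. (\<Sum>a\<in>A. z a * (of_real (exp (psi x)) * ee (v a) x)) \<partial>U)
      = (\<Sum>a\<in>A. z a * (\<integral>x. of_real (exp (psi x)) * ee (v a) x \<partial>U))"
    by (subst Bochner_Integration.integral_sum) (auto intro!: integrable_U_cont continuous_intros c)
  also have "\<bar>Re \<dots>\<bar> \<le> cmod \<dots>" by (rule abs_Re_le_cmod)
  also have "\<dots> \<le> (\<Sum>a\<in>A. cmod (z a) * (\<theta> * ?I))"
    by (rule order_trans[OF norm_sum]) (auto simp: norm_mult intro!: sum_mono mult_left_mono one)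
  also have "\<dots> = \<theta> * (\<Sum>a\<in>A. cmod (z a)) * ?I" by (simp add: sum_distrib_left sum_distrib_right mult_ac)
  finally show ?thesis .
qed

definition freqs :: "nat \<Rightarrow> int set" where "freqs H = {- int H..int H} - {0}"

lemma finite_freqs [simp, intro]: "finite (freqs H)" by (simp add: freqs_def)

definition tp :: "(int \<Rightarrow> complex) \<Rightarrow> nat \<Rightarrow> real \<Rightarrow> real" where
  "tp c H x = Re (\<Sum>j\<in>freqs H. c j * ee j x)"

lemma tp_cont [continuous_intros]: "continuous_on S g \<Longrightarrow> continuous_on S (\<lambda>x. tp c H (g x))"
proof -
  have "continuous_on UNIV (tp c H)" unfolding tp_def by (intro continuous_intros)
  then show "continuous_on S g \<Longrightarrow> continuous_on S (\<lambda>x. tp c H (g x))"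
    by (metis continuous_on_compose2 subset_UNIV)
qed

lemma tp_measurable [measurable]: "tp c H \<in> borel_measurable borel"
  by (intro borel_measurable_continuous_onI continuous_intros)

text \<open>Conjugation permutes the terms of the sum, so \<open>Re\<close> in the definition of
  \<open>tp\<close> discards nothing when the coefficients are conjugate symmetric.\<close>

lemma tp_complex:
  assumes "\<And>j. c (- j) = cnj (c j)"
  shows "of_real (tp c H x) = (\<Sum>j\<in>freqs H. c j * ee j x)"
proof -
  let ?S = "\<Sum>j\<in>freqs H. c j * ee j x"
  have "cnj ?S = (\<Sum>j\<in>freqs H. c (- j) * ee (- j) x)" by (simp add: cnj_ee assms)
  also have "\<dots> = ?S"
    by (rule sum.reindex_bij_witness[of _ uminus uminus]) (auto simp: freqs_def)
  finally have "?S \<in> \<real>" by (simp only: Reals_cnj_iff)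
  then show ?thesis by (simp only: tp_def of_real_Re)
qed

section \<open>Lacunary sequences and the compensated exponential\<close>

locale lacunary =
  fixes m :: "nat \<Rightarrow> nat" and q :: real
  assumes m_pos: "\<And>k. 0 < m k" and q1: "1 < q" and gap: "\<And>k. q * real (m k) \<le> real (m (Suc k))"
begin

lemma m_pow: "a \<le> b \<Longrightarrow> q ^ (b - a) * real (m a) \<le> real (m b)"
proof (induction b rule: dec_induct)
  case (step n)
  have "q ^ (Suc n - a) * real (m a) = q * (q ^ (n - a) * real (m a))"
    using step by (simp add: Suc_diff_le)
  also have "\<dots> \<le> q * real (m n)" using step q1 by (intro mult_left_mono) auto
  also have "\<dots> \<le> real (m (Suc n))" by (rule gap)
  finally show ?case .
qed simp

lemma m_mono: "a \<le> b \<Longrightarrow> m a \<le> m b"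
proof -
  assume "a \<le> b"
  have "1 * real (m a) \<le> q ^ (b - a) * real (m a)"
    using q1 by (intro mult_right_mono one_le_power) auto
  also have "\<dots> \<le> real (m b)" by (rule m_pow) fact
  finally show ?thesis by simp
qed

text \<open>The induction closes because \<open>1 / (q - 1) + 1 = q / (q - 1)\<close>. It lets the
  derivative of a whole partial sum be charged to a single frequency.\<close>

lemma m_sum: "(\<Sum>l<k. real (m l)) \<le> real (m k) / (q - 1)"
proof (induction k)
  case 0 then show ?case using q1 by simp
next
  case (Suc k)
  have "(\<Sum>l<Suc k. real (m l)) \<le> real (m k) / (q - 1) + real (m k)" using Suc by simp
  also have "\<dots> = q * real (m k) / (q - 1)" using q1 by (simp add: field_simps)
  also have "\<dots> \<le> real (m (Suc k)) / (q - 1)" using q1 gap[of k] by (intro divide_right_mono) auto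
  finally show ?case .
qed

end

text \<open>\<open>L\<close> is the lag after which terms decouple: by \<open>qL\<close>, for
  indices at least \<open>L\<close> apart the occurring multiples of the smaller frequency are at
  most half the larger one, so they cannot cancel it. The window in \<open>u14\<close> has length
  \<open>4 * L\<close> because a compensator up to \<open>2 * L\<close> steps back itself looks back
  \<open>2 * L\<close> steps. \<open>La1\<close> majorises both \<open>La\<close> and 1.\<close>

locale lag = lacunary +
  fixes c :: "int \<Rightarrow> complex" and H :: nat and w :: "nat \<Rightarrow> real" and L :: nat and La La1 :: real
  assumes cnj_c: "\<And>j. c (- j) = cnj (c j)"
    and La: "(\<Sum>j\<in>freqs H. cmod (c j)) \<le> La" and La1: "1 \<le> La1" "La \<le> La1"
    and qL: "2 * real H \<le> q ^ L"
    and w1: "\<And>k. \<bar>w k\<bar> \<le> 1"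
    and u14: "\<And>k. La1 * (\<Sum>l\<in>{k - 4 * L..k}. \<bar>w l\<bar>) \<le> 1 / 4"
begin

text \<open>The compensator \<open>Q k\<close> collects the low frequencies of the products of \<open>X k\<close> with the \<open>2 * L\<close>
  preceding terms, and the constant part of half its square. Frequencies that survive in these products
  are at least \<open>m (k - L) / 2\<close>, whereas \<open>psi (k - 2 * L)\<close> varies on the scale of \<open>m (k - 2 * L)\<close>.\<close>

definition X :: "nat \<Rightarrow> real \<Rightarrow> real" where
  "X k x = w k * tp c H (real (m k) * x)"

text \<open>The threshold \<open>m l / 2\<close> is small enough that at most one \<open>j\<close>
  qualifies for a given \<open>i\<close>, and large enough that every excluded frequency can be
  integrated by parts.\<close>

definition low :: "nat \<Rightarrow> nat \<Rightarrow> (int \<times> int) set" where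
  "low k l = {(i, j) \<in> freqs H \<times> freqs H. 2 * \<bar>i * int (m k) + j * int (m l)\<bar> < int (m l)}"

definition lowp :: "nat \<Rightarrow> nat \<Rightarrow> real \<Rightarrow> complex" where
  "lowp k l x = (\<Sum>p\<in>low k l. c (fst p) * c (snd p) * ee (fst p * int (m k) + snd p * int (m l)) x)"

definition Q :: "nat \<Rightarrow> real \<Rightarrow> real" where
  "Q k x = (\<Sum>l\<in>{k - 2 * L..<k}. w k * w l * Re (lowp k l x)) + (w k)\<^sup>2 / 2 * (\<Sum>j\<in>freqs H. (cmod (c j))\<^sup>2)"

definition psi :: "nat \<Rightarrow> real \<Rightarrow> real" where
  "psi k x = (\<Sum>i<k. X i x - Q i x)"

text \<open>The size parameter of step \<open>k\<close>: the terms and their recent sums are at most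
  \<open>u k\<close>, the compensators and their recent sums at most its square.\<close>

definition u :: "nat \<Rightarrow> real" where
  "u k = La1 * (\<Sum>l\<in>{k - 4 * L..k}. \<bar>w l\<bar>)"

text \<open>Bounds the slope of \<open>psi (k - 2 * L)\<close> relative to
  \<open>2 * pi * |v|\<close> when \<open>2 * |v|\<close> is at least \<open>m (k - L)\<close>: the
  slope is controlled by \<open>m (k - 2 * L) / (q - 1)\<close>, and the gap of \<open>L\<close>
  indices supplies \<open>q ^ L\<close>.\<close>

definition th :: real where "th = 2 * La * (real H + 1) / ((q - 1) * q ^ L)"

lemma La0: "0 \<le> La"
  using La by (meson norm_ge_zero order_trans sum_nonneg)

lemma u0: "0 \<le> u k"
  unfolding u_def using La1 by (intro mult_nonneg_nonneg sum_nonneg) auto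

lemma finite_low: "finite (low k l)"
  by (rule finite_subset[of _ "freqs H \<times> freqs H"]) (auto simp: low_def)

lemma low_subset: "low k l \<subseteq> freqs H \<times> freqs H"
  by (auto simp: low_def)

lemma sum_prod_le: "(\<Sum>p\<in>freqs H \<times> freqs H. cmod (c (fst p)) * cmod (c (snd p))) \<le> La * La"
proof -
  have "(\<Sum>p\<in>freqs H \<times> freqs H. cmod (c (fst p)) * cmod (c (snd p))) =
     (\<Sum>i\<in>freqs H. cmod (c i)) * (\<Sum>j\<in>freqs H. cmod (c j))"
    by (simp add: sum_product sum.cartesian_product case_prod_beta)
  also have "\<dots> \<le> La * La" by (intro mult_mono La La0 sum_nonneg) auto
  finally show ?thesis .
qed

lemma sum_low_le:
  assumes "P \<subseteq> freqs H \<times> freqs H"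
  shows "(\<Sum>p\<in>P. cmod (c (fst p) * c (snd p))) \<le> La * La"
  by (rule order_trans[OF _ sum_prod_le]) (auto simp: norm_mult intro!: sum_mono2 assms)

lemma sum_sq_le: "(\<Sum>j\<in>freqs H. (cmod (c j))\<^sup>2) \<le> La * La"
proof -
  have "(\<Sum>j\<in>freqs H. (cmod (c j))\<^sup>2) \<le> (\<Sum>j\<in>freqs H. cmod (c j) * La)"
    unfolding power2_eq_square
  proof (intro sum_mono mult_left_mono)
    fix j assume "j \<in> freqs H"
    then have "cmod (c j) \<le> (\<Sum>j\<in>freqs H. cmod (c j))" by (intro member_le_sum) auto
    then show "cmod (c j) \<le> La" using La by linarith
  qed auto
  also have "\<dots> = (\<Sum>j\<in>freqs H. cmod (c j)) * La" by (simp add: sum_distrib_right)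
  also have "\<dots> \<le> La * La" using La La0 by (intro mult_right_mono) auto
  finally show ?thesis .
qed

lemma X_trig: "X k x = Re (\<Sum>j\<in>freqs H. (of_real (w k) * c j) * ee (j * int (m k)) x)"
proof -
  have "X k x = Re (of_real (w k) * (\<Sum>j\<in>freqs H. c j * ee (j * int (m k)) x))"
    by (simp add: X_def tp_def ee_scale_nat)
  then show ?thesis by (simp only: sum_distrib_left mult.assoc)
qed

lemma X_complex: "of_real (X k x) = of_real (w k) * (\<Sum>j\<in>freqs H. c j * ee (j * int (m k)) x)"
  by (simp add: X_def tp_complex[of c, OF cnj_c] ee_scale_nat)

lemma X_bound: "\<bar>X k x\<bar> \<le> \<bar>w k\<bar> * La"
proof -
  have "cmod (of_real (X k x)) \<le> \<bar>w k\<bar> * (\<Sum>j\<in>freqs H. cmod (c j))"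
    unfolding X_complex norm_mult
    by (auto intro!: mult_left_mono order_trans[OF norm_sum] simp: norm_mult)
  also have "\<dots> \<le> \<bar>w k\<bar> * La" using La by (intro mult_left_mono) auto
  finally show ?thesis by simp
qed

lemma lowp_bound: "cmod (lowp k l x) \<le> La * La"
  unfolding lowp_def
  by (rule order_trans[OF norm_sum]) (auto simp: norm_mult[of _ "ee _ _"] low_def intro!: sum_low_le)

lemma Q_bound0: "\<bar>Q k x\<bar> \<le> La * La * \<bar>w k\<bar> * (\<Sum>l\<in>{k - 2 * L..k}. \<bar>w l\<bar>)"
proof -
  have "\<bar>Q k x\<bar> \<le> (\<Sum>l\<in>{k - 2 * L..<k}. \<bar>w k * w l * Re (lowp k l x)\<bar>) + \<bar>(w k)\<^sup>2 / 2 * (\<Sum>j\<in>freqs H. (cmod (c j))\<^sup>2)\<bar>"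
    unfolding Q_def by (rule order_trans[OF abs_triangle_ineq add_right_mono[OF sum_abs]])
  also have "(\<Sum>l\<in>{k - 2 * L..<k}. \<bar>w k * w l * Re (lowp k l x)\<bar>) \<le> (\<Sum>l\<in>{k - 2 * L..<k}. \<bar>w k\<bar> * \<bar>w l\<bar> * (La * La))"
    unfolding abs_mult by (intro sum_mono mult_left_mono order_trans[OF abs_Re_le_cmod lowp_bound]) auto
  also have "\<bar>(w k)\<^sup>2 / 2 * (\<Sum>j\<in>freqs H. (cmod (c j))\<^sup>2)\<bar> = (w k)\<^sup>2 / 2 * (\<Sum>j\<in>freqs H. (cmod (c j))\<^sup>2)"
    by (intro abs_of_nonneg mult_nonneg_nonneg sum_nonneg) auto
  also have "\<dots> \<le> (w k)\<^sup>2 * (La * La)"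
    using sum_sq_le by (intro mult_mono sum_nonneg) auto
  also have "(w k)\<^sup>2 = \<bar>w k\<bar> * \<bar>w k\<bar>" by (simp add: power2_eq_square)
  also have "(\<Sum>l\<in>{k - 2 * L..<k}. \<bar>w k\<bar> * \<bar>w l\<bar> * (La * La)) + \<bar>w k\<bar> * \<bar>w k\<bar> * (La * La)
     = (\<Sum>l\<in>insert k {k - 2 * L..<k}. \<bar>w k\<bar> * \<bar>w l\<bar> * (La * La))" by simp
  also have "insert k {k - 2 * L..<k} = {k - 2 * L..k}" by auto
  finally show ?thesis by (simp add: sum_distrib_left mult_ac)
qed

text \<open>One factor \<open>La * |w k|\<close> is kept; the other factor, a window sum, is
  absorbed into \<open>u k0\<close>. Allowing \<open>k\<close> below \<open>k0\<close> covers the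
  compensators of all recent steps at once.\<close>

lemma Q_bound:
  assumes "k \<le> k0" "k0 - 2 * L \<le> k"
  shows "\<bar>Q k x\<bar> \<le> La * \<bar>w k\<bar> * u k0"
proof -
  have "(\<Sum>l\<in>{k - 2 * L..k}. \<bar>w l\<bar>) \<le> (\<Sum>l\<in>{k0 - 4 * L..k0}. \<bar>w l\<bar>)"
    using assms by (intro sum_mono2) auto
  then have "La * (\<Sum>l\<in>{k - 2 * L..k}. \<bar>w l\<bar>) \<le> u k0"
    unfolding u_def using La1 La0 by (intro mult_mono) (auto intro: sum_nonneg)
  then have "(La * \<bar>w k\<bar>) * (La * (\<Sum>l\<in>{k - 2 * L..k}. \<bar>w l\<bar>)) \<le> (La * \<bar>w k\<bar>) * u k0"
    using La0 by (intro mult_left_mono) auto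
  then show ?thesis using Q_bound0[of k x] by (simp add: mult_ac)
qed

lemma window_u: "(\<Sum>l\<in>{k - 2 * L..k}. La * \<bar>w l\<bar>) \<le> u k"
proof -
  have "(\<Sum>l\<in>{k - 2 * L..k}. La * \<bar>w l\<bar>) \<le> (\<Sum>l\<in>{k - 4 * L..k}. La1 * \<bar>w l\<bar>)"
    using La0 La1 by (intro order_trans[OF sum_mono2 sum_mono] mult_right_mono) auto
  then show ?thesis by (simp add: u_def sum_distrib_left)
qed

lemma window_u': "La * \<bar>w k\<bar> + (\<Sum>l\<in>{k - 2 * L..<k}. La * \<bar>w l\<bar>) \<le> u k"
proof -
  have "{k - 2 * L..k} = insert k {k - 2 * L..<k}" by auto
  then show ?thesis using window_u[of k] by simp
qed

lemma u_le: "u k \<le> 1 / 4" unfolding u_def by (rule u14)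

text \<open>The \<open>H\<close> comes from \<open>X k\<close>, the extra 1 from \<open>Q k\<close>:
  its frequencies do not exceed \<open>m k\<close>, and the window condition makes its coefficients
  add up to at most \<open>La\<close>.\<close>

lemma per_bd_XQ: "per_bd (2 * pi * La * (real H + 1) * real (m k)) (\<lambda>x. X k x - Q k x)"
proof -
  have "per_bd (2 * pi * (real H * real (m k)) * (\<Sum>j\<in>freqs H. cmod (of_real (w k) * c j))) (X k)"
    unfolding X_trig
  proof (rule per_bd_trig)
    fix j assume "j \<in> freqs H"
    then have "\<bar>j\<bar> \<le> int H" by (auto simp: freqs_def)
    then have "\<bar>j\<bar> * int (m k) \<le> int H * int (m k)" by (intro mult_right_mono) auto
    then show "\<bar>real_of_int (j * int (m k))\<bar> \<le> real H * real (m k)"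
      by (metis (mono_tags) abs_mult abs_of_nat of_int_abs of_int_le_iff of_int_mult of_int_of_nat_eq)
  qed auto
  then have X: "per_bd (2 * pi * (real H * real (m k)) * La) (X k)"
  proof (rule per_bd_mono)
    have "(\<Sum>j\<in>freqs H. cmod (of_real (w k) * c j)) \<le> (\<Sum>j\<in>freqs H. cmod (c j))"
      unfolding norm_mult using w1[of k] by (intro sum_mono mult_left_le_one_le) auto
    then show "2 * pi * (real H * real (m k)) * (\<Sum>j\<in>freqs H. cmod (of_real (w k) * c j))
       \<le> 2 * pi * (real H * real (m k)) * La"
      using La by (intro mult_left_mono) auto
  qed
  have low1: "per_bd (2 * pi * real (m k) * (\<bar>w k\<bar> * \<bar>w l\<bar> * (La * La))) (\<lambda>x. w k * w l * Re (lowp k l x))"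
    if l: "l \<in> {k - 2 * L..<k}" for l
  proof -
    have eq: "w k * w l * Re (lowp k l x) = Re (\<Sum>p\<in>low k l. (of_real (w k * w l) * (c (fst p) * c (snd p))) *
         ee (fst p * int (m k) + snd p * int (m l)) x)" for x
    proof -
      have "w k * w l * Re (lowp k l x) = Re (of_real (w k * w l) * lowp k l x)" by simp
      then show ?thesis unfolding lowp_def by (simp only: sum_distrib_left mult.assoc)
    qed
    have "per_bd (2 * pi * real (m k) * (\<Sum>p\<in>low k l. cmod (of_real (w k * w l) * (c (fst p) * c (snd p)))))
      (\<lambda>x. w k * w l * Re (lowp k l x))"
      unfolding eq
    proof (rule per_bd_trig[OF finite_low])
      fix p assume "p \<in> low k l"
      then have "2 * \<bar>fst p * int (m k) + snd p * int (m l)\<bar> < int (m l)" by (auto simp: low_def)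
      moreover have "int (m l) \<le> int (m k)" using l m_mono[of l k] by simp
      moreover have "\<bar>v\<bar> \<le> b" if "2 * \<bar>v\<bar> < a" "a \<le> b" for v a b :: int using that by linarith
      ultimately have "\<bar>fst p * int (m k) + snd p * int (m l)\<bar> \<le> int (m k)" by blast
      then show "\<bar>real_of_int (fst p * int (m k) + snd p * int (m l))\<bar> \<le> real (m k)"
        by (metis of_int_abs of_int_le_iff of_int_of_nat_eq)
    qed
    moreover have "(\<Sum>p\<in>low k l. cmod (of_real (w k * w l) * (c (fst p) * c (snd p)))) \<le> \<bar>w k\<bar> * \<bar>w l\<bar> * (La * La)"
      unfolding norm_mult[of "of_real _"] sum_distrib_left[symmetric]
      unfolding norm_of_real abs_mult by (intro mult_left_mono sum_low_le low_subset) auto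
    ultimately show ?thesis by (elim per_bd_mono) (auto intro!: mult_left_mono)
  qed
  have "per_bd ((\<Sum>l\<in>{k - 2 * L..<k}. 2 * pi * real (m k) * (\<bar>w k\<bar> * \<bar>w l\<bar> * (La * La))) + 0) (Q k)"
    unfolding Q_def[abs_def] by (intro per_bd_add per_bd_const per_bd_sum low1) auto
  then have Q: "per_bd (2 * pi * real (m k) * La) (Q k)"
  proof (rule per_bd_mono)
    have "(\<Sum>l\<in>{k - 2 * L..<k}. La * \<bar>w l\<bar>) \<le> 1"
      using window_u'[of k] u_le[of k] mult_nonneg_nonneg[OF La0 abs_ge_zero[of "w k"]] by linarith
    then have "\<bar>w k\<bar> * (\<Sum>l\<in>{k - 2 * L..<k}. La * \<bar>w l\<bar>) \<le> 1 * 1"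
      using w1[of k] La0 by (intro mult_mono sum_nonneg) auto
    then have "(2 * pi * real (m k) * La) * (\<bar>w k\<bar> * (\<Sum>l\<in>{k - 2 * L..<k}. La * \<bar>w l\<bar>)) \<le> (2 * pi * real (m k) * La) * 1"
      using La0 by (intro mult_left_mono) auto
    then show "(\<Sum>l\<in>{k - 2 * L..<k}. 2 * pi * real (m k) * (\<bar>w k\<bar> * \<bar>w l\<bar> * (La * La))) + 0 \<le> 2 * pi * real (m k) * La"
      by (simp add: sum_distrib_left mult_ac)
  qed
  have "per_bd (2 * pi * (real H * real (m k)) * La + 2 * pi * real (m k) * La) (\<lambda>x. X k x + (- Q k x))"
    by (rule per_bd_add[OF X per_bd_minus[OF Q]])
  moreover have "2 * pi * (real H * real (m k)) * La + 2 * pi * real (m k) * La = 2 * pi * La * (real H + 1) * real (m k)"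
    by (simp add: algebra_simps)
  ultimately show ?thesis by simp
qed

lemma per_bd_psi: "per_bd (2 * pi * La * (real H + 1) * (\<Sum>l<k. real (m l))) (psi k)"
  unfolding psi_def[abs_def] sum_distrib_left by (intro per_bd_sum per_bd_XQ) auto

lemma psi_cont: "continuous_on UNIV (psi k)"
  by (rule per_bd_cont[OF per_bd_psi])

lemma X_cont: "continuous_on UNIV (X k)"
  unfolding X_def[abs_def] by (intro continuous_intros)

lemma Q_cont: "continuous_on UNIV (Q k)"
  unfolding Q_def[abs_def] lowp_def by (intro continuous_intros)

end

section \<open>One-step change of the integral of the compensated exponential\<close>

context lag begin

text \<open>When the truncated difference \<open>k - 2 * L\<close> is 0, the weight
  \<open>exp (psi 0 x)\<close> is constant and every nonzero frequency integrates to 0 against it;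
  hence the first disjunct.\<close>

definition good_freq :: "nat \<Rightarrow> int \<Rightarrow> bool" where
  "good_freq k v \<longleftrightarrow> v \<noteq> 0 \<and> (k - 2 * L = 0 \<or> int (m (k - L)) \<le> 2 * \<bar>v\<bar>)"

lemma good_freq_th:
  assumes "good_freq k v"
  shows "2 * pi * La * (real H + 1) * (\<Sum>l<k - 2 * L. real (m l)) \<le> 2 * pi * \<bar>of_int v\<bar> * th"
proof (cases "k - 2 * L = 0")
  case True
  then show ?thesis using La0 q1 by (auto simp: th_def intro!: divide_nonneg_nonneg mult_nonneg_nonneg)
next
  case False
  then have "int (m (k - L)) \<le> 2 * \<bar>v\<bar>" using assms by (auto simp: good_freq_def)
  then have v: "real (m (k - L)) \<le> 2 * \<bar>real_of_int v\<bar>" by linarith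
  have "q ^ L * real (m (k - 2 * L)) \<le> real (m (k - L))"
  proof -
    have "k - L - (k - 2 * L) = L" using False by linarith
    then show ?thesis using m_pow[of "k - 2 * L" "k - L"] by simp
  qed
  then have "real (m (k - 2 * L)) \<le> 2 * \<bar>real_of_int v\<bar> / q ^ L"
    using v q1 by (simp add: field_simps)
  then have "(\<Sum>l<k - 2 * L. real (m l)) \<le> 2 * \<bar>real_of_int v\<bar> / q ^ L / (q - 1)"
    by (intro order_trans[OF m_sum] divide_right_mono) (use q1 in auto)
  then have "2 * pi * La * (real H + 1) * (\<Sum>l<k - 2 * L. real (m l)) \<le> 2 * pi * La * (real H + 1) * (2 * \<bar>real_of_int v\<bar> / q ^ L / (q - 1))"
    using La0 by (intro mult_left_mono) auto
  also have "\<dots> = 2 * pi * \<bar>of_int v\<bar> * th" by (simp add: th_def mult_ac)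
  finally show ?thesis .
qed

lemma good_freq_X: "j \<in> freqs H \<Longrightarrow> good_freq k (j * int (m k))"
proof -
  assume "j \<in> freqs H"
  then have j: "j \<noteq> 0" by (auto simp: freqs_def)
  then have "1 * int (m k) \<le> \<bar>j\<bar> * int (m k)" by (intro mult_right_mono) auto
  moreover have "m (k - L) \<le> m k" by (intro m_mono) auto
  ultimately have "int (m (k - L)) \<le> 2 * \<bar>j * int (m k)\<bar>" by (simp add: abs_mult)
  then show ?thesis using j m_pos[of k] by (auto simp: good_freq_def)
qed

text \<open>For \<open>l\<close> within \<open>L\<close> of \<open>k\<close>, failing to be low
  already gives \<open>2 * |v|\<close> at least \<open>m l\<close>. For smaller \<open>l\<close> the
  gap \<open>q ^ L\<close> makes the \<open>l\<close>-part at most \<open>m k / 2\<close>, so the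
  \<open>k\<close>-part cannot be cancelled.\<close>

lemma good_freq_high:
  assumes l: "l \<in> {k - 2 * L..<k}" and p: "(i, j) \<in> freqs H \<times> freqs H - low k l"
  shows "good_freq k (i * int (m k) + j * int (m l))"
proof -
  let ?v = "i * int (m k) + j * int (m l)"
  have v: "int (m l) \<le> 2 * \<bar>?v\<bar>" using p by (auto simp: low_def)
  then have "?v \<noteq> 0" using m_pos[of l] by auto
  moreover have "int (m (k - L)) \<le> 2 * \<bar>?v\<bar>" if "k - 2 * L \<noteq> 0"
  proof (cases "k - L \<le> l")
    case True
    then show ?thesis using v m_mono[of "k - L" l] by linarith
  next
    case False
    have i: "i \<noteq> 0" and j: "\<bar>j\<bar> \<le> int H" using p by (auto simp: freqs_def)
    have "2 * real H * real (m l) \<le> q ^ L * real (m l)" using qL by (intro mult_right_mono) auto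
    also have "\<dots> \<le> q ^ (k - l) * real (m l)"
      using False q1 that by (intro mult_right_mono power_increasing) auto
    also have "\<dots> \<le> real (m k)" using l by (intro m_pow) auto
    finally have "real (2 * H * m l) \<le> real (m k)" by simp
    then have a: "2 * (int H * int (m l)) \<le> int (m k)"
      by (metis mult.assoc of_nat_le_iff of_nat_mult of_nat_numeral)
    have "\<bar>j * int (m l)\<bar> \<le> int H * int (m l)" using j by (simp add: abs_mult mult_right_mono)
    moreover have "1 * int (m k) \<le> \<bar>i\<bar> * int (m k)" using i by (intro mult_right_mono) auto
    then have "int (m k) \<le> \<bar>i * int (m k)\<bar>" by (simp add: abs_mult)
    moreover have "b \<le> 2 * \<bar>x + y\<bar>" if "\<bar>y\<bar> \<le> h" "b \<le> \<bar>x\<bar>" "2 * h \<le> b" for x y h b :: int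
      using that by (simp add: abs_if split: if_splits)
    ultimately have "int (m k) \<le> 2 * \<bar>?v\<bar>" using a by blast
    then show ?thesis using m_mono[of "k - L" k] by linarith
  qed
  ultimately show ?thesis by (auto simp: good_freq_def)
qed

definition highp :: "nat \<Rightarrow> nat \<Rightarrow> real \<Rightarrow> complex" where
  "highp k l x = (\<Sum>p\<in>freqs H \<times> freqs H - low k l. c (fst p) * c (snd p) * ee (fst p * int (m k) + snd p * int (m l)) x)"

definition diagp :: "nat \<Rightarrow> real \<Rightarrow> complex" where
  "diagp k x = (\<Sum>p\<in>freqs H \<times> freqs H - {(i, j). i + j = 0}. c (fst p) * c (snd p) * ee ((fst p + snd p) * int (m k)) x)"

lemma X_mult: "of_real (X k x * X l x) = of_real (w k * w l) *
   (\<Sum>p\<in>freqs H \<times> freqs H. c (fst p) * c (snd p) * ee (fst p * int (m k) + snd p * int (m l)) x)"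
proof -
  have "of_real (X k x * X l x) = of_real (w k * w l) *
    ((\<Sum>i\<in>freqs H. c i * ee (i * int (m k)) x) * (\<Sum>j\<in>freqs H. c j * ee (j * int (m l)) x))"
    by (simp add: X_complex)
  also have "(\<Sum>i\<in>freqs H. c i * ee (i * int (m k)) x) * (\<Sum>j\<in>freqs H. c j * ee (j * int (m l)) x) =
     (\<Sum>p\<in>freqs H \<times> freqs H. c (fst p) * c (snd p) * ee (fst p * int (m k) + snd p * int (m l)) x)"
    unfolding sum_product sum.cartesian_product by (rule sum.cong) (auto simp: ee_add mult_ac)
  finally show ?thesis .
qed

lemma X_mult_split: "X k x * X l x = w k * w l * Re (lowp k l x) + w k * w l * Re (highp k l x)"
proof -
  have "(\<Sum>p\<in>freqs H \<times> freqs H. c (fst p) * c (snd p) * ee (fst p * int (m k) + snd p * int (m l)) x)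
      = highp k l x + lowp k l x"
    unfolding lowp_def highp_def by (rule sum.subset_diff[OF low_subset]) auto
  then have "complex_of_real (X k x * X l x) = of_real (w k * w l) * (highp k l x + lowp k l x)"
    by (simp only: X_mult)
  then have "Re (complex_of_real (X k x * X l x)) = Re (of_real (w k * w l) * (highp k l x + lowp k l x))"
    by (rule arg_cong)
  then show ?thesis by (simp add: algebra_simps)
qed

text \<open>The constant comes from the pairs \<open>(j, - j)\<close>, where conjugate symmetry
  turns the product of coefficients into a squared modulus; all other frequencies are nonzero
  multiples of \<open>m k\<close>.\<close>

lemma X_sq_split: "(X k x)\<^sup>2 = (w k)\<^sup>2 * (\<Sum>j\<in>freqs H. (cmod (c j))\<^sup>2) + (w k)\<^sup>2 * Re (diagp k x)"
proof -
  let ?P = "freqs H \<times> freqs H" and ?D = "(freqs H \<times> freqs H) \<inter> {(i, j). i + j = 0}"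
  let ?f = "\<lambda>p. c (fst p) * c (snd p) * ee (fst p * int (m k) + snd p * int (m k)) x"
  have "(\<Sum>p\<in>?P. ?f p) = (\<Sum>p\<in>?P - ?D. ?f p) + (\<Sum>p\<in>?D. ?f p)"
    by (rule sum.subset_diff) auto
  also have "?P - ?D = ?P - {(i, j). i + j = 0}" by auto
  also have "(\<Sum>p\<in>?P - {(i, j). i + j = 0}. ?f p) = diagp k x" by (simp add: diagp_def algebra_simps)
  also have "(\<Sum>p\<in>?D. ?f p) = (\<Sum>j\<in>freqs H. of_real ((cmod (c j))\<^sup>2))"
  proof (rule sum.reindex_bij_witness[of _ "\<lambda>j. (j, - j)" fst])
    fix p assume p: "p \<in> ?D"
    then have s: "snd p = - fst p" by auto
    show "complex_of_real ((cmod (c (fst p)))\<^sup>2) = ?f p"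
      unfolding s cnj_c complex_norm_square by simp
  qed (auto simp: freqs_def)
  finally have "complex_of_real (X k x * X k x) = of_real (w k * w k) * (diagp k x + (\<Sum>j\<in>freqs H. of_real ((cmod (c j))\<^sup>2)))"
    by (simp only: X_mult)
  then have "Re (complex_of_real (X k x * X k x)) = Re (of_real (w k * w k) * (diagp k x + of_real (\<Sum>j\<in>freqs H. (cmod (c j))\<^sup>2)))"
    by (simp only: of_real_sum)
  then show ?thesis by (simp add: algebra_simps power2_eq_square)
qed

text \<open>\<open>E k\<close> is the second-order part of the increment. By construction
  \<open>Q k\<close> removes from it exactly the low frequencies and the constant, so each remaining
  frequency is good and costs a factor \<open>th\<close>.\<close>

lemma correlation:
  defines "I \<equiv> \<lambda>k. \<integral>x. exp (psi k x) \<partial>U"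
  defines "E \<equiv> \<lambda>k x. X k x + X k x * (\<Sum>l\<in>{k - 2 * L..<k}. X l x) + (X k x)\<^sup>2 / 2 - Q k x"
  shows "\<bar>\<integral>x. exp (psi (k - 2 * L) x) * E k x \<partial>U\<bar> \<le> 2 * La * \<bar>w k\<bar> * th * I (k - 2 * L)"
proof -
  let ?k = "k - 2 * L" and ?W = "{k - 2 * L..<k}"
  note corr = corr_trig[OF per_bd_psi[of ?k], where \<theta> = th]
  have I0: "0 \<le> I ?k" unfolding I_def by (rule Bochner_Integration.integral_nonneg) auto
  have th0: "0 \<le> th" unfolding th_def using La0 q1 by auto
  have E: "E k x = X k x + (\<Sum>l\<in>?W. w k * w l * Re (highp k l x)) + (w k)\<^sup>2 / 2 * Re (diagp k x)" for x
  proof -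
    have "X k x * (\<Sum>l\<in>?W. X l x) = (\<Sum>l\<in>?W. w k * w l * Re (lowp k l x)) + (\<Sum>l\<in>?W. w k * w l * Re (highp k l x))"
      unfolding sum_distrib_left X_mult_split by (rule sum.distrib)
    then show ?thesis unfolding E_def Q_def X_sq_split by (simp add: algebra_simps)
  qed
  have T1: "\<bar>\<integral>x. exp (psi ?k x) * X k x \<partial>U\<bar> \<le> th * (\<bar>w k\<bar> * La) * I ?k"
  proof -
    have "\<bar>\<integral>x. exp (psi ?k x) * X k x \<partial>U\<bar> \<le> th * (\<Sum>j\<in>freqs H. cmod (of_real (w k) * c j)) * I ?k"
      unfolding X_trig I_def
    proof (rule corr)
      fix j assume "j \<in> freqs H"
      then have "good_freq k (j * int (m k))" by (rule good_freq_X)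
      then show "j * int (m k) \<noteq> 0 \<and> 2 * pi * La * (real H + 1) * (\<Sum>l<k - 2 * L. real (m l))
         \<le> 2 * pi * \<bar>real_of_int (j * int (m k))\<bar> * th"
        using good_freq_th unfolding good_freq_def by blast
    qed auto
    also have "\<dots> \<le> th * (\<bar>w k\<bar> * La) * I ?k"
      unfolding norm_mult sum_distrib_left[symmetric] norm_of_real
      by (intro mult_left_mono mult_right_mono La I0 th0) auto
    finally show ?thesis .
  qed
  have T2: "\<bar>\<integral>x. exp (psi ?k x) * Re (highp k l x) \<partial>U\<bar> \<le> th * (La * La) * I ?k" if "l \<in> ?W" for l
  proof -
    have "\<bar>\<integral>x. exp (psi ?k x) * Re (highp k l x) \<partial>U\<bar> \<le>
        th * (\<Sum>p\<in>freqs H \<times> freqs H - low k l. cmod (c (fst p) * c (snd p))) * I ?k"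
      unfolding highp_def I_def
    proof (rule corr)
      fix p assume "p \<in> freqs H \<times> freqs H - low k l"
      then have "good_freq k (fst p * int (m k) + snd p * int (m l))"
        using good_freq_high[OF that, of "fst p" "snd p"] by simp
      then show "fst p * int (m k) + snd p * int (m l) \<noteq> 0 \<and> 2 * pi * La * (real H + 1) * (\<Sum>l<k - 2 * L. real (m l))
         \<le> 2 * pi * \<bar>real_of_int (fst p * int (m k) + snd p * int (m l))\<bar> * th"
        using good_freq_th unfolding good_freq_def by blast
    qed auto
    also have "\<dots> \<le> th * (La * La) * I ?k"
      by (intro mult_left_mono mult_right_mono sum_low_le I0 th0) auto
    finally show ?thesis .
  qed
  have T3: "\<bar>\<integral>x. exp (psi ?k x) * Re (diagp k x) \<partial>U\<bar> \<le> th * (La * La) * I ?k"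
  proof -
    have gd: "good_freq k ((i + j) * int (m k))" if "i + j \<noteq> 0" for i j
    proof -
      have "1 * int (m k) \<le> \<bar>i + j\<bar> * int (m k)" using that by (intro mult_right_mono) auto
      moreover have "m (k - L) \<le> m k" by (intro m_mono) auto
      ultimately have "int (m (k - L)) \<le> 2 * \<bar>(i + j) * int (m k)\<bar>" by (simp add: abs_mult)
      then show ?thesis using that m_pos[of k] by (auto simp: good_freq_def)
    qed
    have "\<bar>\<integral>x. exp (psi ?k x) * Re (diagp k x) \<partial>U\<bar> \<le>
        th * (\<Sum>p\<in>freqs H \<times> freqs H - {(i, j). i + j = 0}. cmod (c (fst p) * c (snd p))) * I ?k"
      unfolding diagp_def I_def
    proof (rule corr)
      fix p assume "p \<in> freqs H \<times> freqs H - {(i, j). i + j = 0}"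
      then have "good_freq k ((fst p + snd p) * int (m k))" by (intro gd) auto
      then show "(fst p + snd p) * int (m k) \<noteq> 0 \<and> 2 * pi * La * (real H + 1) * (\<Sum>l<k - 2 * L. real (m l))
         \<le> 2 * pi * \<bar>real_of_int ((fst p + snd p) * int (m k))\<bar> * th"
        using good_freq_th unfolding good_freq_def by blast
    qed auto
    also have "\<dots> \<le> th * (La * La) * I ?k"
      by (intro mult_left_mono mult_right_mono sum_low_le I0 th0) auto
    finally show ?thesis .
  qed
  have ci: "integrable U (\<lambda>x. exp (psi ?k x) * g x)" if "continuous_on UNIV g" for g
    by (intro integrable_U_cont continuous_intros psi_cont that)
  have ch: "continuous_on UNIV (\<lambda>x. Re (highp k l x))" for l
    unfolding highp_def by (intro continuous_intros)
  have cd: "continuous_on UNIV (\<lambda>x. Re (diagp k x))"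
    unfolding diagp_def by (intro continuous_intros)
  have "(\<integral>x. exp (psi ?k x) * E k x \<partial>U) = (\<integral>x. exp (psi ?k x) * X k x + (\<Sum>l\<in>?W. (w k * w l) * (exp (psi ?k x) * Re (highp k l x)))
     + (w k)\<^sup>2 / 2 * (exp (psi ?k x) * Re (diagp k x)) \<partial>U)"
    unfolding E by (intro Bochner_Integration.integral_cong) (auto simp: distrib_left sum_distrib_left mult_ac)
  also have "\<dots> = (\<integral>x. exp (psi ?k x) * X k x \<partial>U) + (\<Sum>l\<in>?W. (w k * w l) * (\<integral>x. exp (psi ?k x) * Re (highp k l x) \<partial>U))
     + (w k)\<^sup>2 / 2 * (\<integral>x. exp (psi ?k x) * Re (diagp k x) \<partial>U)"
    using ci[OF X_cont[of k]] ci[OF ch] ci[OF cd] by simp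
  finally have eq: "(\<integral>x. exp (psi ?k x) * E k x \<partial>U) = \<dots>" .
  have "\<bar>\<integral>x. exp (psi ?k x) * E k x \<partial>U\<bar> \<le> th * (\<bar>w k\<bar> * La) * I ?k + (\<Sum>l\<in>?W. \<bar>w k * w l\<bar> * (th * (La * La) * I ?k)) + (w k)\<^sup>2 / 2 * (th * (La * La) * I ?k)"
    unfolding eq
    by (intro order_trans[OF abs_triangle_ineq] add_mono T1 order_trans[OF sum_abs] sum_mono)
       (auto simp: abs_mult intro!: mult_left_mono T2 T3)
  also have "\<dots> = (th * La * I ?k * \<bar>w k\<bar>) * (1 + (\<Sum>l\<in>?W. La * \<bar>w l\<bar>) + La * \<bar>w k\<bar> / 2)"
  proof -
    have "(w k)\<^sup>2 = \<bar>w k\<bar> * \<bar>w k\<bar>" by (simp add: power2_eq_square)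
    moreover have "(\<Sum>l\<in>?W. \<bar>w k * w l\<bar> * (th * (La * La) * I ?k)) = \<bar>w k\<bar> * (\<Sum>l\<in>?W. \<bar>w l\<bar>) * (th * (La * La) * I ?k)"
      by (simp add: abs_mult sum_distrib_left sum_distrib_right)
    moreover have "(\<Sum>l\<in>?W. La * \<bar>w l\<bar>) = La * (\<Sum>l\<in>?W. \<bar>w l\<bar>)" by (rule sum_distrib_left[symmetric])
    ultimately show ?thesis by (simp only:) (simp add: algebra_simps)
  qed
  also have "\<dots> \<le> (th * La * I ?k * \<bar>w k\<bar>) * 2"
  proof (intro mult_left_mono)
    have "0 \<le> La * \<bar>w k\<bar>" using La0 by simp
    then show "1 + (\<Sum>l\<in>?W. La * \<bar>w l\<bar>) + La * \<bar>w k\<bar> / 2 \<le> 2"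
      using window_u'[of k] u_le[of k] by linarith
  qed (use th0 La0 I0 in auto)
  finally show ?thesis by (simp add: mult_ac)
qed

lemma psi_split: "a \<le> k \<Longrightarrow> psi k x = psi a x + ((\<Sum>l\<in>{a..<k}. X l x) - (\<Sum>l\<in>{a..<k}. Q l x))"
  unfolding psi_def lessThan_atLeast0 sum_subtractf[symmetric]
  by (rule sum.atLeastLessThan_concat[symmetric]) auto

text \<open>The increment is written as the distant weight \<open>exp (psi (k - 2 * L) x)\<close>
  times a local factor. The local factor equals its second-order part up to
  \<open>80 * u k ^ 3\<close>, and the distant weight hardly correlates with that part. This is why
  the error is relative to \<open>I (k - 2 * L)\<close> and not to \<open>I k\<close>.\<close>

lemma step:
  defines "I \<equiv> \<lambda>k. \<integral>x. exp (psi k x) \<partial>U"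
  shows "\<bar>I (Suc k) - I k\<bar> \<le> (80 * u k ^ 3 + 2 * La * \<bar>w k\<bar> * th) * I (k - 2 * L)"
proof -
  let ?k = "k - 2 * L" and ?W = "{k - 2 * L..<k}"
  define R where "R = (\<lambda>x. \<Sum>l\<in>?W. X l x)"
  define S where "S = (\<lambda>x. \<Sum>l\<in>?W. Q l x)"
  define E where "E = (\<lambda>x. X k x + X k x * R x + (X k x)\<^sup>2 / 2 - Q k x)"
  define G where "G = (\<lambda>x. exp (psi ?k x))"
  have cont: "continuous_on UNIV R" "continuous_on UNIV S" "continuous_on UNIV E" "continuous_on UNIV G"
    unfolding E_def R_def S_def G_def by (intro continuous_intros X_cont Q_cont psi_cont; simp)+
  have cP: "continuous_on UNIV (\<lambda>x. exp (psi j x))" for j by (intro continuous_intros psi_cont)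
  have diff: "exp (psi (Suc k) x) - exp (psi k x) = G x * (exp (R x - S x) * (exp (X k x - Q k x) - 1))" for x
  proof -
    have "psi (Suc k) x = psi k x + (X k x - Q k x)" by (simp add: psi_def)
    moreover have "psi k x = psi ?k x + (R x - S x)" unfolding R_def S_def by (rule psi_split) auto
    ultimately have "exp (psi (Suc k) x) = exp (psi ?k x) * exp (R x - S x) * exp (X k x - Q k x)"
      "exp (psi k x) = exp (psi ?k x) * exp (R x - S x)"
      by (simp_all only: exp_add)
    then show ?thesis unfolding G_def by (simp only: right_diff_distrib mult_1_right mult.assoc)
  qed
  have pt: "\<bar>exp (R x - S x) * (exp (X k x - Q k x) - 1) - E x\<bar> \<le> 80 * u k ^ 3" for x
    unfolding E_def
  proof (rule exp_increment_expansion)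
    have "\<bar>R x\<bar> \<le> (\<Sum>l\<in>?W. La * \<bar>w l\<bar>)"
      unfolding R_def by (rule order_trans[OF sum_abs sum_mono]) (use X_bound in \<open>simp add: mult.commute\<close>)
    moreover have "\<bar>X k x\<bar> \<le> La * \<bar>w k\<bar>" using X_bound[of k x] by (simp add: mult.commute)
    moreover have "0 \<le> La * \<bar>w k\<bar>" "0 \<le> (\<Sum>l\<in>?W. La * \<bar>w l\<bar>)" using La0 by (auto intro: sum_nonneg)
    ultimately show "\<bar>R x\<bar> \<le> u k" "\<bar>X k x\<bar> \<le> u k" using window_u'[of k] by linarith+
    have "\<bar>Q k x\<bar> \<le> La * \<bar>w k\<bar> * u k" by (rule Q_bound) auto
    also have "\<dots> \<le> u k * u k"
      using window_u'[of k] \<open>0 \<le> (\<Sum>l\<in>?W. La * \<bar>w l\<bar>)\<close> u0 by (intro mult_right_mono) auto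
    finally show "\<bar>Q k x\<bar> \<le> (u k)\<^sup>2" by (simp add: power2_eq_square)
    have "\<bar>S x\<bar> \<le> (\<Sum>l\<in>?W. La * \<bar>w l\<bar> * u k)"
      unfolding S_def by (rule order_trans[OF sum_abs sum_mono]) (rule Q_bound, auto)
    also have "\<dots> = (\<Sum>l\<in>?W. La * \<bar>w l\<bar>) * u k" by (simp add: sum_distrib_right)
    also have "\<dots> \<le> u k * u k"
      using window_u'[of k] \<open>0 \<le> La * \<bar>w k\<bar>\<close> u0 by (intro mult_right_mono) auto
    finally show "\<bar>S x\<bar> \<le> (u k)\<^sup>2" by (simp add: power2_eq_square)
  qed (rule u_le)
  have "I (Suc k) - I k = (\<integral>x. exp (psi (Suc k) x) - exp (psi k x) \<partial>U)"
    unfolding I_def by (rule Bochner_Integration.integral_diff[symmetric]) (intro integrable_U_cont cP)+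
  also have "\<dots> = (\<integral>x. G x * (exp (R x - S x) * (exp (X k x - Q k x) - 1) - E x) + G x * E x \<partial>U)"
    unfolding diff by (simp add: algebra_simps)
  also have "\<dots> = (\<integral>x. G x * (exp (R x - S x) * (exp (X k x - Q k x) - 1) - E x) \<partial>U) + (\<integral>x. G x * E x \<partial>U)"
    by (intro Bochner_Integration.integral_add integrable_U_cont continuous_intros cont X_cont Q_cont)
  finally have eq: "I (Suc k) - I k = \<dots>" .
  have "\<bar>\<integral>x. G x * (exp (R x - S x) * (exp (X k x - Q k x) - 1) - E x) \<partial>U\<bar>
     \<le> (\<integral>x. \<bar>G x * (exp (R x - S x) * (exp (X k x - Q k x) - 1) - E x)\<bar> \<partial>U)"
    by (rule integral_abs_bound)
  also have "\<dots> \<le> (\<integral>x. 80 * u k ^ 3 * G x \<partial>U)"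
    by (intro integral_U_mono_cont continuous_intros cont X_cont Q_cont)
       (use pt in \<open>auto simp: abs_mult G_def mult.commute intro!: mult_right_mono\<close>)
  also have "\<dots> = 80 * u k ^ 3 * I ?k" by (simp add: G_def I_def)
  finally have 1: "\<bar>\<integral>x. G x * (exp (R x - S x) * (exp (X k x - Q k x) - 1) - E x) \<partial>U\<bar> \<le> 80 * u k ^ 3 * I ?k" .
  have 2: "\<bar>\<integral>x. G x * E x \<partial>U\<bar> \<le> 2 * La * \<bar>w k\<bar> * th * I ?k"
    unfolding E_def G_def I_def R_def by (rule correlation)
  show ?thesis unfolding eq using 1 2 by (simp add: distrib_right)
qed

text \<open>A bootstrap: while the errors add up to at most 1/2, all earlier integrals are at most
  2, so each step changes the integral by at most twice its error. The induction is strong because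
  step \<open>j\<close> refers back to \<open>j - 2 * L\<close>.\<close>

lemma exp_psi_integral:
  defines "I \<equiv> \<lambda>k. \<integral>x. exp (psi k x) \<partial>U"
  assumes eta: "(\<Sum>k<K. 80 * u k ^ 3 + 2 * La * \<bar>w k\<bar> * th) \<le> eta" and "eta \<le> 1 / 2"
  shows "\<bar>I K - 1\<bar> \<le> 2 * eta"
proof -
  define e where "e = (\<lambda>k. 80 * u k ^ 3 + 2 * La * \<bar>w k\<bar> * th)"
  have th0: "0 \<le> th" unfolding th_def using La0 q1 by auto
  have e0: "0 \<le> e k" for k unfolding e_def using u0 La0 th0 by auto
  have I0: "I 0 = 1" unfolding I_def psi_def using U.prob_space by simp
  have main: "\<bar>I k - 1\<bar> \<le> 2 * (\<Sum>i<k. e i)" if "k \<le> K" for k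
    using that
  proof (induction k rule: less_induct)
    case (less k)
    show ?case
    proof (cases k)
      case 0 then show ?thesis using I0 by simp
    next
      case (Suc j)
      have "I (j - 2 * L) \<le> 1 + 2 * (\<Sum>i<j - 2 * L. e i)" using less.IH[of "j - 2 * L"] less.prems Suc by linarith
      also have "(\<Sum>i<j - 2 * L. e i) \<le> (\<Sum>i<K. e i)" using less.prems Suc e0 by (intro sum_mono2) auto
      also have "\<dots> \<le> 1 / 2" using assms(2,3) unfolding e_def by linarith
      finally have "I (j - 2 * L) \<le> 2" by simp
      then have "e j * I (j - 2 * L) \<le> e j * 2" using e0 by (intro mult_left_mono)
      moreover have "\<bar>I (Suc j) - I j\<bar> \<le> e j * I (j - 2 * L)" unfolding I_def e_def by (rule step)
      moreover have "\<bar>I j - 1\<bar> \<le> 2 * (\<Sum>i<j. e i)" using less Suc by auto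
      ultimately show ?thesis unfolding Suc by simp
    qed
  qed
  show ?thesis using main[of K] eta unfolding e_def by simp
qed

end

section \<open>Laplace transforms of weighted sums\<close>

lemma sum_swap_le:
  fixes f :: "nat \<Rightarrow> real"
  assumes "\<And>l. l < K \<Longrightarrow> 0 \<le> f l" "\<And>k. k < K \<Longrightarrow> W k \<subseteq> {..<K}"
    and n: "\<And>l. l < K \<Longrightarrow> card {k \<in> {..<K}. l \<in> W k} \<le> n"
  shows "(\<Sum>k<K. \<Sum>l\<in>W k. f l) \<le> real n * (\<Sum>l<K. f l)"
proof -
  have "(\<Sum>k<K. \<Sum>l\<in>W k. f l) = (\<Sum>k<K. \<Sum>l\<in>{l \<in> {..<K}. l \<in> W k}. f l)"
  proof (rule sum.cong[OF refl])
    fix k assume "k \<in> {..<K}"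
    then have "{l \<in> {..<K}. l \<in> W k} = W k" using assms(2)[of k] by auto
    then show "sum f (W k) = sum f {l \<in> {..<K}. l \<in> W k}" by simp
  qed
  also have "\<dots> = (\<Sum>l<K. \<Sum>k\<in>{k \<in> {..<K}. l \<in> W k}. f l)"
    by (rule sum.swap_restrict) auto
  also have "\<dots> = (\<Sum>l<K. real (card {k \<in> {..<K}. l \<in> W k}) * f l)" by simp
  also have "\<dots> \<le> (\<Sum>l<K. real n * f l)"
    using assms by (intro sum_mono mult_right_mono) auto
  finally show ?thesis by (simp add: sum_distrib_left)
qed

text \<open>One of the three factors is estimated by the supremum \<open>de\<close> of the weights,
  the other two by Cauchy-Schwarz; every index lies in at most \<open>n + 1\<close> windows. The
  gained factor \<open>de\<close> is what makes third-order errors negligible.\<close>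

lemma sum_cube_window_le:
  fixes w :: "nat \<Rightarrow> real"
  assumes w: "\<And>k. \<bar>w k\<bar> \<le> de"
  shows "(\<Sum>k<K. (\<Sum>l\<in>{k - n..k}. \<bar>w l\<bar>) ^ 3) \<le> (real n + 1) ^ 3 * de * (\<Sum>k<K. (w k)\<^sup>2)"
proof -
  have de0: "0 \<le> de" using w[of 0] by linarith
  have card: "real (card {k - n..k}) \<le> real n + 1" for k by simp
  have "(\<Sum>k<K. (\<Sum>l\<in>{k - n..k}. \<bar>w l\<bar>) ^ 3) \<le> (\<Sum>k<K. ((real n + 1) * de) * ((real n + 1) * (\<Sum>l\<in>{k - n..k}. (w l)\<^sup>2)))"
  proof (rule sum_mono)
    fix k
    let ?s = "\<Sum>l\<in>{k - n..k}. \<bar>w l\<bar>"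
    have "?s \<le> (\<Sum>l\<in>{k - n..k}. de)" by (intro sum_mono w)
    also have "\<dots> = real (card {k - n..k}) * de" by simp
    also have "\<dots> \<le> (real n + 1) * de" using card de0 by (intro mult_right_mono)
    finally have 1: "?s \<le> (real n + 1) * de" .
    have "?s\<^sup>2 \<le> (\<Sum>l\<in>{k - n..k}. \<bar>w l\<bar>\<^sup>2) * real (card {k - n..k})"
      by (rule sum_squared_le_sum_of_squares)
    also have "\<dots> \<le> (\<Sum>l\<in>{k - n..k}. \<bar>w l\<bar>\<^sup>2) * (real n + 1)"
      using card by (intro mult_left_mono sum_nonneg) auto
    finally have 2: "?s\<^sup>2 \<le> (real n + 1) * (\<Sum>l\<in>{k - n..k}. (w l)\<^sup>2)" by (simp add: mult.commute)
    have "?s ^ 3 = ?s * ?s\<^sup>2" by (simp add: eval_nat_numeral)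
    also have "\<dots> \<le> ((real n + 1) * de) * ((real n + 1) * (\<Sum>l\<in>{k - n..k}. (w l)\<^sup>2))"
      using 1 2 de0 by (intro mult_mono) (auto intro!: sum_nonneg)
    finally show "?s ^ 3 \<le> \<dots>" .
  qed
  also have "\<dots> = ((real n + 1) * de) * ((real n + 1) * (\<Sum>k<K. \<Sum>l\<in>{k - n..k}. (w l)\<^sup>2))"
    by (simp only: sum_distrib_left)
  also have "\<dots> \<le> ((real n + 1) * de) * ((real n + 1) * (real (n + 1) * (\<Sum>l<K. (w l)\<^sup>2)))"
  proof (intro mult_left_mono sum_swap_le)
    fix l
    have "card {k \<in> {..<K}. l \<in> {k - n..k}} \<le> card {l..l + n}" by (intro card_mono) auto
    then show "card {k \<in> {..<K}. l \<in> {k - n..k}} \<le> n + 1" by simp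
  qed (use de0 in auto)
  finally show ?thesis by (simp add: power3_eq_cube mult_ac add.commute)
qed

text \<open>A Schur test: the geometric kernel has row and column sums at most
  \<open>1 / (q - 1)\<close>, and \<open>|w k| * |w l|\<close> is replaced by half the sum of the
  squares.\<close>

lemma geometric_window_le:
  fixes w :: "nat \<Rightarrow> real" and q :: real
  assumes q: "1 < q"
  shows "(\<Sum>k<K. \<Sum>l<k. \<bar>w k\<bar> * \<bar>w l\<bar> * (1 / q) ^ (k - l)) \<le> (\<Sum>k<K. (w k)\<^sup>2) / (q - 1)"
proof -
  have g1: "(\<Sum>l<k. (1 / q) ^ (k - l)) \<le> 1 / (q - 1)" for k
  proof (induction k)
    case 0 then show ?case using q by simp
  next
    case (Suc k)
    have "(\<Sum>l<Suc k. (1 / q) ^ (Suc k - l)) = 1 / q * ((\<Sum>l<k. (1 / q) ^ (k - l)) + 1)"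
      by (simp add: Suc_diff_le sum_distrib_left distrib_left)
    also have "\<dots> \<le> 1 / q * (1 / (q - 1) + 1)" using Suc q by (intro mult_left_mono) auto
    also have "\<dots> = 1 / (q - 1)" using q by (simp add: field_simps)
    finally show ?case .
  qed
  have g2: "(\<Sum>k\<in>{k. k < K \<and> l < k}. (1 / q) ^ (k - l)) \<le> 1 / (q - 1)" for l
  proof -
    have "(\<Sum>k\<in>{k. k < K \<and> l < k}. (1 / q) ^ (k - l)) = (\<Sum>i\<in>{i. 0 < i \<and> i + l < K}. (1 / q) ^ i)"
      by (rule sum.reindex_bij_witness[of _ "\<lambda>i. i + l" "\<lambda>k. k - l"]) auto
    also have "\<dots> = (\<Sum>i\<in>{i. i < K - l - 1}. (1 / q) ^ (K - l - 1 - i))"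
      by (rule sum.reindex_bij_witness[of _ "\<lambda>i. K - l - 1 - i" "\<lambda>i. K - l - 1 - i"]) auto
    also have "\<dots> \<le> 1 / (q - 1)" using g1[of "K - l - 1"] by (simp add: lessThan_def)
    finally show ?thesis .
  qed
  have "(\<Sum>k<K. \<Sum>l<k. \<bar>w k\<bar> * \<bar>w l\<bar> * (1 / q) ^ (k - l))
      \<le> (\<Sum>k<K. \<Sum>l<k. ((w k)\<^sup>2 / 2) * (1 / q) ^ (k - l) + ((w l)\<^sup>2 / 2) * (1 / q) ^ (k - l))"
  proof (intro sum_mono)
    fix k l
    have "0 \<le> (\<bar>w k\<bar> - \<bar>w l\<bar>)\<^sup>2" by simp
    then have "\<bar>w k\<bar> * \<bar>w l\<bar> \<le> (w k)\<^sup>2 / 2 + (w l)\<^sup>2 / 2"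
      by (simp add: power2_diff)
    then have "\<bar>w k\<bar> * \<bar>w l\<bar> * (1 / q) ^ (k - l) \<le> ((w k)\<^sup>2 / 2 + (w l)\<^sup>2 / 2) * (1 / q) ^ (k - l)"
      using q by (intro mult_right_mono) auto
    then show "\<bar>w k\<bar> * \<bar>w l\<bar> * (1 / q) ^ (k - l) \<le> ((w k)\<^sup>2 / 2) * (1 / q) ^ (k - l) + ((w l)\<^sup>2 / 2) * (1 / q) ^ (k - l)"
      by (simp add: distrib_right)
  qed
  also have "\<dots> = (\<Sum>k<K. (w k)\<^sup>2 / 2 * (\<Sum>l<k. (1 / q) ^ (k - l))) + (\<Sum>k<K. \<Sum>l\<in>{l \<in> {..<K}. l < k}. (w l)\<^sup>2 / 2 * (1 / q) ^ (k - l))"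
  proof -
    have "{l \<in> {..<K}. l < k} = {..<k}" if "k < K" for k using that by auto
    then show ?thesis by (simp add: sum.distrib sum_distrib_left)
  qed
  also have "(\<Sum>k<K. \<Sum>l\<in>{l \<in> {..<K}. l < k}. (w l)\<^sup>2 / 2 * (1 / q) ^ (k - l)) = (\<Sum>l<K. \<Sum>k\<in>{k \<in> {..<K}. l < k}. (w l)\<^sup>2 / 2 * (1 / q) ^ (k - l))"
    by (rule sum.swap_restrict) auto
  also have "\<dots> = (\<Sum>l<K. (w l)\<^sup>2 / 2 * (\<Sum>k\<in>{k. k < K \<and> l < k}. (1 / q) ^ (k - l)))"
    by (simp add: sum_distrib_left)
  also have "(\<Sum>k<K. (w k)\<^sup>2 / 2 * (\<Sum>l<k. (1 / q) ^ (k - l))) + \<dots> \<le>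
     (\<Sum>k<K. (w k)\<^sup>2 / 2 * (1 / (q - 1))) + (\<Sum>l<K. (w l)\<^sup>2 / 2 * (1 / (q - 1)))"
    by (intro add_mono sum_mono mult_left_mono g1 g2) auto
  also have "\<dots> = (\<Sum>k<K. (w k)\<^sup>2) / (q - 1)"
  proof -
    have "a / 2 * t + a / 2 * t = a * t" for a t :: real by simp
    from this[of _ "1 / (q - 1)"] show ?thesis
      unfolding sum.distrib[symmetric] by (simp only:) (simp add: sum_divide_distrib)
  qed
  finally show ?thesis .
qed

section \<open>Size of the quadratic variation\<close>

context lag
begin

text \<open>A low frequency forces near cancellation, hence \<open>2 * |j|\<close> is at least
  \<open>|i| * q ^ (k - l)\<close>; the decay of \<open>c j\<close> turns this into a geometric
  factor together with \<open>1 / |i|\<close>. Since \<open>i\<close> determines \<open>j\<close>,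
  the sum runs over \<open>i\<close> only and is governed by \<open>ka\<close>, which for a series
  cut at \<open>D\<close> is of order \<open>1 / D\<close>.\<close>

lemma window_low:
  assumes decay: "\<And>j. j \<noteq> 0 \<Longrightarrow> cmod (c j) \<le> C / \<bar>of_int j\<bar>"
    and ka: "(\<Sum>j\<in>freqs H. cmod (c j) / \<bar>of_int j\<bar>) \<le> ka" and lk: "l \<le> k"
  shows "cmod (lowp k l x) \<le> 2 * C * ka * (1 / q) ^ (k - l)"
proof -
  have C0: "0 \<le> C" using order_trans[OF norm_ge_zero decay[of 1]] by simp
  have inj: "inj_on fst (low k l)"
  proof (rule inj_onI, clarify)
    fix i j i' j' assume a: "(i, j) \<in> low k l" "(i', j') \<in> low k l" "fst (i, j) = fst (i', j')"
    have "2 * \<bar>i * int (m k) + j * int (m l)\<bar> < int (m l)" "2 * \<bar>i * int (m k) + j' * int (m l)\<bar> < int (m l)"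
      using a by (auto simp: low_def)
    moreover have "\<bar>y - y'\<bar> < b" if "2 * \<bar>z + y\<bar> < b" "2 * \<bar>z + y'\<bar> < b" for z y y' b :: int
      using that by (simp add: abs_if split: if_splits)
    ultimately have "\<bar>j * int (m l) - j' * int (m l)\<bar> < int (m l)" by blast
    then have "\<bar>j - j'\<bar> * int (m l) < 1 * int (m l)" by (simp add: abs_mult flip: left_diff_distrib)
    then have "\<bar>j - j'\<bar> < 1" using m_pos[of l] by (simp only: mult_less_cancel_right)
    then show "i = i' \<and> j = j'" using a(3) by auto
  qed
  have one: "cmod (c (fst p) * c (snd p)) \<le> (cmod (c (fst p)) / \<bar>of_int (fst p)\<bar>) * (2 * C * (1 / q) ^ (k - l))"
    if p: "p \<in> low k l" for p
  proof -
    define i j where "i = fst p" and "j = snd p"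
    have ij: "i \<noteq> 0" "j \<noteq> 0" "2 * \<bar>i * int (m k) + j * int (m l)\<bar> < int (m l)"
      using p by (auto simp: low_def freqs_def i_def j_def)
    have mlk: "int (m l) \<le> int (m k)" using m_mono[OF lk] by simp
    have ik: "int (m k) \<le> \<bar>i * int (m k)\<bar>"
      using ij(1) mult_right_mono[of 1 "\<bar>i\<bar>" "int (m k)"] by (simp add: abs_mult)
    have "\<bar>a\<bar> \<le> 2 * \<bar>b\<bar>" if "2 * \<bar>a + b\<bar> < y" "y \<le> z" "z \<le> \<bar>a\<bar>" for a b y z :: int
      using that by (simp add: abs_if split: if_splits)
    then have "\<bar>i * int (m k)\<bar> \<le> 2 * \<bar>j * int (m l)\<bar>" using ij(3) mlk ik by blast
    then have "real_of_int \<bar>i * int (m k)\<bar> \<le> real_of_int (2 * \<bar>j * int (m l)\<bar>)" by (simp only: of_int_le_iff)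
    then have b: "\<bar>of_int i\<bar> * real (m k) \<le> 2 * \<bar>of_int j\<bar> * real (m l)" by (simp add: abs_mult)
    have "q ^ (k - l) * real (m l) \<le> real (m k)" by (rule m_pow[OF lk])
    then have "\<bar>of_int i\<bar> * (q ^ (k - l) * real (m l)) \<le> 2 * \<bar>of_int j\<bar> * real (m l)"
      using b mult_left_mono[of "q ^ (k - l) * real (m l)" "real (m k)" "\<bar>real_of_int i\<bar>"] by simp
    then have "(\<bar>of_int i\<bar> * q ^ (k - l)) * real (m l) \<le> (2 * \<bar>of_int j\<bar>) * real (m l)" by (simp add: mult_ac)
    then have "\<bar>of_int i\<bar> * q ^ (k - l) \<le> 2 * \<bar>real_of_int j\<bar>"
      using m_pos[of l] by (simp only: mult_le_cancel_right)
    then have d: "1 / \<bar>real_of_int j\<bar> \<le> 2 * (1 / q) ^ (k - l) / \<bar>of_int i\<bar>"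
      using ij q1 by (simp add: field_simps power_one_over)
    have "cmod (c j) \<le> C * (1 / \<bar>of_int j\<bar>)" using decay[OF ij(2)] by simp
    also have "\<dots> \<le> C * (2 * (1 / q) ^ (k - l) / \<bar>of_int i\<bar>)" using d C0 by (rule mult_left_mono)
    finally have "cmod (c i) * cmod (c j) \<le> cmod (c i) * (C * (2 * (1 / q) ^ (k - l) / \<bar>of_int i\<bar>))"
      by (rule mult_left_mono) simp
    then show ?thesis by (simp add: norm_mult mult_ac flip: i_def j_def)
  qed
  have "cmod (lowp k l x) \<le> (\<Sum>p\<in>low k l. cmod (c (fst p) * c (snd p)))"
    unfolding lowp_def by (rule order_trans[OF norm_sum]) (simp add: norm_mult)
  also have "\<dots> \<le> (\<Sum>p\<in>low k l. (cmod (c (fst p)) / \<bar>of_int (fst p)\<bar>) * (2 * C * (1 / q) ^ (k - l)))"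
    by (intro sum_mono one)
  also have "\<dots> = (\<Sum>i\<in>fst ` low k l. (cmod (c i) / \<bar>of_int i\<bar>) * (2 * C * (1 / q) ^ (k - l)))"
    by (rule sum.reindex[OF inj, symmetric, unfolded o_def])
  also have "\<dots> \<le> (\<Sum>i\<in>freqs H. (cmod (c i) / \<bar>of_int i\<bar>) * (2 * C * (1 / q) ^ (k - l)))"
    by (rule sum_mono2) (use C0 q1 in \<open>auto simp: low_def\<close>)
  also have "\<dots> = (\<Sum>i\<in>freqs H. cmod (c i) / \<bar>of_int i\<bar>) * (2 * C * (1 / q) ^ (k - l))"
    by (rule sum_distrib_right[symmetric])
  also have "\<dots> \<le> ka * (2 * C * (1 / q) ^ (k - l))"
    using ka C0 q1 by (intro mult_right_mono) auto
  finally show ?thesis by (simp add: mult_ac)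
qed

text \<open>The part of the summed compensators that depends on arithmetic coincidences among the
  \<open>m k\<close>; by \<open>sum_Q\<close> the rest is half the Gaussian variance.\<close>

definition noise :: "nat \<Rightarrow> real \<Rightarrow> real" where
  "noise K x = (\<Sum>k<K. \<Sum>l\<in>{k - 2 * L..<k}. w k * w l * Re (lowp k l x))"

lemma sum_Q: "(\<Sum>k<K. Q k x) = noise K x + (\<Sum>k<K. (w k)\<^sup>2) / 2 * (\<Sum>j\<in>freqs H. (cmod (c j))\<^sup>2)"
  unfolding Q_def noise_def sum.distrib by (simp add: sum_distrib_right sum_divide_distrib)

lemma noise_bound:
  assumes decay: "\<And>j. j \<noteq> 0 \<Longrightarrow> cmod (c j) \<le> C / \<bar>of_int j\<bar>"
    and ka: "(\<Sum>j\<in>freqs H. cmod (c j) / \<bar>of_int j\<bar>) \<le> ka"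
  shows "\<bar>noise K x\<bar> \<le> C * ka * (2 / (q - 1)) * (\<Sum>k<K. (w k)\<^sup>2)"
proof -
  have C0: "0 \<le> C" using order_trans[OF norm_ge_zero decay[of 1]] by simp
  have ka0: "0 \<le> ka" using ka by (rule order_trans[rotated]) (auto intro!: sum_nonneg)
  have "\<bar>noise K x\<bar> \<le> (\<Sum>k<K. \<Sum>l\<in>{k - 2 * L..<k}. \<bar>w k\<bar> * \<bar>w l\<bar> * (2 * C * ka * (1 / q) ^ (k - l)))"
    unfolding noise_def
    by (intro order_trans[OF sum_abs] sum_mono)
       (auto simp: abs_mult intro!: mult_left_mono order_trans[OF abs_Re_le_cmod window_low[OF decay ka]])
  also have "\<dots> \<le> (\<Sum>k<K. \<Sum>l<k. \<bar>w k\<bar> * \<bar>w l\<bar> * (2 * C * ka * (1 / q) ^ (k - l)))"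
    using C0 ka0 q1 by (intro sum_mono sum_mono2) auto
  also have "\<dots> = 2 * C * ka * (\<Sum>k<K. \<Sum>l<k. \<bar>w k\<bar> * \<bar>w l\<bar> * (1 / q) ^ (k - l))"
    by (simp add: sum_distrib_left mult_ac)
  also have "\<dots> \<le> 2 * C * ka * ((\<Sum>k<K. (w k)\<^sup>2) / (q - 1))"
    using C0 ka0 by (intro mult_left_mono geometric_window_le q1) auto
  finally show ?thesis by (simp add: mult_ac)
qed

text \<open>The variance is estimated by \<open>C * ka\<close> as well, so the whole bound is small
  together with \<open>ka\<close>; the 1/2 stems from the variance, the \<open>2 / (q - 1)\<close>
  from the noise.\<close>

lemma sum_Q_bound:
  assumes decay: "\<And>j. j \<noteq> 0 \<Longrightarrow> cmod (c j) \<le> C / \<bar>of_int j\<bar>"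
    and ka: "(\<Sum>j\<in>freqs H. cmod (c j) / \<bar>of_int j\<bar>) \<le> ka"
  shows "\<bar>\<Sum>k<K. Q k x\<bar> \<le> C * ka * (1 / 2 + 2 / (q - 1)) * (\<Sum>k<K. (w k)\<^sup>2)"
proof -
  have C0: "0 \<le> C" using order_trans[OF norm_ge_zero decay[of 1]] by simp
  let ?s = "\<Sum>j\<in>freqs H. (cmod (c j))\<^sup>2"
  have "?s \<le> (\<Sum>j\<in>freqs H. C * (cmod (c j) / \<bar>of_int j\<bar>))"
  proof (rule sum_mono)
    fix j assume "j \<in> freqs H"
    then have "cmod (c j) \<le> C / \<bar>of_int j\<bar>" by (intro decay) (auto simp: freqs_def)
    then have "cmod (c j) * cmod (c j) \<le> cmod (c j) * (C / \<bar>of_int j\<bar>)" by (intro mult_left_mono) auto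
    then show "(cmod (c j))\<^sup>2 \<le> C * (cmod (c j) / \<bar>of_int j\<bar>)" by (simp add: power2_eq_square mult_ac)
  qed
  also have "\<dots> = C * (\<Sum>j\<in>freqs H. cmod (c j) / \<bar>of_int j\<bar>)" by (rule sum_distrib_left[symmetric])
  also have "\<dots> \<le> C * ka" using ka C0 by (rule mult_left_mono)
  finally have s: "?s \<le> C * ka" .
  have "0 \<le> ?s" by (intro sum_nonneg) auto
  then have "\<bar>(\<Sum>k<K. (w k)\<^sup>2) / 2 * ?s\<bar> = (\<Sum>k<K. (w k)\<^sup>2) / 2 * ?s" by (intro abs_of_nonneg mult_nonneg_nonneg divide_nonneg_nonneg sum_nonneg) auto
  also have "\<dots> \<le> (\<Sum>k<K. (w k)\<^sup>2) / 2 * (C * ka)" by (intro mult_left_mono s divide_nonneg_nonneg sum_nonneg) auto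
  finally have "\<bar>(\<Sum>k<K. (w k)\<^sup>2) / 2 * ?s\<bar> \<le> (\<Sum>k<K. (w k)\<^sup>2) / 2 * (C * ka)" .
  moreover have "\<bar>noise K x\<bar> \<le> C * ka * (2 / (q - 1)) * (\<Sum>k<K. (w k)\<^sup>2)" by (rule noise_bound[OF decay ka])
  ultimately have "\<bar>\<Sum>k<K. Q k x\<bar> \<le> C * ka * (2 / (q - 1)) * (\<Sum>k<K. (w k)\<^sup>2) + (\<Sum>k<K. (w k)\<^sup>2) / 2 * (C * ka)"
    unfolding sum_Q by linarith
  then show ?thesis by (simp add: algebra_simps)
qed

lemma error_sum:
  assumes w: "\<And>k. \<bar>w k\<bar> \<le> de"
  shows "(\<Sum>k<K. 80 * u k ^ 3 + 2 * La * \<bar>w k\<bar> * th) \<le>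
     80 * La1 ^ 3 * (4 * real L + 1) ^ 3 * de * (\<Sum>k<K. (w k)\<^sup>2) + 2 * La * th * (\<Sum>k<K. \<bar>w k\<bar>)"
proof -
  have "(\<Sum>k<K. u k ^ 3) = La1 ^ 3 * (\<Sum>k<K. (\<Sum>l\<in>{k - 4 * L..k}. \<bar>w l\<bar>) ^ 3)"
    unfolding u_def power_mult_distrib by (rule sum_distrib_left[symmetric])
  also have "\<dots> \<le> La1 ^ 3 * ((real (4 * L) + 1) ^ 3 * de * (\<Sum>k<K. (w k)\<^sup>2))"
    using La1 by (intro mult_left_mono sum_cube_window_le w) auto
  finally have "(\<Sum>k<K. u k ^ 3) \<le> La1 ^ 3 * (4 * real L + 1) ^ 3 * de * (\<Sum>k<K. (w k)\<^sup>2)"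
    by (simp add: mult_ac)
  then have "80 * (\<Sum>k<K. u k ^ 3) \<le> 80 * (La1 ^ 3 * (4 * real L + 1) ^ 3 * de * (\<Sum>k<K. (w k)\<^sup>2))" by simp
  then show ?thesis by (simp add: sum.distrib sum_distrib_left mult_ac)
qed

lemma exp_sum_split: "exp (\<Sum>k<K. X k x) = exp (psi K x) * exp (\<Sum>k<K. Q k x)"
  by (simp add: psi_def sum_subtractf flip: exp_add)

end

text \<open>Orthogonality of the characters leaves only pairs with equal frequencies; there are at
  most \<open>N\<close> of them for each index, and \<open>z a * z b\<close> is split into
  squares.\<close>

lemma trig_L2_le:
  fixes z :: "'a \<Rightarrow> real" and v :: "'a \<Rightarrow> int"
  assumes A: "finite A" and N: "\<And>a. a \<in> A \<Longrightarrow> card {b \<in> A. v b = v a} \<le> N"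
  shows "(\<integral>x. (cmod (\<Sum>a\<in>A. of_real (z a) * ee (v a) x))\<^sup>2 \<partial>U) \<le> real N * (\<Sum>a\<in>A. (z a)\<^sup>2)"
proof -
  let ?S = "\<lambda>x. \<Sum>a\<in>A. of_real (z a) * ee (v a) x"
  have sq: "of_real ((cmod (?S x))\<^sup>2) = (\<Sum>a\<in>A. \<Sum>b\<in>A. of_real (z a * z b) * ee (v a - v b) x)" for x
  proof -
    have "of_real ((cmod (?S x))\<^sup>2) = ?S x * cnj (?S x)" by (rule complex_norm_square)
    also have "cnj (?S x) = (\<Sum>b\<in>A. of_real (z b) * ee (- v b) x)" by (simp add: cnj_ee)
    also have "?S x * \<dots> = (\<Sum>a\<in>A. \<Sum>b\<in>A. of_real (z a * z b) * ee (v a - v b) x)"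
      unfolding sum_product by (intro sum.cong) (auto simp: ee_add[of _ "- _", simplified] mult_ac)
    finally show ?thesis .
  qed
  have "complex_of_real (\<integral>x. (cmod (?S x))\<^sup>2 \<partial>U) = (\<integral>x. of_real ((cmod (?S x))\<^sup>2) \<partial>U)"
    by (rule integral_complex_of_real[symmetric])
  also have "\<dots> = (\<integral>x. (\<Sum>a\<in>A. \<Sum>b\<in>A. of_real (z a * z b) * ee (v a - v b) x) \<partial>U)"
    by (simp only: sq)
  also have "\<dots> = (\<Sum>a\<in>A. \<Sum>b\<in>A. \<integral>x. of_real (z a * z b) * ee (v a - v b) x \<partial>U)"
  proof -
    have "(\<integral>x. (\<Sum>a\<in>A. \<Sum>b\<in>A. of_real (z a * z b) * ee (v a - v b) x) \<partial>U)
        = (\<Sum>a\<in>A. \<integral>x. (\<Sum>b\<in>A. of_real (z a * z b) * ee (v a - v b) x) \<partial>U)"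
      by (rule Bochner_Integration.integral_sum) (intro integrable_U_cont continuous_intros)
    also have "\<dots> = (\<Sum>a\<in>A. \<Sum>b\<in>A. \<integral>x. of_real (z a * z b) * ee (v a - v b) x \<partial>U)"
      by (intro sum.cong refl Bochner_Integration.integral_sum integrable_U_cont continuous_intros)
    finally show ?thesis .
  qed
  also have "\<dots> = (\<Sum>a\<in>A. \<Sum>b\<in>A. of_real (z a * z b) * (if v a - v b = 0 then 1 else 0))"
    by (simp only: integral_mult_right_zero integral_ee)
  also have "\<dots> = of_real (\<Sum>a\<in>A. \<Sum>b\<in>{b \<in> A. v b = v a}. z a * z b)"
    unfolding of_real_sum
  proof (rule sum.cong[OF refl])
    fix a
    show "(\<Sum>b\<in>A. of_real (z a * z b) * (if v a - v b = 0 then 1 else 0)) = (\<Sum>b\<in>{b \<in> A. v b = v a}. complex_of_real (z a * z b))"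
      by (rule sum.mono_neutral_cong_right) (use A in auto)
  qed
  finally have "(\<integral>x. (cmod (?S x))\<^sup>2 \<partial>U) = (\<Sum>a\<in>A. \<Sum>b\<in>{b \<in> A. v b = v a}. z a * z b)"
    using of_real_eq_iff by blast
  also have "\<dots> \<le> (\<Sum>a\<in>A. \<Sum>b\<in>{b \<in> A. v b = v a}. (z a)\<^sup>2 / 2 + (z b)\<^sup>2 / 2)"
  proof (intro sum_mono)
    fix a b
    have "0 \<le> (z a - z b)\<^sup>2" by simp
    then show "z a * z b \<le> (z a)\<^sup>2 / 2 + (z b)\<^sup>2 / 2" by (simp add: power2_diff)
  qed
  also have "\<dots> = (\<Sum>a\<in>A. \<Sum>b\<in>{b \<in> A. v b = v a}. (z a)\<^sup>2 / 2) + (\<Sum>a\<in>A. \<Sum>b\<in>{b \<in> A. v b = v a}. (z b)\<^sup>2 / 2)"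
    by (simp only: sum.distrib)
  also have "(\<Sum>a\<in>A. \<Sum>b\<in>{b \<in> A. v b = v a}. (z b)\<^sup>2 / 2) = (\<Sum>b\<in>A. \<Sum>a\<in>{a \<in> A. v b = v a}. (z b)\<^sup>2 / 2)"
    by (rule sum.swap_restrict) (use A in auto)
  also have "(\<Sum>a\<in>A. \<Sum>b\<in>{b \<in> A. v b = v a}. (z a)\<^sup>2 / 2) + \<dots> = (\<Sum>a\<in>A. real (card {b \<in> A. v b = v a}) * (z a)\<^sup>2)"
  proof -
    have "{a \<in> A. v b = v a} = {a \<in> A. v a = v b}" for b by auto
    then show ?thesis by (simp add: mult.commute flip: sum.distrib)
  qed
  also have "\<dots> \<le> (\<Sum>a\<in>A. real N * (z a)\<^sup>2)"
    by (intro sum_mono mult_right_mono) (use N in auto)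
  finally show ?thesis by (simp add: sum_distrib_left)
qed

lemma weighted_Cauchy_Schwarz:
  fixes a b :: "'a \<Rightarrow> real"
  assumes "\<And>i. i \<in> I \<Longrightarrow> 0 \<le> a i"
  shows "(\<Sum>i\<in>I. a i * b i)\<^sup>2 \<le> (\<Sum>i\<in>I. a i) * (\<Sum>i\<in>I. a i * (b i)\<^sup>2)"
proof -
  have "(\<Sum>i\<in>I. sqrt (a i) * (sqrt (a i) * b i))\<^sup>2 \<le> (\<Sum>i\<in>I. (sqrt (a i))\<^sup>2) * (\<Sum>i\<in>I. (sqrt (a i) * b i)\<^sup>2)"
    by (rule Cauchy_Schwarz_ineq_sum)
  moreover have "(\<Sum>i\<in>I. sqrt (a i) * (sqrt (a i) * b i)) = (\<Sum>i\<in>I. a i * b i)"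
    using assms by (intro sum.cong) (auto simp flip: mult.assoc)
  moreover have "(\<Sum>i\<in>I. (sqrt (a i))\<^sup>2) = (\<Sum>i\<in>I. a i)" using assms by (intro sum.cong) auto
  moreover have "(\<Sum>i\<in>I. (sqrt (a i) * b i)\<^sup>2) = (\<Sum>i\<in>I. a i * (b i)\<^sup>2)"
    using assms by (intro sum.cong) (auto simp: power_mult_distrib)
  ultimately show ?thesis by simp
qed

context lag
begin

lemma noise_cont: "continuous_on UNIV (noise K)"
  unfolding noise_def[abs_def] lowp_def by (intro continuous_intros)

text \<open>For each fixed pair of multipliers the frequencies \<open>i * m k + j * m l\<close>
  repeat at most \<open>N\<close> times, so \<open>trig_L2_le\<close> applies; a Cauchy-Schwarz
  inequality weighted by the coefficients combines the pairs. The factor \<open>de\<^sup>2\<close>,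
  absent from the pointwise bound, appears because squares of products of weights are
  summed.\<close>

lemma noise_L2:
  assumes w: "\<And>k. \<bar>w k\<bar> \<le> de"
    and dioph: "\<And>p v. p \<in> freqs H \<times> freqs H \<Longrightarrow>
        card {(k, l). k < K \<and> l < k \<and> fst p * int (m k) + snd p * int (m l) = v} \<le> N"
  shows "(\<integral>x. (noise K x)\<^sup>2 \<partial>U) \<le> La ^ 4 * real N * (2 * real L * de\<^sup>2 * (\<Sum>k<K. (w k)\<^sup>2))"
proof -
  let ?J = "freqs H \<times> freqs H"
  let ?P = "Sigma {..<K} (\<lambda>k. {k - 2 * L..<k})"
  let ?Pp = "\<lambda>p. {r \<in> ?P. p \<in> low (fst r) (snd r)}"
  let ?v = "\<lambda>p r. fst p * int (m (fst r)) + snd p * int (m (snd r))"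
  let ?zz = "\<lambda>r. w (fst r) * w (snd r)"
  define Z where "Z = (\<lambda>p x. \<Sum>r\<in>?Pp p. of_real (?zz r) * ee (?v p r) x)"
  let ?a = "\<lambda>p. cmod (c (fst p) * c (snd p))"
  have fin: "finite ?P" "finite (?Pp p)" for p by (auto intro: finite_SigmaI)
  have Zc: "continuous_on UNIV (Z p)" for p unfolding Z_def by (intro continuous_intros)
  have noise: "noise K x = Re (\<Sum>p\<in>?J. (c (fst p) * c (snd p)) * Z p x)" for x
  proof -
    have "noise K x = Re (\<Sum>r\<in>?P. of_real (?zz r) * lowp (fst r) (snd r) x)"
      unfolding noise_def by (subst sum.Sigma) (auto simp: case_prod_beta)
    also have "(\<Sum>r\<in>?P. of_real (?zz r) * lowp (fst r) (snd r) x) =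
        (\<Sum>r\<in>?P. \<Sum>p\<in>{p \<in> ?J. p \<in> low (fst r) (snd r)}. of_real (?zz r) * (c (fst p) * c (snd p) * ee (?v p r) x))"
    proof (rule sum.cong[OF refl])
      fix r
      have "{p \<in> ?J. p \<in> low (fst r) (snd r)} = low (fst r) (snd r)" using low_subset by blast
      then show "of_real (?zz r) * lowp (fst r) (snd r) x = (\<Sum>p\<in>{p \<in> ?J. p \<in> low (fst r) (snd r)}. of_real (?zz r) * (c (fst p) * c (snd p) * ee (?v p r) x))"
        unfolding lowp_def by (simp only: sum_distrib_left)
    qed
    also have "\<dots> = (\<Sum>p\<in>?J. \<Sum>r\<in>?Pp p. of_real (?zz r) * (c (fst p) * c (snd p) * ee (?v p r) x))"
      by (rule sum.swap_restrict) (use fin in auto)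
    also have "\<dots> = (\<Sum>p\<in>?J. (c (fst p) * c (snd p)) * Z p x)"
      unfolding Z_def sum_distrib_left by (simp only: mult_ac)
    finally show ?thesis .
  qed
  have pt: "(noise K x)\<^sup>2 \<le> (La * La) * (\<Sum>p\<in>?J. ?a p * (cmod (Z p x))\<^sup>2)" for x
  proof -
    have "\<bar>noise K x\<bar> \<le> (\<Sum>p\<in>?J. ?a p * cmod (Z p x))"
      unfolding noise by (rule order_trans[OF abs_Re_le_cmod]) (rule order_trans[OF norm_sum], simp add: norm_mult)
    then have "\<bar>noise K x\<bar>\<^sup>2 \<le> (\<Sum>p\<in>?J. ?a p * cmod (Z p x))\<^sup>2" by (intro power_mono) auto
    also have "\<dots> \<le> (\<Sum>p\<in>?J. ?a p) * (\<Sum>p\<in>?J. ?a p * (cmod (Z p x))\<^sup>2)"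
      by (rule weighted_Cauchy_Schwarz) auto
    also have "\<dots> \<le> (La * La) * (\<Sum>p\<in>?J. ?a p * (cmod (Z p x))\<^sup>2)"
      by (intro mult_right_mono sum_low_le sum_nonneg) auto
    finally show ?thesis by simp
  qed
  let ?D = "2 * real L * de\<^sup>2 * (\<Sum>k<K. (w k)\<^sup>2)"
  have zz: "(\<Sum>r\<in>?P. (?zz r)\<^sup>2) \<le> ?D"
  proof -
    have "(\<Sum>r\<in>?P. (?zz r)\<^sup>2) = (\<Sum>k<K. \<Sum>l\<in>{k - 2 * L..<k}. (w k)\<^sup>2 * (w l)\<^sup>2)"
      by (subst sum.Sigma) (auto simp: case_prod_beta power_mult_distrib)
    also have "\<dots> \<le> (\<Sum>k<K. \<Sum>l\<in>{k - 2 * L..<k}. (w k)\<^sup>2 * de\<^sup>2)"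
      using power_mono[OF w, of _ 2] by (intro sum_mono mult_left_mono) auto
    also have "\<dots> = (\<Sum>k<K. real (card {k - 2 * L..<k}) * ((w k)\<^sup>2 * de\<^sup>2))" by simp
    also have "\<dots> \<le> (\<Sum>k<K. (2 * real L) * ((w k)\<^sup>2 * de\<^sup>2))"
      by (intro sum_mono mult_right_mono) auto
    finally show ?thesis by (simp add: sum_distrib_left sum_distrib_right mult_ac)
  qed
  have one: "(\<integral>x. (cmod (Z p x))\<^sup>2 \<partial>U) \<le> real N * ?D" if p: "p \<in> ?J" for p
  proof -
    have "(\<integral>x. (cmod (Z p x))\<^sup>2 \<partial>U) \<le> real N * (\<Sum>r\<in>?Pp p. (?zz r)\<^sup>2)"
      unfolding Z_def
    proof (rule trig_L2_le[OF fin(2)])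
      fix r
      let ?T = "{(k, l). k < K \<and> l < k \<and> fst p * int (m k) + snd p * int (m l) = ?v p r}"
      have "card {b \<in> ?Pp p. ?v p b = ?v p r} \<le> card ?T"
        by (rule card_mono) (auto intro: finite_subset[of _ "{..<K} \<times> {..<K}"])
      also have "\<dots> \<le> N" by (rule dioph[OF p])
      finally show "card {b \<in> ?Pp p. ?v p b = ?v p r} \<le> N" .
    qed
    also have "\<dots> \<le> real N * (\<Sum>r\<in>?P. (?zz r)\<^sup>2)"
      by (intro mult_left_mono sum_mono2 fin) auto
    also have "\<dots> \<le> real N * ?D" by (intro mult_left_mono zz) auto
    finally show ?thesis .
  qed
  have D0: "0 \<le> real N * ?D" by (intro mult_nonneg_nonneg sum_nonneg) auto
  have "(\<integral>x. (noise K x)\<^sup>2 \<partial>U) \<le> (\<integral>x. (La * La) * (\<Sum>p\<in>?J. ?a p * (cmod (Z p x))\<^sup>2) \<partial>U)"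
    by (intro integral_U_mono_cont continuous_intros noise_cont Zc pt)
  also have "\<dots> = (La * La) * (\<Sum>p\<in>?J. ?a p * (\<integral>x. (cmod (Z p x))\<^sup>2 \<partial>U))"
    by (simp add: Bochner_Integration.integral_sum integrable_U_cont continuous_intros Zc)
  also have "\<dots> \<le> (La * La) * (\<Sum>p\<in>?J. ?a p * (real N * ?D))"
    using La0 by (intro mult_left_mono sum_mono one) auto
  also have "\<dots> = (La * La) * ((\<Sum>p\<in>?J. ?a p) * (real N * ?D))" by (simp only: sum_distrib_right)
  also have "\<dots> \<le> (La * La) * ((La * La) * (real N * ?D))"
    using La0 D0 by (intro mult_left_mono mult_right_mono sum_low_le) auto
  finally show ?thesis by (simp add: eval_nat_numeral mult_ac)
qed

end

text \<open>The right side of \<open>error_sum\<close> with \<open>La\<close> and \<open>La1\<close>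
  both equal to \<open>B\<close>, as a function of the supremum \<open>de\<close>, the sum of
  squares \<open>W2\<close> and the sum of moduli \<open>W1\<close> of the weights.\<close>

definition lap_err :: "real \<Rightarrow> real \<Rightarrow> nat \<Rightarrow> nat \<Rightarrow> real \<Rightarrow> real \<Rightarrow> real \<Rightarrow> real" where
  "lap_err q B H L de W2 W1 = 80 * B ^ 3 * (4 * real L + 1) ^ 3 * de * W2
     + 2 * B * (2 * B * (real H + 1) / ((q - 1) * q ^ L)) * W1"

context lacunary
begin

lemma lagI:
  assumes "\<And>j. c (- j) = cnj (c j)" "(\<Sum>j\<in>freqs H. cmod (c j)) \<le> B" "1 \<le> B" "2 * real H \<le> q ^ L"
    and w: "\<And>k. \<bar>w k\<bar> \<le> de" and "de \<le> 1" and B: "B * (4 * real L + 1) * de \<le> 1 / 4"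
  shows "lag m q c H w L B B"
proof unfold_locales
  fix k
  have de0: "0 \<le> de" using w[of 0] by linarith
  have "B * (\<Sum>l\<in>{k - 4 * L..k}. \<bar>w l\<bar>) \<le> B * (\<Sum>l\<in>{k - 4 * L..k}. de)"
    using assms by (intro mult_left_mono sum_mono w) auto
  also have "\<dots> = B * (real (card {k - 4 * L..k}) * de)" by simp
  also have "\<dots> \<le> B * ((4 * real L + 1) * de)"
    using assms de0 by (intro mult_left_mono mult_right_mono) auto
  finally show "B * (\<Sum>l\<in>{k - 4 * L..k}. \<bar>w l\<bar>) \<le> 1 / 4" using B by (simp add: mult.assoc)
  show "\<bar>w k\<bar> \<le> 1" using w[of k] \<open>de \<le> 1\<close> by simp
qed (use assms in auto)

text \<open>The compensated exponential has integral at most 2, and the compensator is then removed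
  at the price of its supremum.\<close>

theorem laplace_crude:
  assumes cnj_c: "\<And>j. c (- j) = cnj (c j)" and B: "(\<Sum>j\<in>freqs H. cmod (c j)) \<le> B" "1 \<le> B"
    and qL: "2 * real H \<le> q ^ L" and w: "\<And>k. \<bar>w k\<bar> \<le> de" and de: "de \<le> 1" "B * (4 * real L + 1) * de \<le> 1 / 4"
    and err: "lap_err q B H L de (\<Sum>k<K. (w k)\<^sup>2) (\<Sum>k<K. \<bar>w k\<bar>) \<le> 1 / 2"
    and decay: "\<And>j. j \<noteq> 0 \<Longrightarrow> cmod (c j) \<le> C / \<bar>of_int j\<bar>"
    and ka: "(\<Sum>j\<in>freqs H. cmod (c j) / \<bar>of_int j\<bar>) \<le> ka"
  shows "(\<integral>x. exp (\<Sum>k<K. w k * tp c H (real (m k) * x)) \<partial>U)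
     \<le> 2 * exp (C * ka * (1 / 2 + 2 / (q - 1)) * (\<Sum>k<K. (w k)\<^sup>2))"
proof -
  interpret lag m q c H w L B B by (rule lagI[OF cnj_c B qL w de])
  let ?E = "C * ka * (1 / 2 + 2 / (q - 1)) * (\<Sum>k<K. (w k)\<^sup>2)"
  have "\<bar>(\<integral>x. exp (psi K x) \<partial>U) - 1\<bar> \<le> 2 * (1 / 2)"
  proof (rule exp_psi_integral)
    show "(\<Sum>k<K. 80 * u k ^ 3 + 2 * B * \<bar>w k\<bar> * th) \<le> 1 / 2"
      using error_sum[OF w, of K] err unfolding lap_err_def th_def by simp
  qed simp
  then have 1: "(\<integral>x. exp (psi K x) \<partial>U) \<le> 2" by linarith
  have "(\<integral>x. exp (\<Sum>k<K. X k x) \<partial>U) \<le> (\<integral>x. exp ?E * exp (psi K x) \<partial>U)"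
  proof (intro integral_U_mono_cont continuous_intros X_cont psi_cont)
    fix x
    have "(\<Sum>k<K. Q k x) \<le> ?E" using sum_Q_bound[OF decay ka, where K = K and x = x] by linarith
    then show "exp (\<Sum>k<K. X k x) \<le> exp ?E * exp (psi K x)"
      unfolding exp_sum_split by (simp add: mult.commute)
  qed
  also have "\<dots> = exp ?E * (\<integral>x. exp (psi K x) \<partial>U)" by simp
  also have "\<dots> \<le> exp ?E * 2" using 1 by (intro mult_left_mono) auto
  finally show ?thesis by (simp add: X_def mult.commute)
qed

text \<open>The normalised exponential equals \<open>exp (psi K x) * exp (noise K x)\<close>, and
  the noise factor is removed in \<open>L^1\<close>. This needs the second exponential moment of the
  sum, which \<open>laplace_crude\<close> supplies for the weights \<open>2 * w k\<close>; hence the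
  error conditions are imposed for doubled weights.\<close>

theorem laplace_exact:
  assumes cnj_c: "\<And>j. c (- j) = cnj (c j)" and B: "(\<Sum>j\<in>freqs H. cmod (c j)) \<le> B" "1 \<le> B"
    and qL: "2 * real H \<le> q ^ L" and w: "\<And>k. \<bar>w k\<bar> \<le> de" and de: "2 * de \<le> 1" "B * (4 * real L + 1) * (2 * de) \<le> 1 / 4" "0 < de"
    and err: "lap_err q B H L (2 * de) (4 * (\<Sum>k<K. (w k)\<^sup>2)) (2 * (\<Sum>k<K. \<bar>w k\<bar>)) \<le> eta" and eta: "eta \<le> 1 / 2"
    and decay: "\<And>j. j \<noteq> 0 \<Longrightarrow> cmod (c j) \<le> C / \<bar>of_int j\<bar>"
    and ka: "(\<Sum>j\<in>freqs H. cmod (c j) / \<bar>of_int j\<bar>) \<le> ka"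
    and dioph: "\<And>p v. p \<in> freqs H \<times> freqs H \<Longrightarrow>
        card {(k, l). k < K \<and> l < k \<and> fst p * int (m k) + snd p * int (m l) = v} \<le> N"
  defines "W2 \<equiv> \<Sum>k<K. (w k)\<^sup>2"
  shows "\<bar>exp (- (\<Sum>j\<in>freqs H. (cmod (c j))\<^sup>2) * W2 / 2) * (\<integral>x. exp (\<Sum>k<K. w k * tp c H (real (m k) * x)) \<partial>U) - 1\<bar>
     \<le> 2 * eta + exp (2 * (C * ka * (2 / (q - 1)) * W2)) * de *
        (exp (4 * (C * ka * (1 / 2 + 2 / (q - 1)) * W2)) + B ^ 4 * real N * real L * W2)"
proof -
  have de2: "B * (4 * real L + 1) * de \<le> 1 / 4"
  proof (rule order_trans[OF _ de(2)])
    show "B * (4 * real L + 1) * de \<le> B * (4 * real L + 1) * (2 * de)"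
      using de(3) B by (intro mult_left_mono) auto
  qed
  interpret lag m q c H w L B B by (rule lagI[OF cnj_c B qL w _ de2]) (use de in auto)
  define s where "s = (\<Sum>j\<in>freqs H. (cmod (c j))\<^sup>2)"
  define C1 where "C1 = C * ka * (1 / 2 + 2 / (q - 1)) * W2"
  define C2 where "C2 = C * ka * (2 / (q - 1)) * W2"
  have W20: "0 \<le> W2" unfolding W2_def by (intro sum_nonneg) auto
  have W10: "0 \<le> (\<Sum>k<K. \<bar>w k\<bar>)" by (intro sum_nonneg) auto
  have err2: "lap_err q B H L de W2 (\<Sum>k<K. \<bar>w k\<bar>) \<le> eta"
  proof (rule order_trans[OF _ err])
    have "80 * B ^ 3 * (4 * real L + 1) ^ 3 * de * W2 \<le> 80 * B ^ 3 * (4 * real L + 1) ^ 3 * (2 * de) * (4 * W2)"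
      using de B W20 by (intro mult_mono mult_nonneg_nonneg) auto
    moreover have "2 * B * (2 * B * (real H + 1) / ((q - 1) * q ^ L)) * (\<Sum>k<K. \<bar>w k\<bar>) \<le> 2 * B * (2 * B * (real H + 1) / ((q - 1) * q ^ L)) * (2 * (\<Sum>k<K. \<bar>w k\<bar>))"
      using B q1 W10 by (intro mult_left_mono mult_nonneg_nonneg divide_nonneg_nonneg) auto
    ultimately show "lap_err q B H L de W2 (\<Sum>k<K. \<bar>w k\<bar>) \<le> lap_err q B H L (2 * de) (4 * (\<Sum>k<K. (w k)\<^sup>2)) (2 * (\<Sum>k<K. \<bar>w k\<bar>))"
      unfolding lap_err_def W2_def by linarith
  qed
  have F: "\<bar>(\<integral>x. exp (psi K x) \<partial>U) - 1\<bar> \<le> 2 * eta"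
  proof (rule exp_psi_integral[OF _ eta])
    show "(\<Sum>k<K. 80 * u k ^ 3 + 2 * B * \<bar>w k\<bar> * th) \<le> eta"
      using error_sum[OF w, of K] err2 unfolding lap_err_def th_def W2_def by simp
  qed
  have dbl: "(\<integral>x. exp (2 * (\<Sum>k<K. X k x)) \<partial>U) \<le> 2 * exp (4 * C1)"
  proof -
    have a: "(\<Sum>k<K. (2 * w k)\<^sup>2) = 4 * W2" "(\<Sum>k<K. \<bar>2 * w k\<bar>) = 2 * (\<Sum>k<K. \<bar>w k\<bar>)"
      by (simp_all add: W2_def power_mult_distrib abs_mult sum_distrib_left)
    have "(\<integral>x. exp (\<Sum>k<K. (2 * w k) * tp c H (real (m k) * x)) \<partial>U) \<le> 2 * exp (C * ka * (1 / 2 + 2 / (q - 1)) * (\<Sum>k<K. (2 * w k)\<^sup>2))"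
    proof (rule laplace_crude[OF cnj_c B qL _ de(1,2) _ decay ka])
      show "\<bar>2 * w k\<bar> \<le> 2 * de" for k using w[of k] by (simp only: abs_mult)
      show "lap_err q B H L (2 * de) (\<Sum>k<K. (2 * w k)\<^sup>2) (\<Sum>k<K. \<bar>2 * w k\<bar>) \<le> 1 / 2"
        unfolding a using err eta by (simp add: W2_def)
    qed
    moreover have "(\<Sum>k<K. (2 * w k) * tp c H (real (m k) * x)) = 2 * (\<Sum>k<K. X k x)" for x
      by (simp add: X_def sum_distrib_left mult.assoc)
    moreover have "C * ka * (1 / 2 + 2 / (q - 1)) * (\<Sum>k<K. (2 * w k)\<^sup>2) = 4 * C1"
      unfolding a C1_def by simp
    ultimately show ?thesis by simp
  qed
  have N2: "(\<integral>x. (noise K x)\<^sup>2 \<partial>U) \<le> B ^ 4 * real N * (2 * real L * de\<^sup>2 * W2)"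
    unfolding W2_def by (rule noise_L2[OF w dioph])
  have nb: "\<bar>noise K x\<bar> \<le> C2" for x
    unfolding C2_def W2_def by (rule noise_bound[OF decay ka])
  have split: "exp (- s * W2 / 2) * exp (\<Sum>k<K. X k x) = exp (psi K x) * exp (noise K x)" for x
    unfolding exp_sum_split sum_Q s_def[symmetric] W2_def[symmetric] by (simp add: field_simps flip: exp_add)
  have s0: "0 \<le> s" unfolding s_def by (intro sum_nonneg) auto
  have pt: "\<bar>exp (psi K x) * exp (noise K x) - exp (psi K x)\<bar> \<le> exp (2 * C2) * (de / 2 * exp (2 * (\<Sum>k<K. X k x)) + (noise K x)\<^sup>2 / (2 * de))" for x
  proof -
    let ?V = "noise K x" and ?S = "\<Sum>k<K. X k x"
    have e1: "\<bar>exp ?V - 1\<bar> \<le> \<bar>?V\<bar> * exp \<bar>?V\<bar>"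
    proof (cases "0 \<le> ?V")
      case True
      have "1 - ?V \<le> exp (- ?V)" using exp_ge_add_one_self[of "- ?V"] by simp
      then have "(1 - ?V) * exp ?V \<le> exp (- ?V) * exp ?V" by (intro mult_right_mono) auto
      then show ?thesis using True by (simp add: algebra_simps flip: exp_add)
    next
      case False
      have "\<bar>exp ?V - 1\<bar> \<le> \<bar>?V\<bar>" using False exp_ge_add_one_self[of ?V] exp_le_one_iff[of ?V] by linarith
      also have "\<dots> \<le> \<bar>?V\<bar> * exp \<bar>?V\<bar>" by (simp add: mult_le_cancel_left1)
      finally show ?thesis .
    qed
    have e2: "exp (psi K x) \<le> exp ?S * exp C2"
    proof -
      have "exp (psi K x) = exp (- s * W2 / 2) * exp ?S * exp (- ?V)"
        unfolding split by (simp add: mult.assoc flip: exp_add)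
      also have "\<dots> \<le> 1 * exp ?S * exp C2"
        using s0 W20 nb[of x] by (intro mult_mono) (auto simp: abs_le_iff)
      finally show ?thesis by simp
    qed
    \<comment> \<open>The arithmetic-geometric inequality with weight \<open>de\<close>: the second
      exponential moment carries no smallness, while the mean square of the noise is of order
      \<open>de\<^sup>2\<close>, and the weight shares this gain between both terms.\<close>
    have e3: "exp ?S * \<bar>?V\<bar> \<le> de / 2 * exp (2 * ?S) + ?V\<^sup>2 / (2 * de)"
    proof -
      have "0 \<le> (de * exp ?S - \<bar>?V\<bar>)\<^sup>2" by simp
      then have "2 * de * (exp ?S * \<bar>?V\<bar>) \<le> de\<^sup>2 * (exp ?S)\<^sup>2 + ?V\<^sup>2" by (simp add: power2_diff power_mult_distrib)
      also have "(exp ?S)\<^sup>2 = exp (2 * ?S)" by (simp add: power2_eq_square flip: exp_add)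
      finally show ?thesis using de(3) by (simp add: field_simps power2_eq_square)
    qed
    have "\<bar>exp (psi K x) * exp ?V - exp (psi K x)\<bar> = exp (psi K x) * \<bar>exp ?V - 1\<bar>"
    proof -
      have "exp (psi K x) * exp ?V - exp (psi K x) = exp (psi K x) * (exp ?V - 1)" by (simp add: right_diff_distrib)
      then show ?thesis by (simp only: abs_mult abs_exp_cancel)
    qed
    also have "\<dots> \<le> (exp ?S * exp C2) * (\<bar>?V\<bar> * exp \<bar>?V\<bar>)" by (intro mult_mono e1 e2) auto
    also have "\<dots> \<le> (exp ?S * exp C2) * (\<bar>?V\<bar> * exp C2)" using nb by (intro mult_left_mono) auto
    also have "\<dots> = exp (2 * C2) * (exp ?S * \<bar>?V\<bar>)" by (simp add: mult_ac flip: exp_add)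
    also have "\<dots> \<le> exp (2 * C2) * (de / 2 * exp (2 * ?S) + ?V\<^sup>2 / (2 * de))" by (intro mult_left_mono e3) auto
    finally show ?thesis .
  qed
  have ic: "integrable U (\<lambda>x. exp (psi K x))" "integrable U (\<lambda>x. exp (psi K x) * exp (noise K x))"
     "integrable U (\<lambda>x. exp (2 * (\<Sum>k<K. X k x)))" "integrable U (\<lambda>x. (noise K x)\<^sup>2)"
    by (intro integrable_U_cont continuous_intros psi_cont noise_cont X_cont)+
  have "\<bar>(\<integral>x. exp (psi K x) * exp (noise K x) \<partial>U) - (\<integral>x. exp (psi K x) \<partial>U)\<bar> = \<bar>\<integral>x. exp (psi K x) * exp (noise K x) - exp (psi K x) \<partial>U\<bar>"
    using ic by simp
  also have "\<dots> \<le> (\<integral>x. \<bar>exp (psi K x) * exp (noise K x) - exp (psi K x)\<bar> \<partial>U)" by (rule integral_abs_bound)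
  also have "\<dots> \<le> (\<integral>x. exp (2 * C2) * (de / 2 * exp (2 * (\<Sum>k<K. X k x)) + (noise K x)\<^sup>2 / (2 * de)) \<partial>U)"
    using de(3) by (intro integral_U_mono_cont continuous_intros psi_cont noise_cont X_cont pt) auto
  also have "\<dots> = exp (2 * C2) * (de / 2 * (\<integral>x. exp (2 * (\<Sum>k<K. X k x)) \<partial>U) + (\<integral>x. (noise K x)\<^sup>2 \<partial>U) / (2 * de))"
    using ic by simp
  also have "\<dots> \<le> exp (2 * C2) * (de / 2 * (2 * exp (4 * C1)) + (B ^ 4 * real N * (2 * real L * de\<^sup>2 * W2)) / (2 * de))"
    using de(3) by (intro mult_left_mono add_mono divide_right_mono dbl N2) auto
  also have "\<dots> = exp (2 * C2) * de * (exp (4 * C1) + B ^ 4 * real N * real L * W2)"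
    using de(3) by (simp add: field_simps power2_eq_square)
  finally have G: "\<bar>(\<integral>x. exp (psi K x) * exp (noise K x) \<partial>U) - (\<integral>x. exp (psi K x) \<partial>U)\<bar> \<le> \<dots>" .
  have "exp (- s * W2 / 2) * (\<integral>x. exp (\<Sum>k<K. X k x) \<partial>U) = (\<integral>x. exp (psi K x) * exp (noise K x) \<partial>U)"
    unfolding split[symmetric] by simp
  then have "\<bar>exp (- s * W2 / 2) * (\<integral>x. exp (\<Sum>k<K. X k x) \<partial>U) - 1\<bar> \<le> 2 * eta + exp (2 * C2) * de * (exp (4 * C1) + B ^ 4 * real N * real L * W2)"
    using F G by linarith
  then show ?thesis unfolding s_def C1_def C2_def X_def .
qed

end

section \<open>Asymptotics of the error terms\<close>

lemma eventually_degree_le_lag: "q > 1 \<Longrightarrow> eventually (\<lambda>a::nat. 2 * 2 ^ (8 * a) \<le> (q::real) ^ (a\<^sup>2)) sequentially"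
  by real_asymp

lemma eventually_window_small: "eventually (\<lambda>a::nat. 18 * C * real a * (4 * real (a\<^sup>2) + 1) * (2 * (19/20) ^ a) \<le> (1 / 4 :: real)) sequentially"
  by real_asymp

lemma window_error_tendsto_0: "A > 0 \<Longrightarrow> C > 0 \<Longrightarrow> ((\<lambda>a::nat. 80 * (18 * C * real a) ^ 3 * (4 * real (a\<^sup>2) + 1) ^ 3 * (2 * (19/20::real) ^ a) * (4 * (A * real a))) \<longlonglongrightarrow> 0)"
  by real_asymp

lemma frequency_error_tendsto_0: "q > 1 \<Longrightarrow> R > 0 \<Longrightarrow> ((\<lambda>a::nat. 2 * (18 * C * real a) * (2 * (18 * C * real a) * (2 ^ (8 * a) + 1) / ((q - 1) * q ^ (a\<^sup>2))) * (2 * R ^ a)) \<longlonglongrightarrow> (0::real))"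
  by real_asymp

lemma noise_error_tendsto_0: "A > 0 \<Longrightarrow> C > 0 \<Longrightarrow> C1 > 0 \<Longrightarrow> C2 > 0 \<Longrightarrow> N > 0 \<Longrightarrow> ((\<lambda>a::nat. exp (2 * (C2 * (A * ln (real a)))) * (19/20) ^ a *
        (exp (4 * (C1 * (A * ln (real a)))) + (18 * C * real a) ^ 4 * N * real (a\<^sup>2) * (A * ln (real a)))) \<longlonglongrightarrow> (0::real))"
  by real_asymp


lemma sum_inverse_dyadic: "(\<Sum>j=1..<2 ^ n. 1 / real j) \<le> real n"
proof (induction n)
  case (Suc n)
  have "(\<Sum>j=1..<2 ^ Suc n. 1 / real j) = (\<Sum>j=1..<2 ^ n. 1 / real j) + (\<Sum>j=2 ^ n..<2 ^ Suc n. 1 / real j)"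
    by (rule sum.atLeastLessThan_concat[symmetric]) auto
  also have "(\<Sum>j=2 ^ n..<2 ^ Suc n. 1 / real j) \<le> (\<Sum>j=2 ^ n..<(2::nat) ^ Suc n. 1 / 2 ^ n)"
    by (intro sum_mono divide_left_mono) auto
  also have "\<dots> = 1" by simp
  finally show ?case using Suc by simp
qed simp

lemma sum_inverse_squares: "(\<Sum>j=Suc D..H. 1 / (real j)\<^sup>2) \<le> 2 / real (Suc D)"
proof (cases "Suc D \<le> H")
  case True
  \<comment> \<open>The subtracted \<open>1 / real H\<close> lets the induction telescope through
    \<open>1 / n - 1 / (n + 1)\<close>.\<close>
  have "(\<Sum>j=Suc D..H. 1 / (real j)\<^sup>2) \<le> 2 / real (Suc D) - 1 / real H"
    using True
  proof (induction H rule: dec_induct)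
    case base
    have "1 / (real (Suc D))\<^sup>2 \<le> 1 / real (Suc D)"
      by (intro divide_left_mono) (auto simp: power2_eq_square)
    then show ?case by (simp add: field_simps)
  next
    case (step n)
    then have n: "0 < real n" by simp
    have "1 / (real (Suc n))\<^sup>2 \<le> 1 / (real n * real (Suc n))"
      using n by (intro divide_left_mono) (auto simp: power2_eq_square intro!: mult_right_mono)
    also have "\<dots> = 1 / real n - 1 / real (Suc n)" using n by (simp add: field_simps)
    finally have "1 / (real (Suc n))\<^sup>2 \<le> 1 / real n - 1 / real (Suc n)" .
    moreover have "(\<Sum>j=Suc D..Suc n. 1 / (real j)\<^sup>2) = (\<Sum>j=Suc D..n. 1 / (real j)\<^sup>2) + 1 / (real (Suc n))\<^sup>2"
      by (rule sum.cl_ivl_Suc[THEN trans]) (use step in auto)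
    ultimately show ?case using step.IH by linarith
  qed
  moreover have "0 \<le> 1 / real H" by simp
  ultimately show ?thesis by linarith
qed simp

lemma freqs_sum: "(\<Sum>j\<in>freqs H. g (nat \<bar>j\<bar>)) = 2 * (\<Sum>j=1..H. g j :: real)"
proof -
  have "freqs H = int ` {1..H} \<union> (\<lambda>j. - int j) ` {1..H}"
  proof (intro equalityI subsetI)
    fix j assume j: "j \<in> freqs H"
    then have "nat \<bar>j\<bar> \<in> {1..H}" "j = int (nat \<bar>j\<bar>) \<or> j = - int (nat \<bar>j\<bar>)" by (auto simp: freqs_def)
    then show "j \<in> int ` {1..H} \<union> (\<lambda>j. - int j) ` {1..H}" by blast
  qed (auto simp: freqs_def)
  then have "(\<Sum>j\<in>freqs H. g (nat \<bar>j\<bar>)) = (\<Sum>j\<in>int ` {1..H}. g (nat \<bar>j\<bar>)) + (\<Sum>j\<in>(\<lambda>j. - int j) ` {1..H}. g (nat \<bar>j\<bar>))"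
    by (simp only:) (rule sum.union_disjoint, auto)
  also have "\<dots> = (\<Sum>j=1..H. g j) + (\<Sum>j=1..H. g j)"
    by (subst (1 2) sum.reindex) (auto simp: inj_on_def)
  finally show ?thesis by simp
qed

section \<open>Fourier series with coefficients of order 1/j\<close>

definition cut :: "nat \<Rightarrow> (int \<Rightarrow> complex) \<Rightarrow> int \<Rightarrow> complex" where
  "cut D c j = (if \<bar>j\<bar> \<le> int D then 0 else c j)"

lemma tp_cut: "D \<le> H \<Longrightarrow> tp c H x = tp c D x + tp (cut D c) H x"
proof -
  assume "D \<le> H"
  then have s: "freqs D \<subseteq> freqs H" by (auto simp: freqs_def)
  have "(\<Sum>j\<in>freqs H. c j * ee j x) = (\<Sum>j\<in>freqs H. (c j - cut D c j) * ee j x) + (\<Sum>j\<in>freqs H. cut D c j * ee j x)"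
    by (simp add: algebra_simps flip: sum.distrib)
  also have "(\<Sum>j\<in>freqs H. (c j - cut D c j) * ee j x) = (\<Sum>j\<in>freqs D. c j * ee j x)"
    by (rule sum.mono_neutral_cong_right) (use s in \<open>auto simp: cut_def freqs_def\<close>)
  finally show ?thesis by (simp add: tp_def)
qed

locale fourier_lac = lacunary +
  fixes c :: "int \<Rightarrow> complex" and C :: real
  assumes cnj_c: "\<And>j. c (- j) = cnj (c j)"
    and decay: "\<And>j. j \<noteq> 0 \<Longrightarrow> cmod (c j) \<le> C / \<bar>of_int j\<bar>" and C1: "1 \<le> C"
begin

lemma cut_cnj: "cut D c (- j) = cnj (cut D c j)"
  by (simp add: cut_def cnj_c)

lemma cut_decay: "j \<noteq> 0 \<Longrightarrow> cmod (cut D c j) \<le> C / \<bar>of_int j\<bar>"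
  using C1 by (auto simp: cut_def intro: decay)

text \<open>The harmonic sum up to \<open>2 ^ (8 * a)\<close> is at most \<open>8 * a + 1\<close>,
  hence at most \<open>9 * a\<close>, and the two signs of \<open>j\<close> double the 9 to 18. A
  degree exponential in \<open>a\<close> thus costs only a factor \<open>a\<close>.\<close>

lemma sum_cmod_le:
  assumes H: "H \<le> 2 ^ (8 * a)" and a: "1 \<le> a" and d: "\<And>j. j \<noteq> 0 \<Longrightarrow> cmod (d j) \<le> C / \<bar>of_int j\<bar>"
  shows "(\<Sum>j\<in>freqs H. cmod (d j)) \<le> 18 * C * real a"
proof -
  have "(\<Sum>j\<in>freqs H. cmod (d j)) \<le> (\<Sum>j\<in>freqs H. (\<lambda>k. C * (1 / real k)) (nat \<bar>j\<bar>))"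
  proof (rule sum_mono)
    fix j assume "j \<in> freqs H"
    then show "cmod (d j) \<le> C * (1 / real (nat \<bar>j\<bar>))" using d[of j] by (auto simp: freqs_def)
  qed
  also have "\<dots> = 2 * (\<Sum>k=1..H. C * (1 / real k))" by (rule freqs_sum)
  also have "\<dots> = 2 * C * (\<Sum>k=1..H. 1 / real k)" by (simp only: sum_distrib_left mult.assoc)
  also have "\<dots> \<le> 2 * C * (\<Sum>k=1..<2 ^ (8 * a + 1). 1 / real k)"
    using H C1 by (intro mult_left_mono sum_mono2) auto
  also have "\<dots> \<le> 2 * C * real (8 * a + 1)" using C1 by (intro mult_left_mono sum_inverse_dyadic) auto
  also have "\<dots> \<le> 2 * C * (9 * real a)" using C1 a by (intro mult_left_mono) auto
  finally show ?thesis by simp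
qed

lemma sum_cut_le: "(\<Sum>j\<in>freqs H. cmod (cut D c j) / \<bar>of_int j\<bar>) \<le> 4 * C / (real D + 1)"
proof -
  have "(\<Sum>j\<in>freqs H. cmod (cut D c j) / \<bar>of_int j\<bar>) \<le> (\<Sum>j\<in>freqs H. (\<lambda>k. if k \<le> D then 0 else C * (1 / (real k)\<^sup>2)) (nat \<bar>j\<bar>))"
  proof (rule sum_mono)
    fix j assume j: "j \<in> freqs H"
    then have "cmod (c j) / \<bar>of_int j\<bar> \<le> (C / \<bar>of_int j\<bar>) / \<bar>of_int j\<bar>"
      by (intro divide_right_mono decay) (auto simp: freqs_def)
    then show "cmod (cut D c j) / \<bar>of_int j\<bar> \<le> (\<lambda>k. if k \<le> D then 0 else C * (1 / (real k)\<^sup>2)) (nat \<bar>j\<bar>)"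
      by (auto simp: cut_def power2_eq_square)
  qed
  also have "\<dots> = 2 * (\<Sum>k=1..H. if k \<le> D then 0 else C * (1 / (real k)\<^sup>2))" by (rule freqs_sum)
  also have "(\<Sum>k=1..H. if k \<le> D then 0 else C * (1 / (real k)\<^sup>2)) = (\<Sum>k=Suc D..H. C * (1 / (real k)\<^sup>2))"
    by (rule sum.mono_neutral_cong_right) auto
  also have "\<dots> = C * (\<Sum>k=Suc D..H. 1 / (real k)\<^sup>2)" by (rule sum_distrib_left[symmetric])
  also have "2 * \<dots> \<le> 2 * (C * (2 / real (Suc D)))" using C1 by (intro mult_left_mono sum_inverse_squares) auto
  finally show ?thesis by (simp add: add.commute)
qed

text \<open>The constant of \<open>sum_Q_bound\<close> with \<open>ka = 4 * C / (D + 1)\<close>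
  taken from \<open>sum_cut_le\<close>: a sub-Gaussian constant for the series beyond degree
  \<open>D\<close>.\<close>

definition VD :: "nat \<Rightarrow> real" where "VD D = 4 * C\<^sup>2 * (1 / 2 + 2 / (q - 1)) / (real D + 1)"

lemma VD_pos: "0 < VD D"
  unfolding VD_def using C1 q1 by (intro divide_pos_pos mult_pos_pos add_pos_pos[of "1/2"]) auto

text \<open>The lag \<open>a\<^sup>2\<close> is long enough for the geometric factor \<open>q ^ (a\<^sup>2)\<close> to beat everything
  that grows exponentially in \<open>a\<close>, and short enough to be invisible next to weights of size \<open>(19/20) ^ a\<close>.\<close>

lemma eventually_lap_err:
  assumes A: "0 < A" and R: "1 \<le> R" and e: "0 < e"
  shows "\<forall>\<^sub>F a in sequentially. 1 \<le> a \<and> 2 * 2 ^ (8 * a) \<le> q ^ (a\<^sup>2) \<and> 2 * (19/20) ^ a \<le> (1::real)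
    \<and> 18 * C * real a * (4 * real (a\<^sup>2) + 1) * (2 * (19/20) ^ a) \<le> 1 / 4
    \<and> (\<forall>H W2 W1. H \<le> 2 ^ (8 * a) \<longrightarrow> W2 \<le> A * real a \<longrightarrow> W1 \<le> R ^ a \<longrightarrow> 
      lap_err q (18 * C * real a) H (a\<^sup>2) (2 * (19/20) ^ a) (4 * W2) (2 * W1) \<le> e)"
proof -
  have C0: "0 < C" using C1 by simp
  have d: "\<forall>\<^sub>F a in sequentially. 2 * (19/20) ^ a \<le> (1::real)" by real_asymp
  have e2: "0 < e / 2" using e by simp
  from window_error_tendsto_0[OF A C0] have 3: "\<forall>\<^sub>F a in sequentially. 80 * (18 * C * real a) ^ 3 * (4 * real (a\<^sup>2) + 1) ^ 3 * (2 * (19/20::real) ^ a) * (4 * (A * real a)) < e / 2"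
    by (rule order_tendstoD(2)[OF _ e2])
  have R0: "R > 0" using R by simp
  from frequency_error_tendsto_0[OF q1 R0, of C] have 4: "\<forall>\<^sub>F a in sequentially. 2 * (18 * C * real a) * (2 * (18 * C * real a) * (2 ^ (8 * a) + 1) / ((q - 1) * q ^ (a\<^sup>2))) * (2 * R ^ a) < e / 2"
    by (rule order_tendstoD(2)[OF _ e2])
  show ?thesis
    using eventually_ge_at_top[of 1] eventually_degree_le_lag[OF q1] d eventually_window_small[of C] 3 4
  proof eventually_elim
    case (elim a)
    show ?case
    proof (intro conjI allI impI)
      fix H :: nat and W2 W1 :: real assume *: "H \<le> 2 ^ (8 * a)" "W2 \<le> A * real a" "W1 \<le> R ^ a"
      have H: "real H \<le> 2 ^ (8 * a)" using *(1) by (metis of_nat_le_iff of_nat_numeral of_nat_power)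
      have "80 * (18 * C * real a) ^ 3 * (4 * real (a\<^sup>2) + 1) ^ 3 * (2 * (19/20::real) ^ a) * (4 * W2)
          \<le> 80 * (18 * C * real a) ^ 3 * (4 * real (a\<^sup>2) + 1) ^ 3 * (2 * (19/20::real) ^ a) * (4 * (A * real a))"
        using * C0 by (intro mult_left_mono) auto
      moreover have "2 * (18 * C * real a) * (2 * (18 * C * real a) * (real H + 1) / ((q - 1) * q ^ (a\<^sup>2))) * (2 * W1)
          \<le> 2 * (18 * C * real a) * (2 * (18 * C * real a) * (real H + 1) / ((q - 1) * q ^ (a\<^sup>2))) * (2 * R ^ a)"
        using * C0 q1 by (intro mult_left_mono mult_nonneg_nonneg divide_nonneg_nonneg) auto
      moreover have "\<dots> \<le> 2 * (18 * C * real a) * (2 * (18 * C * real a) * (2 ^ (8 * a) + 1) / ((q - 1) * q ^ (a\<^sup>2))) * (2 * R ^ a)"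
        using H C0 q1 R0 by (intro mult_left_mono mult_right_mono divide_right_mono) auto
      ultimately show "lap_err q (18 * C * real a) H (a\<^sup>2) (2 * (19/20) ^ a) (4 * W2) (2 * W1) \<le> e"
        unfolding lap_err_def using elim by linarith
    qed (use elim in auto)
  qed
qed

text \<open>The threshold for \<open>a\<close> is chosen before \<open>D\<close>, \<open>H\<close>,
  the weights and their number, which makes the bound uniform over all permuted blocks and over
  degrees growing with \<open>a\<close>.\<close>

theorem laplace_crude_eventually:
  assumes A: "0 < A" and R: "1 \<le> R"
  shows "\<forall>\<^sub>F a in sequentially. \<forall>D H w K. H \<le> 2 ^ (8 * a) \<longrightarrow> (\<forall>k. \<bar>w k\<bar> \<le> (19/20) ^ a) \<longrightarrow>
     (\<Sum>k<K. (w k)\<^sup>2) \<le> A * real a \<longrightarrow> (\<Sum>k<K. \<bar>w k\<bar>) \<le> R ^ a \<longrightarrow>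
     (\<integral>x. exp (\<Sum>k<K. w k * tp (cut D c) H (real (m k) * x)) \<partial>U) \<le> 2 * exp (VD D * (\<Sum>k<K. (w k)\<^sup>2))"
  using eventually_lap_err[OF A R, of "1/2", simplified]
proof eventually_elim
  case (elim a)
  show ?case
  proof (intro allI impI)
    fix D H :: nat and w :: "nat \<Rightarrow> real" and K
    assume *: "H \<le> 2 ^ (8 * a)" "\<forall>k. \<bar>w k\<bar> \<le> (19/20) ^ a" "(\<Sum>k<K. (w k)\<^sup>2) \<le> A * real a" "(\<Sum>k<K. \<bar>w k\<bar>) \<le> R ^ a"
    have a1: "1 \<le> a" using elim by auto
    have H: "real H \<le> 2 ^ (8 * a)" using *(1) by (metis of_nat_le_iff of_nat_numeral of_nat_power)
    have B1: "1 \<le> 18 * C * real a"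
      using mult_mono[of 1 "18 * C" 1 "real a"] C1 a1 by simp
    have W: "0 \<le> (\<Sum>k<K. (w k)\<^sup>2)" "0 \<le> (\<Sum>k<K. \<bar>w k\<bar>)" by (auto intro: sum_nonneg)
    have d2: "\<bar>w k\<bar> \<le> 2 * (19/20) ^ a" for k using *(2)[rule_format, of k] zero_le_power[of "19/20::real" a] by linarith
    have e: "lap_err q (18 * C * real a) H (a\<^sup>2) (2 * (19/20) ^ a) (\<Sum>k<K. (w k)\<^sup>2) (\<Sum>k<K. \<bar>w k\<bar>)
       \<le> lap_err q (18 * C * real a) H (a\<^sup>2) (2 * (19/20) ^ a) (4 * (\<Sum>k<K. (w k)\<^sup>2)) (2 * (\<Sum>k<K. \<bar>w k\<bar>))"
      unfolding lap_err_def using C1 q1 W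
      by (intro add_mono mult_left_mono mult_nonneg_nonneg divide_nonneg_nonneg) auto
    have "(\<integral>x. exp (\<Sum>k<K. w k * tp (cut D c) H (real (m k) * x)) \<partial>U)
       \<le> 2 * exp (C * (4 * C / (real D + 1)) * (1 / 2 + 2 / (q - 1)) * (\<Sum>k<K. (w k)\<^sup>2))"
    proof (rule laplace_crude[where B = "18 * C * real a" and L = "a\<^sup>2" and de = "2 * (19/20) ^ a"])
      show "lap_err q (18 * C * real a) H (a\<^sup>2) (2 * (19/20) ^ a) (\<Sum>k<K. (w k)\<^sup>2) (\<Sum>k<K. \<bar>w k\<bar>) \<le> 1 / 2"
        using e elim * by fastforce
      show "2 * real H \<le> q ^ a\<^sup>2" using elim H by linarith
      show "(\<Sum>j\<in>freqs H. cmod (cut D c j)) \<le> 18 * C * real a"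
        by (rule sum_cmod_le[OF *(1) a1 cut_decay])
    qed (use cut_cnj cut_decay sum_cut_le d2 elim B1 in auto)
    also have "C * (4 * C / (real D + 1)) * (1 / 2 + 2 / (q - 1)) = VD D"
      by (simp add: VD_def power2_eq_square)
    finally show "(\<integral>x. exp (\<Sum>k<K. w k * tp (cut D c) H (real (m k) * x)) \<partial>U) \<le> 2 * exp (VD D * (\<Sum>k<K. (w k)\<^sup>2))" .
  qed
qed

end

text \<open>The bound may depend on \<open>i\<close> and \<open>j\<close> in an arbitrary way. It
  can include \<open>v = 0\<close> because the pairs are ordered by \<open>l < k\<close>, which
  keeps them off the diagonal.\<close>

locale fourier_lac_dioph = fourier_lac +
  assumes dioph: "\<And>i j. i \<noteq> 0 \<Longrightarrow> j \<noteq> 0 \<Longrightarrow>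
     \<exists>N::nat. \<forall>v K. card {(k, l). k < K \<and> l < k \<and> i * int (m k) + j * int (m l) = v} \<le> N"
begin

definition s2 :: "nat \<Rightarrow> real" where "s2 D = (\<Sum>j\<in>freqs D. (cmod (c j))\<^sup>2)"

lemma s2_nonneg: "0 \<le> s2 D" unfolding s2_def by (intro sum_nonneg) auto

text \<open>For fixed \<open>D\<close> only finitely many pairs of multipliers occur, so their
  individual bounds can be added up; this is what ties the exact transform to a fixed
  degree.\<close>

lemma dioph_uniform:
  obtains N :: nat where "0 < N" "\<And>p v K. p \<in> freqs D \<times> freqs D \<Longrightarrow>
     card {(k, l). k < K \<and> l < k \<and> fst p * int (m k) + snd p * int (m l) = v} \<le> N"
proof -
  define P where "P = (\<lambda>p (N::nat). \<forall>v K. card {(k, l). k < K \<and> l < k \<and> fst p * int (m k) + snd p * int (m l) = v} \<le> N)"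
  have "\<forall>p \<in> freqs D \<times> freqs D. \<exists>N. P p N"
    unfolding P_def by (intro ballI dioph) (auto simp: freqs_def)
  then obtain N where "\<forall>p \<in> freqs D \<times> freqs D. P p (N p)" by (rule bchoice[elim_format]) blast
  then have N: "card {(k, l). k < K \<and> l < k \<and> fst p * int (m k) + snd p * int (m l) = v} \<le> N p"
    if "p \<in> freqs D \<times> freqs D" for p v K
    using that unfolding P_def by blast
  show ?thesis
  proof
    fix p v K assume p: "p \<in> freqs D \<times> freqs D"
    have "N p \<le> (\<Sum>p\<in>freqs D \<times> freqs D. N p)" by (rule member_le_sum) (use p in auto)
    then show "card {(k, l). k < K \<and> l < k \<and> fst p * int (m k) + snd p * int (m l) = v} \<le> (\<Sum>p\<in>freqs D \<times> freqs D. N p) + 1"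
      using N[OF p, where K = K and v = v] by linarith
  qed simp
qed

text \<open>Here the sum of squares may grow only like \<open>ln a\<close>: the noise enters through
  exponentials of its supremum, which is proportional to that sum, and these must stay polynomial in
  \<open>a\<close> to be beaten by \<open>(19/20) ^ a\<close>.\<close>

theorem laplace_exact_eventually:
  assumes A: "0 < A" and R: "1 \<le> R" and e: "0 < e"
  shows "\<forall>\<^sub>F a in sequentially. \<forall>w K. (\<forall>k. \<bar>w k\<bar> \<le> (19/20) ^ a) \<longrightarrow>
     (\<Sum>k<K. (w k)\<^sup>2) \<le> A * ln (real a) \<longrightarrow> (\<Sum>k<K. \<bar>w k\<bar>) \<le> R ^ a \<longrightarrow>
     \<bar>exp (- s2 D * (\<Sum>k<K. (w k)\<^sup>2) / 2) * (\<integral>x. exp (\<Sum>k<K. w k * tp c D (real (m k) * x)) \<partial>U) - 1\<bar> \<le> e"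
proof -
  obtain N :: nat where N: "0 < N" "\<And>p v K. p \<in> freqs D \<times> freqs D \<Longrightarrow>
     card {(k, l). k < K \<and> l < k \<and> fst p * int (m k) + snd p * int (m l) = v} \<le> N"
    using dioph_uniform by blast
  define C1' C2 where "C1' = C * (4 * C) * (1 / 2 + 2 / (q - 1))" and "C2 = C * (4 * C) * (2 / (q - 1))"
  have pos: "0 < C" "0 < C1'" "0 < C2" using C1 q1 unfolding C1'_def C2_def
    by (auto intro!: mult_pos_pos add_pos_pos)
  define eta where "eta = min (1 / 2) (e / 4)"
  have eta: "0 < eta" "eta \<le> 1 / 2" "2 * eta \<le> e / 2" using e by (auto simp: eta_def)
  have HD: "\<forall>\<^sub>F a in sequentially. real D \<le> 2 ^ (8 * a)" by real_asymp
  have e2: "0 < e / 2" using e by simp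
  have "\<forall>\<^sub>F a::nat in sequentially. exp (2 * (C2 * (A * ln (real a)))) * (19/20) ^ a *
        (exp (4 * (C1' * (A * ln (real a)))) + (18 * C * real a) ^ 4 * real N * real (a\<^sup>2) * (A * ln (real a))) < e / 2"
    by (rule order_tendstoD(2)[OF noise_error_tendsto_0 e2]) (use A pos N in auto)
  with HD eventually_lap_err[OF A R eta(1)] show ?thesis
  proof eventually_elim
    case (elim a)
    show ?case
    proof (intro allI impI)
      fix w :: "nat \<Rightarrow> real" and K
      assume *: "\<forall>k. \<bar>w k\<bar> \<le> (19/20) ^ a" "(\<Sum>k<K. (w k)\<^sup>2) \<le> A * ln (real a)" "(\<Sum>k<K. \<bar>w k\<bar>) \<le> R ^ a"
      let ?W2 = "\<Sum>k<K. (w k)\<^sup>2"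
      have W: "0 \<le> ?W2" by (auto intro: sum_nonneg)
      have a1: "1 \<le> a" using elim by auto
      have D: "D \<le> 2 ^ (8 * a)" using elim(1) by (metis of_nat_le_iff of_nat_numeral of_nat_power)
      have B1: "1 \<le> 18 * C * real a"
        using mult_mono[of 1 "18 * C" 1 "real a"] C1 a1 by simp
      have lna: "A * ln (real a) \<le> A * real a" using A a1 ln_le_minus_one[of "real a"] by (intro mult_left_mono) auto
      have ka: "(\<Sum>j\<in>freqs D. cmod (c j) / \<bar>of_int j\<bar>) \<le> 4 * C"
      proof -
        have "(\<Sum>j\<in>freqs D. cmod (c j) / \<bar>of_int j\<bar>) = (\<Sum>j\<in>freqs D. cmod (cut 0 c j) / \<bar>of_int j\<bar>)"
          by (intro sum.cong) (auto simp: cut_def freqs_def)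
        then show ?thesis using sum_cut_le[of 0 D] by simp
      qed
      have "\<bar>exp (- (\<Sum>j\<in>freqs D. (cmod (c j))\<^sup>2) * ?W2 / 2) * (\<integral>x. exp (\<Sum>k<K. w k * tp c D (real (m k) * x)) \<partial>U) - 1\<bar>
        \<le> 2 * eta + exp (2 * (C * (4 * C) * (2 / (q - 1)) * ?W2)) * (19/20) ^ a *
        (exp (4 * (C * (4 * C) * (1 / 2 + 2 / (q - 1)) * ?W2)) + (18 * C * real a) ^ 4 * real N * real (a\<^sup>2) * ?W2)"
      proof (rule laplace_exact[where c = c, OF cnj_c _ B1])
        show "lap_err q (18 * C * real a) D (a\<^sup>2) (2 * (19/20) ^ a) (4 * (\<Sum>k<K. (w k)\<^sup>2)) (2 * (\<Sum>k<K. \<bar>w k\<bar>)) \<le> eta"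
          using elim(2) D * lna by fastforce
        show "2 * real D \<le> q ^ a\<^sup>2" using elim by linarith
        show "(\<Sum>j\<in>freqs D. cmod (c j)) \<le> 18 * C * real a"
          by (rule sum_cmod_le[OF D a1 decay])
      qed (use decay ka * elim eta N in auto)
      also have "\<dots> \<le> 2 * eta + exp (2 * (C2 * (A * ln (real a)))) * (19/20) ^ a *
        (exp (4 * (C1' * (A * ln (real a)))) + (18 * C * real a) ^ 4 * real N * real (a\<^sup>2) * (A * ln (real a)))"
        unfolding C1'_def[symmetric] C2_def[symmetric] using * pos W
        by (intro add_left_mono mult_mono add_mono mult_left_mono iffD2[OF exp_le_cancel_iff] add_nonneg_nonneg mult_nonneg_nonneg) auto
      also have "\<dots> \<le> e" using elim(3) eta by linarith
      finally show "\<bar>exp (- s2 D * ?W2 / 2) * (\<integral>x. exp (\<Sum>k<K. w k * tp c D (real (m k) * x)) \<partial>U) - 1\<bar> \<le> e"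
        unfolding s2_def .
    qed
  qed
qed

end

section \<open>A maximal inequality for permuted sums\<close>

lemma exp_Markov:
  assumes S: "continuous_on UNIV S" and la: "0 \<le> la"
  shows "measure U {x. t \<le> S x} \<le> exp (- la * t) * (\<integral>x. exp (la * S x) \<partial>U)"
proof -
  have Sm: "S \<in> borel_measurable borel" using S by (rule borel_measurable_continuous_onI)
  have [measurable]: "S \<in> borel_measurable borel" by (rule Sm)
  have "measure U {x. t \<le> S x} \<le> measure U {x \<in> space U. exp (la * t) \<le> exp (la * S x)}"
  proof (rule U.finite_measure_mono)
    show "{x. t \<le> S x} \<subseteq> {x \<in> space U. exp (la * t) \<le> exp (la * S x)}" using la by (auto intro: mult_left_mono)
    show "{x \<in> space U. exp (la * t) \<le> exp (la * S x)} \<in> sets U" by measurable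
  qed
  also have "\<dots> \<le> (\<integral>x. exp (la * S x) \<partial>U) / exp (la * t)"
    by (rule integral_Markov_inequality_measure[where A = UNIV])
       (auto intro!: integrable_U_cont continuous_intros S)
  finally show ?thesis by (simp add: exp_minus field_simps)
qed

text \<open>This is where the permutation disappears: weights on an arbitrary index set are carried
  along the injection \<open>\<tau>\<close> to weights on the ordered frequencies, and none of the
  quantities in the Laplace bounds changes.\<close>

lemma reorder_weights:
  fixes v :: "'i \<Rightarrow> real" and \<tau> :: "'i \<Rightarrow> nat"
  assumes I: "finite I" and inj: "inj_on \<tau> I"
  obtains w :: "nat \<Rightarrow> real" and K where "\<And>h. (\<Sum>k<K. w k * h k) = (\<Sum>i\<in>I. v i * h (\<tau> i))"
    "(\<Sum>k<K. (w k)\<^sup>2) = (\<Sum>i\<in>I. (v i)\<^sup>2)" "(\<Sum>k<K. \<bar>w k\<bar>) = (\<Sum>i\<in>I. \<bar>v i\<bar>)"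
    "\<And>k b. 0 \<le> b \<Longrightarrow> (\<And>i. i \<in> I \<Longrightarrow> \<bar>v i\<bar> \<le> b) \<Longrightarrow> \<bar>w k\<bar> \<le> b"
proof -
  define w where "w = (\<lambda>k. if k \<in> \<tau> ` I then v (the_inv_into I \<tau> k) else 0)"
  obtain K where K: "\<tau> ` I \<subseteq> {..<K}" using I by (meson finite_imageI finite_nat_iff_bounded)
  have w: "w (\<tau> i) = v i" if "i \<in> I" for i using that inj by (simp add: w_def the_inv_into_f_f)
  have sum: "(\<Sum>k<K. F k (w k)) = (\<Sum>i\<in>I. F (\<tau> i) (v i) :: real)" if "\<And>k. F k 0 = 0" for F
  proof -
    have "(\<Sum>k<K. F k (w k)) = (\<Sum>k\<in>\<tau> ` I. F k (w k))"
      by (rule sum.mono_neutral_right) (use K that in \<open>auto simp: w_def\<close>)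
    also have "\<dots> = (\<Sum>i\<in>I. F (\<tau> i) (v i))" using w by (simp add: sum.reindex[OF inj])
    finally show ?thesis .
  qed
  show ?thesis
  proof (rule that[of w K])
    show "(\<Sum>k<K. w k * h k) = (\<Sum>i\<in>I. v i * h (\<tau> i))" for h using sum[of "\<lambda>k y. y * h k"] by simp
    show "(\<Sum>k<K. (w k)\<^sup>2) = (\<Sum>i\<in>I. (v i)\<^sup>2)" using sum[of "\<lambda>k y. y\<^sup>2"] by simp
    show "(\<Sum>k<K. \<bar>w k\<bar>) = (\<Sum>i\<in>I. \<bar>v i\<bar>)" using sum[of "\<lambda>k y. \<bar>y\<bar>"] by simp
    show "\<bar>w k\<bar> \<le> b" if "0 \<le> b" "\<And>i. i \<in> I \<Longrightarrow> \<bar>v i\<bar> \<le> b" for k b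
      using that w by (cases "k \<in> \<tau> ` I") (auto simp: w_def the_inv_into_f_f[OF inj])
  qed
qed

text \<open>The binary expansion of \<open>j\<close> splits the initial segment into at most one
  block for each level up to \<open>i0\<close>; what is left is shorter than
  \<open>2 ^ (a - i0)\<close> and is bounded trivially.\<close>

lemma dyadic_chaining:
  fixes y :: "nat \<Rightarrow> real"
  assumes T: "\<And>i r. i \<le> i0 \<Longrightarrow> r < 2 ^ i \<Longrightarrow> \<bar>\<Sum>k\<in>{r * 2 ^ (a - i)..<Suc r * 2 ^ (a - i)}. y k\<bar> \<le> t i"
    and b: "\<And>k. \<bar>y k\<bar> \<le> b" and i0: "i0 \<le> a" and j: "j \<le> 2 ^ a"
  shows "\<bar>\<Sum>k<j. y k\<bar> \<le> (\<Sum>i\<le>i0. t i) + b * 2 ^ (a - i0)"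
proof -
  have t0: "0 \<le> t i" if "i \<le> i0" for i using T[OF that, of 0] by fastforce
  have grid: "\<bar>\<Sum>k<s * 2 ^ (a - i). y k\<bar> \<le> (\<Sum>i\<le>i. t i)" if "i \<le> i0" "s \<le> 2 ^ i" for i s
    using that
  proof (induction i arbitrary: s)
    case 0
    then consider "s = 0" | "s = 1" by force
    then show ?case
    proof cases
      case 1 then show ?thesis using t0[of 0] by simp
    next
      case 2 then show ?thesis using T[of 0 0] by (simp add: lessThan_atLeast0)
    qed
  next
    case (Suc i)
    have e: "2 * 2 ^ (a - Suc i) = (2::nat) ^ (a - i)"
      using Suc.prems i0 by (simp add: Suc_diff_Suc flip: power_Suc)
    \<comment> \<open>An odd grid point is one block beyond an even one, and the even one already
      lies on the previous level.\<close>
    define s' where "s' = s div 2"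
    have s': "s' \<le> 2 ^ i" using Suc.prems by (auto simp: s'_def)
    have IH: "\<bar>\<Sum>k<s' * 2 ^ (a - i). y k\<bar> \<le> (\<Sum>i\<le>i. t i)" using Suc s' by auto
    show ?case
    proof (cases "even s")
      case True
      then have "s * 2 ^ (a - Suc i) = s' * 2 ^ (a - i)" using e by (auto simp: s'_def elim!: evenE)
      then show ?thesis using IH t0[of "Suc i"] Suc.prems by simp
    next
      case False
      then have s: "s = Suc (2 * s')" by (auto simp: s'_def elim!: oddE)
      have 1: "(2 * s') * 2 ^ (a - Suc i) = s' * 2 ^ (a - i)" using e by simp
      have "(\<Sum>k<s * 2 ^ (a - Suc i). y k) = (\<Sum>k\<in>{0..<(2 * s') * 2 ^ (a - Suc i)}. y k) + (\<Sum>k\<in>{(2 * s') * 2 ^ (a - Suc i)..<s * 2 ^ (a - Suc i)}. y k)"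
        unfolding lessThan_atLeast0 by (rule sum.atLeastLessThan_concat[symmetric]) (auto simp: s)
      also have "(\<Sum>k\<in>{0..<(2 * s') * 2 ^ (a - Suc i)}. y k) = (\<Sum>k<s' * 2 ^ (a - i). y k)"
        by (simp only: 1 lessThan_atLeast0)
      finally have eq: "(\<Sum>k<s * 2 ^ (a - Suc i). y k) = (\<Sum>k<s' * 2 ^ (a - i). y k) + (\<Sum>k\<in>{(2 * s') * 2 ^ (a - Suc i)..<s * 2 ^ (a - Suc i)}. y k)" .
      have "\<bar>\<Sum>k\<in>{(2 * s') * 2 ^ (a - Suc i)..<s * 2 ^ (a - Suc i)}. y k\<bar> \<le> t (Suc i)"
        unfolding s using Suc.prems s by (intro T) auto
      moreover have "(\<Sum>i\<le>Suc i. t i) = (\<Sum>i\<le>i. t i) + t (Suc i)" by simp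
      ultimately show ?thesis unfolding eq using IH by linarith
    qed
  qed
  let ?h = "2 ^ (a - i0) :: nat"
  have e: "2 ^ i0 * ?h = 2 ^ a" using i0 by (simp flip: power_add)
  have "j div ?h \<le> 2 ^ a div ?h" using j by (rule div_le_mono)
  also have "\<dots> = 2 ^ i0" using e by (metis nonzero_mult_div_cancel_right power_not_zero zero_neq_numeral)
  finally have s: "j div ?h \<le> 2 ^ i0" .
  have le: "j div ?h * ?h \<le> j" by simp
  have "(\<Sum>k<j. y k) = (\<Sum>k<j div ?h * ?h. y k) + (\<Sum>k\<in>{j div ?h * ?h..<j}. y k)"
    unfolding lessThan_atLeast0 by (rule sum.atLeastLessThan_concat[symmetric]) (auto simp: le)
  moreover have "\<bar>\<Sum>k\<in>{j div ?h * ?h..<j}. y k\<bar> \<le> b * 2 ^ (a - i0)"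
  proof -
    have b0: "0 \<le> b" using b[of 0] by linarith
    have "\<bar>\<Sum>k\<in>{j div ?h * ?h..<j}. y k\<bar> \<le> (\<Sum>k\<in>{j div ?h * ?h..<j}. b)"
      by (rule order_trans[OF sum_abs sum_mono]) (rule b)
    also have "\<dots> = real (j - j div ?h * ?h) * b" by simp
    also have "j - j div ?h * ?h = j mod ?h" by (simp add: minus_div_mult_eq_mod)
    also have "real (j mod ?h) * b \<le> real ?h * b" using b0
      by (intro mult_right_mono) (auto intro!: less_imp_le[OF mod_less_divisor])
    finally show ?thesis by (simp add: mult.commute)
  qed
  ultimately show ?thesis using grid[OF order_refl s] by linarith
qed

lemma eventually_poly_le_power: "W > 0 \<Longrightarrow> eventually (\<lambda>a::nat. (4 * real a) ^ 4 / W \<le> (13/10 :: real) ^ a) sequentially"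
  by real_asymp

text \<open>\<open>2 * (19/20) ^ 8\<close> exceeds 13/10, which leaves a geometric factor to absorb
  the polynomial. The exponent \<open>8 * a\<close> matches the eighth power of the Chernoff
  parameter taken in \<open>block_tail\<close>.\<close>

lemma eventually_block_weight_small: "V > 0 \<Longrightarrow> eventually (\<lambda>a::nat. (4 * real a) ^ 4 / (V ^ 4 * 2 ^ a) \<le> (19/20::real) ^ (8 * a)) sequentially"
proof -
  assume V: "V > 0"
  then have "V ^ 4 > 0" by simp
  then have "eventually (\<lambda>a::nat. (4 * real a) ^ 4 / V ^ 4 \<le> (13/10) ^ a) sequentially"
    by (rule eventually_poly_le_power)
  then show ?thesis
  proof eventually_elim
    case (elim a)
    have "(13/10::real) ^ a \<le> (2 * (19/20) ^ 8) ^ a" by (intro power_mono) (auto simp: power_divide eval_nat_numeral)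
    also have "\<dots> = 2 ^ a * (19/20) ^ (8 * a)" by (simp add: power_mult power_mult_distrib)
    finally have "(4 * real a) ^ 4 / V ^ 4 \<le> 2 ^ a * (19/20::real) ^ (8 * a)" using elim by linarith
    then show ?case using V by (simp add: field_simps)
  qed
qed

lemma eventually_short_blocks_negligible: "V > 0 \<Longrightarrow> C > 0 \<Longrightarrow> eventually (\<lambda>a::nat. (18 * C * real a) ^ 4 * (16 * 2 ^ a) \<le> (V * 2 ^ a * ln (real a))\<^sup>2) sequentially"
  by real_asymp

context fourier_lac
begin

lemma laplace_crude_perm:
  assumes A: "0 < A" and R: "1 \<le> R"
  shows "\<forall>\<^sub>F a in sequentially. \<forall>D H v I (\<tau> :: nat \<Rightarrow> nat). H \<le> 2 ^ (8 * a) \<longrightarrow> finite I \<longrightarrow> inj_on \<tau> I \<longrightarrow> (\<forall>i\<in>I. \<bar>v i\<bar> \<le> (19/20) ^ a) \<longrightarrow>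
     (\<Sum>i\<in>I. (v i)\<^sup>2) \<le> A * real a \<longrightarrow> (\<Sum>i\<in>I. \<bar>v i\<bar>) \<le> R ^ a \<longrightarrow>
     (\<integral>x. exp (\<Sum>i\<in>I. v i * tp (cut D c) H (real (m (\<tau> i)) * x)) \<partial>U) \<le> 2 * exp (VD D * (\<Sum>i\<in>I. (v i)\<^sup>2))"
  using laplace_crude_eventually[OF A R]
proof eventually_elim
  case (elim a)
  show ?case
  proof (intro allI impI)
    fix D H :: nat and v :: "nat \<Rightarrow> real" and I :: "nat set" and \<tau> :: "nat \<Rightarrow> nat"
    assume *: "H \<le> 2 ^ (8 * a)" "finite I" "inj_on \<tau> I" "\<forall>i\<in>I. \<bar>v i\<bar> \<le> (19/20) ^ a"
      "(\<Sum>i\<in>I. (v i)\<^sup>2) \<le> A * real a" "(\<Sum>i\<in>I. \<bar>v i\<bar>) \<le> R ^ a"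
    obtain w K where w: "\<And>h. (\<Sum>k<K. w k * h k) = (\<Sum>i\<in>I. v i * h (\<tau> i))"
      "(\<Sum>k<K. (w k)\<^sup>2) = (\<Sum>i\<in>I. (v i)\<^sup>2)" "(\<Sum>k<K. \<bar>w k\<bar>) = (\<Sum>i\<in>I. \<bar>v i\<bar>)"
      "\<And>k b. 0 \<le> b \<Longrightarrow> (\<And>i. i \<in> I \<Longrightarrow> \<bar>v i\<bar> \<le> b) \<Longrightarrow> \<bar>w k\<bar> \<le> b"
      by (rule reorder_weights[OF *(2,3), of v]) blast
    have "\<bar>w k\<bar> \<le> (19/20) ^ a" for k by (rule w(4)) (use * in auto)
    then show "(\<integral>x. exp (\<Sum>i\<in>I. v i * tp (cut D c) H (real (m (\<tau> i)) * x)) \<partial>U) \<le> 2 * exp (VD D * (\<Sum>i\<in>I. (v i)\<^sup>2))"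
      using elim[rule_format, of H w K D] * w(2,3) w(1)[of "\<lambda>k. tp (cut D c) H (real (m k) * x)" for x] by simp
  qed
qed

lemma tp_bound:
  assumes "H \<le> 2 ^ (8 * a)" "1 \<le> a"
  shows "\<bar>tp (cut D c) H x\<bar> \<le> 18 * C * real a"
proof -
  have "\<bar>tp (cut D c) H x\<bar> \<le> (\<Sum>j\<in>freqs H. cmod (cut D c j * ee j x))"
    unfolding tp_def by (rule order_trans[OF abs_Re_le_cmod norm_sum])
  also have "\<dots> = (\<Sum>j\<in>freqs H. cmod (cut D c j))" by (simp add: norm_mult)
  also have "\<dots> \<le> 18 * C * real a" by (rule sum_cmod_le[OF assms cut_decay])
  finally show ?thesis .
qed

text \<open>Chernoff's bound with \<open>yy = 3 * ln a + i\<close>: the parameter \<open>la\<close>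
  makes the exponent of the Laplace bound equal to \<open>yy\<close> and
  \<open>la * t = 3 * yy\<close>, hence a tail \<open>2 * exp (- 2 * yy)\<close> for each sign. The
  part \<open>3 * ln a\<close> gives summability in \<open>a\<close>, the part \<open>i\<close> pays
  for the \<open>2 ^ i\<close> blocks at level \<open>i\<close>. The restriction
  \<open>4 * i \<le> 3 * a\<close> keeps the blocks so long that \<open>la\<close> is admissible as
  a weight.\<close>

lemma block_tail:
  fixes D :: nat
  shows "\<forall>\<^sub>F a in sequentially. \<forall>H i I (\<tau> :: nat \<Rightarrow> nat). H \<le> 2 ^ (8 * a) \<longrightarrow> 4 * i \<le> 3 * a \<longrightarrow> finite I \<longrightarrow> inj_on \<tau> I \<longrightarrow> card I = 2 ^ (a - i) \<longrightarrow>
     measure U {x. 3 * sqrt (VD D * 2 ^ (a - i) * (3 * ln (real a) + real i)) \<le> \<bar>\<Sum>k\<in>I. tp (cut D c) H (real (m (\<tau> k)) * x)\<bar>}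
       \<le> 4 * exp (- 2 * (3 * ln (real a) + real i))"
proof -
  define V where "V = VD D"
  have V: "0 < V" unfolding V_def by (rule VD_pos)
  have V4: "0 < 4 / V" using V by simp
  have R: "1 \<le> (2::real)" by simp
  show ?thesis
    using laplace_crude_perm[OF V4 R] eventually_block_weight_small[OF V] eventually_ge_at_top[of 3]
  proof eventually_elim
    case (elim a)
    show ?case
    proof (intro allI impI)
      fix H i :: nat and I :: "nat set" and \<tau> :: "nat \<Rightarrow> nat"
      assume *: "H \<le> 2 ^ (8 * a)" "4 * i \<le> 3 * a" "finite I" "inj_on \<tau> I" "card I = 2 ^ (a - i)"
      define h where "h = (2::real) ^ (a - i)"
      define yy where "yy = 3 * ln (real a) + real i"
      define la where "la = sqrt (yy / (V * h))"
      define S where "S = (\<lambda>x. \<Sum>k\<in>I. tp (cut D c) H (real (m (\<tau> k)) * x))"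
      have Sc: "continuous_on UNIV S" unfolding S_def by (intro continuous_intros)
      have h1: "1 \<le> h" unfolding h_def by simp
      have card: "real (card I) = h" using *(5) by (simp add: h_def)
      have lna: "0 < ln (real a)" "ln (real a) \<le> real a"
        using elim(3) ln_le_minus_one[of "real a"] by auto
      have lna': "3 * ln (real a) + real i \<le> 4 * real a"
      proof -
        have "ln (real a) \<le> real a - 1" using elim(3) by (intro ln_le_minus_one) auto
        then show ?thesis using *(2) by (auto simp: V_def)
      qed
      have yy: "0 < yy" "yy \<le> 4 * real a" using lna lna' unfolding yy_def by auto
      have la0: "0 < la" unfolding la_def using yy V h1 by auto
      have la2: "la\<^sup>2 = yy / (V * h)" unfolding la_def using yy V h1 by simp
      have h4: "2 ^ a \<le> h ^ 4"
      proof -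
        have "(2::real) ^ a \<le> 2 ^ (4 * (a - i))" using * by (intro power_increasing) auto
        then show ?thesis by (simp add: h_def power_mult[symmetric] mult.commute)
      qed
      \<comment> \<open>Blocks may be as short as \<open>2 ^ (a / 4)\<close>, so
        \<open>la\<^sup>2\<close> must be raised to the fourth power to bring \<open>2 ^ a\<close>
        into the denominator; this explains the eighth power of \<open>la\<close>.\<close>
      have lab: "la \<le> (19/20) ^ a"
      proof (rule power_le_imp_le_base[of _ 7])
        have "la ^ 8 = (la\<^sup>2) ^ 4" by (simp flip: power_mult)
        also have "\<dots> = yy ^ 4 / (V ^ 4 * h ^ 4)" by (simp add: la2 power_divide power_mult_distrib)
        also have "\<dots> \<le> (4 * real a) ^ 4 / (V ^ 4 * 2 ^ a)"
          using yy V h4 by (intro frac_le power_mono mult_left_mono mult_pos_pos) auto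
        also have "\<dots> \<le> (19/20::real) ^ (8 * a)" by (rule elim(2))
        also have "\<dots> = ((19/20::real) ^ a) ^ 8" by (simp add: mult.commute flip: power_mult)
        finally show "la ^ Suc 7 \<le> ((19/20::real) ^ a) ^ Suc 7" by simp
      qed simp
      have lap: "(\<integral>x. exp (la * S x) \<partial>U) \<le> 2 * exp yy" "(\<integral>x. exp (la * (- S x)) \<partial>U) \<le> 2 * exp yy"
      proof -
        have v: "(\<integral>x. exp (\<Sum>k\<in>I. v * tp (cut D c) H (real (m (\<tau> k)) * x)) \<partial>U) \<le> 2 * exp yy" if v: "\<bar>v\<bar> = la" for v
        proof -
          have v2: "v\<^sup>2 = la\<^sup>2" using v by (metis power2_abs)
          have s: "(\<Sum>k\<in>I. v\<^sup>2) = yy / V" using card la2 v2 h1 by simp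
          have "(\<integral>x. exp (\<Sum>k\<in>I. v * tp (cut D c) H (real (m (\<tau> k)) * x)) \<partial>U) \<le> 2 * exp (VD D * (\<Sum>k\<in>I. v\<^sup>2))"
          proof (rule elim(1)[rule_format])
            show "(\<Sum>k\<in>I. v\<^sup>2) \<le> 4 / V * real a" unfolding s using yy V by (simp add: divide_right_mono)
            have "(\<Sum>k\<in>I. \<bar>v\<bar>) = h * la" using card v by simp
            also have "\<dots> \<le> 2 ^ a * 1"
              unfolding h_def using la0 lab power_le_one[of "19/20::real" a]
              by (intro mult_mono power_increasing) auto
            finally show "(\<Sum>k\<in>I. \<bar>v\<bar>) \<le> 2 ^ a" by simp
          qed (use * v lab in auto)
          also have "VD D * (\<Sum>k\<in>I. v\<^sup>2) = yy" unfolding s using V by (simp add: V_def)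
          finally show ?thesis .
        qed
        from v[of la] v[of "- la"] la0
        show "(\<integral>x. exp (la * S x) \<partial>U) \<le> 2 * exp yy" "(\<integral>x. exp (la * (- S x)) \<partial>U) \<le> 2 * exp yy"
          unfolding S_def by (simp_all add: sum_distrib_left sum_negf)
      qed
      define t where "t = 3 * sqrt (V * h * yy)"
      have lat: "la * t = 3 * yy"
      proof -
        have "la * t = 3 * (sqrt (yy / (V * h)) * sqrt (V * h * yy))" unfolding la_def t_def by (simp only: mult_ac)
        also have "sqrt (yy / (V * h)) * sqrt (V * h * yy) = sqrt ((yy / (V * h)) * (V * h * yy))"
          by (rule real_sqrt_mult[symmetric])
        also have "(yy / (V * h)) * (V * h * yy) = yy\<^sup>2" using V h1 by (simp add: power2_eq_square)
        finally show ?thesis using yy by simp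
      qed
      have p: "measure U {x. t \<le> T x} \<le> 2 * exp (- 2 * yy)" if T: "continuous_on UNIV T" "(\<integral>x. exp (la * T x) \<partial>U) \<le> 2 * exp yy" for T
      proof -
        have "measure U {x. t \<le> T x} \<le> exp (- la * t) * (\<integral>x. exp (la * T x) \<partial>U)"
          using la0 by (intro exp_Markov T) auto
        also have "\<dots> \<le> exp (- la * t) * (2 * exp yy)" by (intro mult_left_mono T) auto
        also have "\<dots> = 2 * exp (- 2 * yy)" using lat by (simp flip: exp_add)
        finally show ?thesis .
      qed
      have [measurable]: "S \<in> borel_measurable borel" using Sc by (rule borel_measurable_continuous_onI)
      have "measure U {x. t \<le> \<bar>S x\<bar>} \<le> measure U ({x. t \<le> S x} \<union> {x. t \<le> - S x})"
        by (rule U.finite_measure_mono) auto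
      also have "\<dots> \<le> measure U {x. t \<le> S x} + measure U {x. t \<le> - S x}"
        by (rule measure_Un_le) auto
      also have "\<dots> \<le> 2 * exp (- 2 * yy) + 2 * exp (- 2 * yy)"
        by (intro add_mono p lap Sc continuous_intros)
      finally show "measure U {x. 3 * sqrt (VD D * 2 ^ (a - i) * (3 * ln (real a) + real i)) \<le> \<bar>\<Sum>k\<in>I. tp (cut D c) H (real (m (\<tau> k)) * x)\<bar>}
       \<le> 4 * exp (- 2 * (3 * ln (real a) + real i))"
        unfolding t_def S_def V_def h_def yy_def by simp
    qed
  qed
qed

text \<open>A union bound over all dyadic blocks down to level \<open>i0\<close>, followed by
  chaining. Of the constant 64 the levels use 63 and the short remainder 1.\<close>

theorem maximal_inequality:
  fixes D :: nat
  shows "\<forall>\<^sub>F a in sequentially. \<forall>H n0 (\<tau> :: nat \<Rightarrow> nat). H \<le> 2 ^ (8 * a) \<longrightarrow> inj \<tau> \<longrightarrow>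
     measure U {x. \<exists>j\<le>2 ^ a. 64 * sqrt (VD D * 2 ^ a * ln (real a)) < \<bar>\<Sum>k<j. tp (cut D c) H (real (m (\<tau> (n0 + k))) * x)\<bar>} \<le> 1 / (real a)\<^sup>2"
proof -
  define V where "V = VD D"
  have V: "0 < V" unfolding V_def by (rule VD_pos)
  have C0: "0 < C" using C1 by simp
  show ?thesis
    using block_tail[of D] eventually_short_blocks_negligible[OF V C0] eventually_ge_at_top[of 3]
  proof eventually_elim
    case (elim a)
    show ?case
    proof (intro allI impI)
      fix H n0 :: nat and \<tau> :: "nat \<Rightarrow> nat"
      assume H: "H \<le> 2 ^ (8 * a)" and inj: "inj \<tau>"
      \<comment> \<open>Stopping after three quarters of the levels leaves segments of length about
        \<open>2 ^ (a / 4)\<close>, whose trivial bound is far below the square root scale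
        \<open>2 ^ (a / 2)\<close>.\<close>
      define i0 where "i0 = (3 * a) div 4"
      have i0: "4 * i0 \<le> 3 * a" "i0 \<le> a" "4 * (a - i0) \<le> a + 4" unfolding i0_def by linarith+
      define g where "g = (\<lambda>x k. tp (cut D c) H (real (m (\<tau> (n0 + k))) * x))"
      define W where "W = V * 2 ^ a * ln (real a)"
      have lna: "1 \<le> ln (real a)"
      proof -
        have "exp 1 \<le> real a" proof -
          have "3 \<le> real a" using elim(3) by simp
          then show ?thesis using exp_le by linarith
        qed
        then show ?thesis using elim(3) by (subst ln_ge_iff) auto
      qed
      have W0: "0 < W" unfolding W_def using V lna by auto
      define t where "t = (\<lambda>i::nat. sqrt W * (6 * sqrt 3 * (5 / 6) ^ i))"
      define J where "J = (\<lambda>i r::nat. {r * 2 ^ (a - i)..<Suc r * 2 ^ (a - i)})"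
      define B where "B = (\<lambda>i r. {x. t i \<le> \<bar>\<Sum>k\<in>J i r. g x k\<bar>})"
      have gm [measurable]: "(\<lambda>x. g x k) \<in> borel_measurable borel" for k
        unfolding g_def by (intro borel_measurable_continuous_onI continuous_intros)
      have Bm [measurable]: "B i r \<in> sets borel" for i r unfolding B_def by measurable
      have tail: "measure U (B i r) \<le> 4 / (real a) ^ 6 * (1 / 4) ^ i" if i: "i \<le> i0" for i r
      proof -
        have ai: "i \<le> a" "4 * i \<le> 3 * a" using i i0 by auto
        have cmp: "3 * sqrt (VD D * 2 ^ (a - i) * (3 * ln (real a) + real i)) \<le> t i"
        proof -
          \<comment> \<open>The base \<open>25 / 18\<close> is chosen so that, after division by the
            factor \<open>2 ^ i\<close> from the halving of blocks, the ratio is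
            \<open>(5 / 6)\<^sup>2\<close>: the thresholds decay geometrically although the
            deviation parameter grows with \<open>i\<close>.\<close>
          have "1 + real i * (7 / 18) \<le> (1 + 7 / 18) ^ i" by (rule Bernoulli_inequality) simp
          then have b: "1 + real i \<le> 4 * (25 / 18) ^ i" by simp
          have "3 * ln (real a) + real i \<le> 3 * ln (real a) * (1 + real i)"
            using lna mult_mono[of 1 "3 * ln (real a)" "real i" "real i"] by (simp add: distrib_left)
          also have "\<dots> \<le> 3 * ln (real a) * (4 * (25 / 18) ^ i)" using lna b by (intro mult_left_mono) auto
          finally have "V * 2 ^ (a - i) * (3 * ln (real a) + real i) \<le> V * 2 ^ (a - i) * (3 * ln (real a) * (4 * (25 / 18) ^ i))"
            using V by (intro mult_left_mono) auto
          also have "\<dots> = W * (12 * (25 / 36) ^ i)"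
          proof -
            have "(2::real) ^ a = 2 ^ (a - i) * 2 ^ i" using ai by (simp flip: power_add)
            moreover have "(25 / 18 :: real) ^ i = (25 / 36) ^ i * 2 ^ i" by (simp flip: power_mult_distrib)
            ultimately show ?thesis by (simp add: W_def)
          qed
          also have "\<dots> = W * (2 * sqrt 3 * (5 / 6) ^ i)\<^sup>2"
          proof -
            have "((5 / 6 :: real) ^ i)\<^sup>2 = (25 / 36) ^ i" by (simp add: power2_eq_square flip: power_mult_distrib)
            then show ?thesis by (simp add: power_mult_distrib)
          qed
          finally have "sqrt (VD D * 2 ^ (a - i) * (3 * ln (real a) + real i)) \<le> sqrt (W * (2 * sqrt 3 * (5 / 6) ^ i)\<^sup>2)"
            unfolding V_def by (rule real_sqrt_le_mono)
          also have "\<dots> = sqrt W * (2 * sqrt 3 * (5 / 6) ^ i)" by (simp add: real_sqrt_mult real_sqrt_abs)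
          finally show ?thesis by (simp add: t_def)
        qed
        have "measure U (B i r) \<le> measure U {x. 3 * sqrt (VD D * 2 ^ (a - i) * (3 * ln (real a) + real i)) \<le> \<bar>\<Sum>k\<in>J i r. g x k\<bar>}"
        proof (rule U.finite_measure_mono)
          show "B i r \<subseteq> {x. 3 * sqrt (VD D * 2 ^ (a - i) * (3 * ln (real a) + real i)) \<le> \<bar>\<Sum>k\<in>J i r. g x k\<bar>}"
            unfolding B_def using cmp by auto
          show "{x. 3 * sqrt (VD D * 2 ^ (a - i) * (3 * ln (real a) + real i)) \<le> \<bar>\<Sum>k\<in>J i r. g x k\<bar>} \<in> sets U"
            by simp
        qed
        also have "\<dots> \<le> 4 * exp (- 2 * (3 * ln (real a) + real i))"
          unfolding g_def
        proof (rule elim(1)[rule_format, where \<tau> = "\<lambda>k. \<tau> (n0 + k)" and I = "J i r"])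
          show "inj_on (\<lambda>k. \<tau> (n0 + k)) (J i r)" 
            by (rule inj_onI) (use injD[OF inj] in fastforce)
        qed (use H ai in \<open>auto simp: J_def\<close>)
        also have "exp (- 2 * (3 * ln (real a) + real i)) = exp (- (6 * ln (real a))) * exp (- 2 * real i)"
          by (simp flip: exp_add)
        also have "exp (- (6 * ln (real a))) = 1 / (real a) ^ 6"
        proof -
          have "exp (6 * ln (real a)) = real a ^ 6" using elim(3) exp_of_nat_mult[of 6 "ln (real a)"] by simp
          then show ?thesis by (simp add: exp_minus inverse_eq_divide)
        qed
        also have "4 * (1 / (real a) ^ 6 * exp (- 2 * real i)) \<le> 4 * (1 / (real a) ^ 6 * (1 / 4) ^ i)"
        proof (intro mult_left_mono)
          have e4: "4 \<le> exp (2::real)"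
          proof -
            have "(2::real) * 2 \<le> exp 1 * exp 1" using exp_ge_add_one_self[of 1] by (intro mult_mono) auto
            then show ?thesis by (simp flip: exp_add)
          qed
          have "exp (- 2 * real i) = exp (-2) ^ i" by (simp add: exp_of_nat_mult[of i "-2", symmetric] mult.commute)
          also have "\<dots> \<le> (1 / 4) ^ i" using e4 by (intro power_mono) (auto simp: exp_minus field_simps)
          finally show "exp (- 2 * real i) \<le> (1 / 4) ^ i" .
        qed auto
        finally show ?thesis by simp
      qed
      have incl: "{x. \<exists>j\<le>2 ^ a. 64 * sqrt (VD D * 2 ^ a * ln (real a)) < \<bar>\<Sum>k<j. g x k\<bar>} \<subseteq> (\<Union>i\<in>{..i0}. \<Union>r\<in>{..<2 ^ i}. B i r)"
      proof (rule subsetI, rule ccontr)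
        fix x
        assume "x \<in> {x. \<exists>j\<le>2 ^ a. 64 * sqrt (VD D * 2 ^ a * ln (real a)) < \<bar>\<Sum>k<j. g x k\<bar>}"
        then obtain j where j: "j \<le> 2 ^ a" "64 * sqrt W < \<bar>\<Sum>k<j. g x k\<bar>" unfolding W_def V_def by blast
        assume nx: "x \<notin> (\<Union>i\<in>{..i0}. \<Union>r\<in>{..<2 ^ i}. B i r)"
        have x: "\<bar>\<Sum>k\<in>J i r. g x k\<bar> < t i" if "i \<le> i0" "r < 2 ^ i" for i r
        proof -
          have "x \<notin> B i r" using nx that by blast
          then show ?thesis unfolding B_def by auto
        qed
        have "\<bar>\<Sum>k<j. g x k\<bar> \<le> (\<Sum>i\<le>i0. t i) + (18 * C * real a) * 2 ^ (a - i0)"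
          by (rule dyadic_chaining[OF _ _ i0(2) j(1)])
             (use x H elim(3) in \<open>auto simp: J_def g_def intro: tp_bound less_imp_le\<close>)
        \<comment> \<open>The 63 is \<open>6 * sqrt 3 * 6\<close> with
          \<open>sqrt 3 \<le> 7 / 4\<close>; the last 6 is the geometric series of ratio
          \<open>5 / 6\<close>.\<close>
        also have "(\<Sum>i\<le>i0. t i) \<le> 63 * sqrt W"
        proof -
          have "(\<Sum>i\<le>i0. t i) = sqrt W * (6 * sqrt 3) * (\<Sum>i<Suc i0. (5 / 6) ^ i)"
            unfolding t_def lessThan_Suc_atMost sum_distrib_left by (simp only: mult_ac)
          also have "(\<Sum>i<Suc i0. (5 / 6 :: real) ^ i) \<le> 6"
            by (subst geometric_sum) (auto simp: field_simps)
          also have "sqrt W * (6 * sqrt 3) * 6 \<le> sqrt W * 63"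
          proof -
            have "sqrt 3 \<le> sqrt ((7/4)\<^sup>2)" by (intro real_sqrt_le_mono) (simp add: power2_eq_square)
            then have "sqrt 3 \<le> 7 / 4" by simp
            then have "6 * sqrt 3 * 6 \<le> 63" by simp
            from mult_left_mono[OF this, of "sqrt W"] W0 show ?thesis by (simp add: mult_ac)
          qed
          finally show ?thesis using W0 by (simp add: mult.commute)
        qed
        also have "(18 * C * real a) * 2 ^ (a - i0) \<le> sqrt W"
        proof (rule power_le_imp_le_base[of _ 3])
          have "((18 * C * real a) * 2 ^ (a - i0)) ^ 4 = (18 * C * real a) ^ 4 * 2 ^ (4 * (a - i0))"
            by (simp only: power_mult_distrib flip: power_mult) (simp add: mult.commute)
          also have "\<dots> \<le> (18 * C * real a) ^ 4 * 2 ^ (a + 4)"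
            using i0(3) by (intro mult_left_mono power_increasing) auto
          also have "\<dots> = (18 * C * real a) ^ 4 * (16 * 2 ^ a)" by (simp add: power_add)
          also have "\<dots> \<le> W\<^sup>2" unfolding W_def by (rule elim(2))
          also have "\<dots> = (sqrt W) ^ 4"
          proof -
            have "(sqrt W) ^ 4 = ((sqrt W)\<^sup>2)\<^sup>2" by (simp flip: power_mult)
            then show ?thesis using W0 by simp
          qed
          finally show "((18 * C * real a) * 2 ^ (a - i0)) ^ Suc 3 \<le> (sqrt W) ^ Suc 3" by simp
        qed (use W0 in simp)
        finally show False using j(2) by linarith
      qed
      have "measure U {x. \<exists>j\<le>2 ^ a. 64 * sqrt (VD D * 2 ^ a * ln (real a)) < \<bar>\<Sum>k<j. g x k\<bar>} \<le> measure U (\<Union>i\<in>{..i0}. \<Union>r\<in>{..<2 ^ i}. B i r)"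
        by (rule U.finite_measure_mono[OF incl]) simp
      also have "\<dots> \<le> (\<Sum>i\<le>i0. measure U (\<Union>r\<in>{..<2 ^ i}. B i r))"
        by (rule U.finite_measure_subadditive_finite) auto
      also have "\<dots> \<le> (\<Sum>i\<le>i0. \<Sum>r<2 ^ i. measure U (B i r))"
        by (intro sum_mono U.finite_measure_subadditive_finite) auto
      also have "\<dots> \<le> (\<Sum>i\<le>i0. \<Sum>r<(2::nat) ^ i. 4 / (real a) ^ 6 * (1 / 4) ^ i)"
        by (intro sum_mono tail) auto
      also have "\<dots> = 4 / (real a) ^ 6 * (\<Sum>i<Suc i0. (1 / 2) ^ i)"
      proof -
        have "(2::real) ^ i * (1 / 4) ^ i = (1 / 2) ^ i" for i by (simp flip: power_mult_distrib)
        then show ?thesis by (simp add: sum_distrib_left sum_divide_distrib lessThan_Suc_atMost mult_ac)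
      qed
      also have "\<dots> \<le> 4 / (real a) ^ 6 * 2"
      proof (rule mult_left_mono)
        show "(\<Sum>i<Suc i0. (1 / 2 :: real) ^ i) \<le> 2"
          by (subst geometric_sum) (auto simp: field_simps)
      qed simp
      also have "\<dots> \<le> 1 / (real a)\<^sup>2"
      proof -
        have "(8::real) \<le> 3 ^ 4" by simp
        also have "\<dots> \<le> real a ^ 4" using elim(3) by (intro power_mono) auto
        finally have "8 * (real a)\<^sup>2 \<le> real a ^ 4 * (real a)\<^sup>2" by (intro mult_right_mono) auto
        also have "real a ^ 4 * (real a)\<^sup>2 = real a ^ 6" by (simp flip: power_add)
        finally show ?thesis using elim(3) by (simp add: field_simps)
      qed
      finally show "measure U {x. \<exists>j\<le>2 ^ a. 64 * sqrt (VD D * 2 ^ a * ln (real a)) < \<bar>\<Sum>k<j. tp (cut D c) H (real (m (\<tau> (n0 + k))) * x)\<bar>} \<le> 1 / (real a)\<^sup>2"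
        unfolding g_def .
    qed
  qed
qed

end

section \<open>The upper bound\<close>

lemma borel_cantelli_U:
  assumes B: "\<And>a. B a \<in> sets borel" and le: "\<forall>\<^sub>F a in sequentially. measure U (B a) \<le> f a" and f: "summable f"
  shows "AE x in U. \<forall>\<^sub>F a in sequentially. x \<notin> B a"
proof -
  have "summable (\<lambda>a. measure U (B a))"
    by (rule summable_comparison_test_ev[OF _ f]) (use le in \<open>auto elim!: eventually_mono\<close>)
  then have "AE x in U. \<forall>\<^sub>F a in sequentially. x \<in> space U - B a"
    using B by (intro borel_cantelli_AE1) (auto simp: U.emeasure_eq_measure)
  then show ?thesis by simp
qed

lemma summable_inverse_powr: "e > 0 \<Longrightarrow> summable (\<lambda>a. K * real a powr (- 1 - e))"
  by (intro summable_mult) (simp add: summable_real_powr_iff)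

lemma eventually_ln_le_scaled_ln: "e > 0 \<Longrightarrow> \<forall>\<^sub>F a::nat in sequentially. ln (real a) \<le> (1 + e)\<^sup>2 * ln (real a * ln 2)"
  by real_asymp

lemma eventually_ln_le_ln_shifted: "\<forall>\<^sub>F a::nat in sequentially. ln (real a) \<le> 4 * ln ((real a - 1) * ln 2)"
  by real_asymp

lemma sum_lessThan_add: "(\<Sum>k<n + j. h k) = (\<Sum>k<n. h k) + (\<Sum>k<j. h (n + k) :: real)" for n :: nat
  by (induction j) simp_all

lemma eventually_const_degree: "\<forall>\<^sub>F a in sequentially. D \<le> 2 ^ (8 * a)" for D :: nat
proof -
  have "\<forall>\<^sub>F a::nat in sequentially. real D \<le> 2 ^ (8 * a)" by real_asymp
  then show ?thesis by eventually_elim (metis of_nat_le_iff of_nat_numeral of_nat_power)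
qed

lemma eventually_dyadic:
  assumes "\<forall>\<^sub>F a in sequentially. \<forall>N. 2 ^ a \<le> N \<longrightarrow> N < 2 ^ Suc a \<longrightarrow> P N"
  shows "\<forall>\<^sub>F N :: nat in sequentially. P N"
proof -
  obtain a0 where a0: "\<And>a N. a0 \<le> a \<Longrightarrow> 2 ^ a \<le> N \<Longrightarrow> N < 2 ^ Suc a \<Longrightarrow> P N"
    using assms unfolding eventually_sequentially by blast
  show ?thesis unfolding eventually_sequentially
  proof (intro exI allI impI)
    fix N :: nat assume N: "2 ^ a0 \<le> N"
    then have "0 < N" by (auto intro: less_le_trans[of 0 "2 ^ a0"])
    then obtain a where a: "2 ^ a \<le> N" "N < 2 ^ Suc a"
      using ex_power_ivl1[of 2 N] by auto
    have "2 ^ a0 < (2::nat) ^ Suc a" using N a by linarith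
    then have "a0 < Suc a" by (rule power_less_imp_less_exp[rotated]) simp
    then show "P N" using a by (intro a0) auto
  qed
qed

lemma eventually_dyadic':
  assumes "\<forall>\<^sub>F a in sequentially. \<forall>N. 2 ^ (a - 1) \<le> N \<longrightarrow> N \<le> 2 ^ a \<longrightarrow> P N"
  shows "\<forall>\<^sub>F N :: nat in sequentially. P N"
proof (rule eventually_dyadic)
  have "\<forall>\<^sub>F a in sequentially. \<forall>N. 2 ^ (Suc a - 1) \<le> N \<longrightarrow> N \<le> 2 ^ Suc a \<longrightarrow> P N"
    by (rule eventually_compose_filterlim[OF assms filterlim_Suc])
  then show "\<forall>\<^sub>F a in sequentially. \<forall>N. 2 ^ a \<le> N \<longrightarrow> N < 2 ^ Suc a \<longrightarrow> P N"
    by eventually_elim auto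
qed

text \<open>The value at \<open>N = 2\<close> is negative, since \<open>sqrt\<close> is extended as
  an odd function; nonnegativity is therefore derived only for large \<open>N\<close>.\<close>

definition lil :: "nat \<Rightarrow> real" where "lil N = sqrt (2 * real N * ln (ln (real N)))"

lemma ln_ln_ge:
  assumes "2 ^ a \<le> N" "1 \<le> a" shows "ln (real a * ln 2) \<le> ln (ln (real N))"
proof -
  have "real a * ln 2 = ln (2 ^ a)" by (simp add: ln_realpow)
  also have "\<dots> \<le> ln (real N)"
  proof (rule ln_mono)
    show "(2::real) ^ a \<le> real N" using assms by (metis of_nat_le_iff of_nat_numeral of_nat_power)
  qed auto
  finally have "real a * ln 2 \<le> ln (real N)" .
  then show ?thesis using assms by (intro ln_mono) auto
qed

context fourier_lac
begin

text \<open>The start \<open>n0 a\<close> may depend on \<open>a\<close>, so that one statement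
  controls both initial segments and the fluctuation after a moving grid point.\<close>

lemma AE_maximal:
  fixes D :: nat and H n0 :: "nat \<Rightarrow> nat" and \<tau> :: "nat \<Rightarrow> nat"
  assumes H: "\<forall>\<^sub>F a in sequentially. H a \<le> 2 ^ (8 * a)" and inj: "inj \<tau>"
  shows "AE x in U. \<forall>\<^sub>F a in sequentially. \<forall>j\<le>2 ^ a.
     \<bar>\<Sum>k<j. tp (cut D c) (H a) (real (m (\<tau> (n0 a + k))) * x)\<bar> \<le> 64 * sqrt (VD D * 2 ^ a * ln (real a))"
proof -
  define B where "B = (\<lambda>a. {x. \<exists>j\<le>2 ^ a. 64 * sqrt (VD D * 2 ^ a * ln (real a)) < \<bar>\<Sum>k<j. tp (cut D c) (H a) (real (m (\<tau> (n0 a + k))) * x)\<bar>})"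
  have "AE x in U. \<forall>\<^sub>F a in sequentially. x \<notin> B a"
  proof (rule borel_cantelli_U)
    fix a
    have [measurable]: "(\<lambda>x. \<Sum>k<j. tp (cut D c) (H a) (real (m (\<tau> (n0 a + k))) * x)) \<in> borel_measurable borel" for j
      by (intro borel_measurable_continuous_onI continuous_intros)
    have "B a = (\<Union>j\<in>{..2 ^ a}. {x \<in> space borel. 64 * sqrt (VD D * 2 ^ a * ln (real a)) < \<bar>\<Sum>k<j. tp (cut D c) (H a) (real (m (\<tau> (n0 a + k))) * x)\<bar>})"
      unfolding B_def by auto
    then show "B a \<in> sets borel" by (simp only:) measurable
  next
    show "summable (\<lambda>a. 1 / (real a)\<^sup>2)" using inverse_power_summable[of 2, where 'a = real] by (simp add: inverse_eq_divide power_one_over)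
    show "\<forall>\<^sub>F a in sequentially. measure U (B a) \<le> 1 / (real a)\<^sup>2"
      using maximal_inequality[of D] H
      by eventually_elim (use inj in \<open>auto simp: B_def\<close>)
  qed
  then show ?thesis
    by eventually_elim (auto elim!: eventually_mono simp: B_def not_less)
qed

text \<open>The degree \<open>H a\<close> is allowed to grow with the scale. The passage from 64 to
  128 pays for \<open>ln a \<le> 4 * ln (ln N)\<close>, while \<open>2 ^ a \<le> 2 * N\<close> is
  absorbed by the 2 inside \<open>lil\<close>.\<close>

lemma AE_upper_tail:
  fixes D :: nat and H :: "nat \<Rightarrow> nat" and \<tau> :: "nat \<Rightarrow> nat"
  assumes H: "\<forall>\<^sub>F a in sequentially. H a \<le> 2 ^ (8 * a)" and inj: "inj \<tau>"
  shows "AE x in U. \<forall>\<^sub>F a in sequentially. \<forall>N. 2 ^ (a - 1) \<le> N \<longrightarrow> N \<le> 2 ^ a \<longrightarrow>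
     \<bar>\<Sum>k<N. tp (cut D c) (H a) (real (m (\<tau> k)) * x)\<bar> \<le> 128 * sqrt (VD D) * lil N"
proof -
  have "AE x in U. \<forall>\<^sub>F a in sequentially. \<forall>j\<le>2 ^ a.
     \<bar>\<Sum>k<j. tp (cut D c) (H a) (real (m (\<tau> (0 + k))) * x)\<bar> \<le> 64 * sqrt (VD D * 2 ^ a * ln (real a))"
    by (rule AE_maximal[OF H inj])
  then show ?thesis
  proof eventually_elim
    case (elim x)
    then show ?case using eventually_ln_le_ln_shifted eventually_ge_at_top[of 2]
    proof eventually_elim
      case (elim a)
      show ?case
      proof (intro allI impI)
        fix N :: nat assume N: "2 ^ (a - 1) \<le> N" "N \<le> 2 ^ a"
        have "\<bar>\<Sum>k<N. tp (cut D c) (H a) (real (m (\<tau> k)) * x)\<bar> \<le> 64 * sqrt (VD D * 2 ^ a * ln (real a))"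
          using elim(1) N by simp
        also have "VD D * 2 ^ a * ln (real a) \<le> VD D * (2 * real N) * (4 * ln (ln (real N)))"
        proof (intro mult_mono mult_left_mono)
          have "2 ^ a = 2 * 2 ^ (a - 1)" using elim(3) by (simp add: power_eq_if)
          then show "2 ^ a \<le> 2 * real N" using N(1) by (metis mult_left_mono of_nat_le_iff of_nat_numeral of_nat_power zero_le_numeral)
          have "ln ((real a - 1) * ln 2) \<le> ln (ln (real N))" using ln_ln_ge[OF N(1)] elim(3) by (simp add: of_nat_diff)
          then show "ln (real a) \<le> 4 * ln (ln (real N))" using elim(2) by linarith
        qed (use VD_pos[of D] elim(3) in auto)
        also have "\<dots> = VD D * 2\<^sup>2 * (2 * real N * ln (ln (real N)))" by simp
        also have "sqrt \<dots> = sqrt (VD D) * 2 * lil N" unfolding lil_def by (simp only: real_sqrt_mult real_sqrt_abs abs_numeral)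
        finally show "\<bar>\<Sum>k<N. tp (cut D c) (H a) (real (m (\<tau> k)) * x)\<bar> \<le> 128 * sqrt (VD D) * lil N" by simp
      qed
    qed
  qed
qed

end

context fourier_lac_dioph
begin

text \<open>The index type is left open because the lower bound sums over pairs consisting of a
  block and a position in it.\<close>

lemma laplace_exact_perm:
  assumes A: "0 < A" and R: "1 \<le> R" and e: "0 < e"
  shows "\<forall>\<^sub>F a in sequentially. \<forall>v (I :: 'i set) \<tau>. finite I \<longrightarrow> inj_on \<tau> I \<longrightarrow> (\<forall>i\<in>I. \<bar>v i\<bar> \<le> (19/20) ^ a) \<longrightarrow>
     (\<Sum>i\<in>I. (v i)\<^sup>2) \<le> A * ln (real a) \<longrightarrow> (\<Sum>i\<in>I. \<bar>v i\<bar>) \<le> R ^ a \<longrightarrow>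
     \<bar>exp (- s2 D * (\<Sum>i\<in>I. (v i)\<^sup>2) / 2) * (\<integral>x. exp (\<Sum>i\<in>I. v i * tp c D (real (m (\<tau> i)) * x)) \<partial>U) - 1\<bar> \<le> e"
  using laplace_exact_eventually[OF A R e, of D]
proof eventually_elim
  case (elim a)
  show ?case
  proof (intro allI impI)
    fix v :: "'i \<Rightarrow> real" and I :: "'i set" and \<tau> :: "'i \<Rightarrow> nat"
    assume *: "finite I" "inj_on \<tau> I" "\<forall>i\<in>I. \<bar>v i\<bar> \<le> (19/20) ^ a"
      "(\<Sum>i\<in>I. (v i)\<^sup>2) \<le> A * ln (real a)" "(\<Sum>i\<in>I. \<bar>v i\<bar>) \<le> R ^ a"
    obtain w K where w: "\<And>h. (\<Sum>k<K. w k * h k) = (\<Sum>i\<in>I. v i * h (\<tau> i))"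
      "(\<Sum>k<K. (w k)\<^sup>2) = (\<Sum>i\<in>I. (v i)\<^sup>2)" "(\<Sum>k<K. \<bar>w k\<bar>) = (\<Sum>i\<in>I. \<bar>v i\<bar>)"
      "\<And>k b. 0 \<le> b \<Longrightarrow> (\<And>i. i \<in> I \<Longrightarrow> \<bar>v i\<bar> \<le> b) \<Longrightarrow> \<bar>w k\<bar> \<le> b"
      by (rule reorder_weights[OF *(1,2), of v]) blast
    have "\<bar>w k\<bar> \<le> (19/20) ^ a" for k by (rule w(4)) (use * in auto)
    then show "\<bar>exp (- s2 D * (\<Sum>i\<in>I. (v i)\<^sup>2) / 2) * (\<integral>x. exp (\<Sum>i\<in>I. v i * tp c D (real (m (\<tau> i)) * x)) \<partial>U) - 1\<bar> \<le> e"
      using elim[rule_format, of w K] * w(2,3) w(1)[of "\<lambda>k. tp c D (real (m k) * x)" for x] by simp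
  qed
qed

text \<open>Chernoff's bound with the Gaussian transform: \<open>la\<close> is tuned so that the
  Gaussian exponent is at most \<open>ln a\<close> while \<open>la * t = 2 * (1 + e) * ln a\<close>.
  The variance is replaced by a positive majorant \<open>v\<close>, so that \<open>la\<close> is
  meaningful also when \<open>s2 D = 0\<close>.\<close>

lemma upper_tail_exact:
  fixes D :: nat
  assumes v: "s2 D \<le> v" "0 < v" and e: "0 \<le> e"
  shows "\<forall>\<^sub>F a in sequentially. \<forall>I (\<tau> :: nat \<Rightarrow> nat). finite I \<longrightarrow> inj_on \<tau> I \<longrightarrow> 2 ^ a \<le> card I \<longrightarrow> card I \<le> 2 ^ Suc a \<longrightarrow>
     measure U {x. (1 + e) * sqrt v * sqrt (2 * real (card I) * ln (real a)) \<le> (\<Sum>k\<in>I. tp c D (real (m (\<tau> k)) * x))}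
       \<le> 2 * real a powr (- 1 - 2 * e)"
proof -
  have A: "0 < 2 / v" using v by simp
  have as: "\<forall>\<^sub>F a::nat in sequentially. 2 * ln (real a) / v \<le> (9 / 5) ^ a" using v(2) by real_asymp
  show ?thesis
    using laplace_exact_perm[where 'i = nat, OF A, of 4 1 D, simplified] as eventually_ge_at_top[of 2]
  proof eventually_elim
    case (elim a)
    show ?case
    proof (intro allI impI)
      fix I :: "nat set" and \<tau> :: "nat \<Rightarrow> nat"
      assume *: "finite I" "inj_on \<tau> I" "2 ^ a \<le> card I" "card I \<le> 2 ^ Suc a"
      define G where "G = real (card I)"
      have G: "2 ^ a \<le> G" "G \<le> 2 * 2 ^ a" using *(3,4) unfolding G_def
        by (metis of_nat_le_iff of_nat_numeral of_nat_power) (metis *(4) of_nat_le_iff of_nat_numeral of_nat_power power_Suc)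
      have G0: "0 < G" using G(1) by (rule less_le_trans[rotated]) simp
      define la where "la = sqrt (2 * ln (real a) / (v * G))"
      define S where "S = (\<lambda>x. \<Sum>k\<in>I. tp c D (real (m (\<tau> k)) * x))"
      have Sc: "continuous_on UNIV S" unfolding S_def by (intro continuous_intros)
      have lna: "0 < ln (real a)" using elim(3) by simp
      have la2: "la\<^sup>2 = 2 * ln (real a) / (v * G)" unfolding la_def using lna v G0 by simp
      have la0: "0 \<le> la" unfolding la_def using lna v G0 by simp
      have lab: "la \<le> (19/20) ^ a"
      proof (rule power2_le_imp_le)
        have "la\<^sup>2 = (2 * ln (real a) / v) / G" by (simp add: la2)
        also have "\<dots> \<le> (9/5) ^ a / 2 ^ a" using elim(2) G lna v by (intro frac_le) auto
        also have "\<dots> = (9/10) ^ a" by (simp flip: power_divide)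
        also have "\<dots> \<le> ((19/20)\<^sup>2) ^ a" by (intro power_mono) (auto simp: power2_eq_square)
        also have "\<dots> = ((19/20) ^ a)\<^sup>2" by (simp add: mult.commute flip: power_mult)
        finally show "la\<^sup>2 \<le> ((19/20) ^ a)\<^sup>2" .
      qed simp
      have s: "(\<Sum>k\<in>I. la\<^sup>2) = 2 * ln (real a) / v" using G0 by (simp add: la2 flip: G_def)
      have W1: "(\<Sum>k\<in>I. \<bar>la\<bar>) \<le> 4 ^ a"
      proof -
        have "(\<Sum>k\<in>I. \<bar>la\<bar>) = G * la" using la0 by (simp add: G_def)
        also have "\<dots> \<le> (2 * 2 ^ a) * 1" using G G0 la0 lab power_le_one[of "19/20::real" a] by (intro mult_mono) auto
        also have "\<dots> \<le> 2 ^ a * 2 ^ a" using elim(3) power_increasing[of 1 a "2::real"] by simp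
        also have "\<dots> = 4 ^ a" by (simp flip: power_mult_distrib)
        finally show ?thesis .
      qed
      have "\<bar>exp (- s2 D * (2 * ln (real a) / v) / 2) * (\<integral>x. exp (\<Sum>i\<in>I. la * tp c D (real (m (\<tau> i)) * x)) \<partial>U) - 1\<bar> \<le> 1"
        using elim(1)[rule_format, of I \<tau> "\<lambda>_. la"] * lab la0 W1 s by simp
      then have "exp (- s2 D * (2 * ln (real a) / v) / 2) * (\<integral>x. exp (la * S x) \<partial>U) \<le> 2"
        unfolding S_def sum_distrib_left by linarith
      then have "exp (- (s2 D * ln (real a) / v)) * (\<integral>x. exp (la * S x) \<partial>U) \<le> 2" by simp
      then have "exp (s2 D * ln (real a) / v) * (exp (- (s2 D * ln (real a) / v)) * (\<integral>x. exp (la * S x) \<partial>U)) \<le> exp (s2 D * ln (real a) / v) * 2"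
        by (rule mult_left_mono) simp
      then have "(\<integral>x. exp (la * S x) \<partial>U) \<le> 2 * exp (s2 D * ln (real a) / v)"
        by (simp only: mult.assoc[symmetric] exp_add[symmetric]) simp
      also have "\<dots> \<le> 2 * exp (ln (real a))"
        using v lna by (simp add: field_simps mult_right_mono)
      finally have lap: "(\<integral>x. exp (la * S x) \<partial>U) \<le> 2 * exp (ln (real a))" .
      define t where "t = (1 + e) * sqrt v * sqrt (2 * G * ln (real a))"
      have lat: "la * t = 2 * (1 + e) * ln (real a)"
      proof -
        have "la * t = (1 + e) * (sqrt (2 * ln (real a) / (v * G)) * sqrt v * sqrt (2 * G * ln (real a)))" unfolding la_def t_def by (simp only: mult_ac)
        also have "sqrt (2 * ln (real a) / (v * G)) * sqrt v * sqrt (2 * G * ln (real a)) = sqrt ((2 * ln (real a) / (v * G)) * v * (2 * G * ln (real a)))"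
          by (simp only: real_sqrt_mult)
        also have "(2 * ln (real a) / (v * G)) * v * (2 * G * ln (real a)) = (2 * ln (real a))\<^sup>2" using v G0 by (simp add: power2_eq_square)
        also have "sqrt ((2 * ln (real a))\<^sup>2) = 2 * ln (real a)" by (rule real_sqrt_unique) (use lna in auto)
        finally show ?thesis by simp
      qed
      have "measure U {x. t \<le> S x} \<le> exp (- la * t) * (\<integral>x. exp (la * S x) \<partial>U)"
        using la0 by (intro exp_Markov Sc)
      also have "\<dots> \<le> exp (- la * t) * (2 * exp (ln (real a)))" by (intro mult_left_mono lap) auto
      also have "\<dots> = 2 * exp ((- 1 - 2 * e) * ln (real a))" using lat by (simp add: algebra_simps flip: exp_add)
      also have "\<dots> = 2 * real a powr (- 1 - 2 * e)" using elim(3) by (simp add: powr_def)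
      finally show "measure U {x. (1 + e) * sqrt v * sqrt (2 * real (card I) * ln (real a)) \<le> (\<Sum>k\<in>I. tp c D (real (m (\<tau> k)) * x))}
       \<le> 2 * real a powr (- 1 - 2 * e)"
        unfolding t_def S_def G_def .
    qed
  qed
qed

lemma tp_cut_0: "tp (cut 0 c) D = tp c D"
  unfolding tp_def[abs_def] by (intro ext arg_cong[of _ _ Re] sum.cong) (auto simp: cut_def freqs_def)

text \<open>The sharp tail is summable only over boundedly many points per scale, so it is applied
  on a grid of \<open>2 ^ b\<close> points between consecutive powers of 2. The maximal inequality,
  whose constant is not sharp, bridges gaps of length \<open>2 ^ (a - b)\<close>; a large
  \<open>b\<close> makes its contribution small.\<close>

lemma AE_upper_poly:
  fixes D :: nat and \<tau> :: "nat \<Rightarrow> nat"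
  assumes inj: "inj \<tau>" and eps: "0 < eps"
  shows "AE x in U. \<forall>\<^sub>F N in sequentially. (\<Sum>k<N. tp c D (real (m (\<tau> k)) * x)) \<le> (sqrt (s2 D) + eps) * lil N"
proof -
  define y where "y = sqrt (s2 D)"
  have y0: "0 \<le> y" unfolding y_def using s2_nonneg by simp
  \<comment> \<open>Chosen so that \<open>(y + eps) * e = eps / 8\<close>: a factor
    \<open>1 + e\<close> is lost in the tail bound and another in comparing \<open>ln a\<close> with
    \<open>ln (ln N)\<close>, and both must fit into \<open>eps\<close>.\<close>
  define e where "e = eps / (8 * (y + eps))"
  have e0: "0 < e" unfolding e_def using eps y0 by simp
  have ye: "(y + eps) * e = eps / 8" unfolding e_def using eps y0 by (simp add: field_simps)
  define v where "v = (y + eps / 4)\<^sup>2"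
  have v: "s2 D \<le> v" "0 < v" "sqrt v = y + eps / 4"
  proof -
    show sv: "sqrt v = y + eps / 4" unfolding v_def using y0 eps by simp
    have "sqrt (s2 D) \<le> sqrt v" unfolding sv using eps by (simp add: y_def)
    then show "s2 D \<le> v" by simp
    show "0 < v" unfolding v_def using y0 eps by simp
  qed
  have V0: "0 < VD 0" by (rule VD_pos)
  have "\<exists>b::nat. 64 * sqrt (VD 0 / 2 ^ b) \<le> eps / 4"
  proof -
    have "((\<lambda>b::nat. 64 * sqrt (VD 0 / 2 ^ b)) \<longlonglongrightarrow> 0)" using V0 by real_asymp
    then have "\<forall>\<^sub>F b::nat in sequentially. 64 * sqrt (VD 0 / 2 ^ b) < eps / 4"
      by (rule order_tendstoD(2)) (use eps in simp)
    then show ?thesis by (auto dest!: eventually_happens intro: less_imp_le)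
  qed
  then obtain b :: nat where b: "64 * sqrt (VD 0 / 2 ^ b) \<le> eps / 4" by blast
  define G where "G = (\<lambda>a r::nat. 2 ^ a + r * 2 ^ (a - b) :: nat)"
  define S where "S = (\<lambda>N x. \<Sum>k<N. tp c D (real (m (\<tau> k)) * x))"
  have Sm: "S N \<in> borel_measurable borel" for N
    unfolding S_def by (intro borel_measurable_continuous_onI continuous_intros)
  have grid: "AE x in U. \<forall>r\<in>{..<2 ^ b}. \<forall>\<^sub>F a in sequentially. S (G a r) x < (1 + e) * sqrt v * sqrt (2 * real (G a r) * ln (real a))"
  proof (rule AE_finite_allI)
    fix r :: nat assume "r \<in> {..<2 ^ b}"
    then have r: "r < 2 ^ b" by simp
    define B where "B = (\<lambda>a. {x \<in> space borel. (1 + e) * sqrt v * sqrt (2 * real (G a r) * ln (real a)) \<le> S (G a r) x})"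
    have "AE x in U. \<forall>\<^sub>F a in sequentially. x \<notin> B a"
    proof (rule borel_cantelli_U)
      note Sm[measurable]
      show "B a \<in> sets borel" for a unfolding B_def by measurable
      show "summable (\<lambda>a. 2 * real a powr (- 1 - 2 * e))" using e0 by (intro summable_inverse_powr) simp
      show "\<forall>\<^sub>F a in sequentially. measure U (B a) \<le> 2 * real a powr (- 1 - 2 * e)"
        using upper_tail_exact[OF v(1,2) less_imp_le[OF e0]] eventually_ge_at_top[of b]
      proof eventually_elim
        case (elim a)
        have "r * 2 ^ (a - b) \<le> 2 ^ b * 2 ^ (a - b)" using r by (intro mult_right_mono) auto
        also have "\<dots> = (2::nat) ^ a" using elim(2) by (simp flip: power_add)
        finally have "G a r \<le> 2 ^ Suc a" by (simp add: G_def)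
        moreover have "2 ^ a \<le> G a r" by (simp add: G_def)
        ultimately show ?case
          using elim(1)[rule_format, of "{..<G a r}" \<tau>] inj_on_subset[OF inj] by (simp add: B_def S_def)
      qed
    qed
    then show "AE x in U. \<forall>\<^sub>F a in sequentially. S (G a r) x < (1 + e) * sqrt v * sqrt (2 * real (G a r) * ln (real a))"
      by eventually_elim (auto elim!: eventually_mono simp: B_def not_le)
  qed simp
  have incr: "AE x in U. \<forall>r\<in>{..<2 ^ b}. \<forall>\<^sub>F a in sequentially. \<forall>j\<le>2 ^ (a - b).
     \<bar>\<Sum>k<j. tp c D (real (m (\<tau> (G a r + k))) * x)\<bar> \<le> 64 * sqrt (VD 0 * 2 ^ (a - b) * ln (real (a - b)))"
  proof (rule AE_finite_allI)
    fix r :: nat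
    \<comment> \<open>The inequality is used at scale \<open>a\<close> around grid points of scale
      \<open>a + b\<close>; renaming the scale afterwards avoids trouble with truncated
      subtraction.\<close>
    have "AE x in U. \<forall>\<^sub>F a in sequentially. \<forall>j\<le>2 ^ a.
       \<bar>\<Sum>k<j. tp (cut 0 c) D (real (m (\<tau> (G (a + b) r + k))) * x)\<bar> \<le> 64 * sqrt (VD 0 * 2 ^ a * ln (real a))"
      by (rule AE_maximal[OF eventually_const_degree inj])
    then show "AE x in U. \<forall>\<^sub>F a in sequentially. \<forall>j\<le>2 ^ (a - b).
     \<bar>\<Sum>k<j. tp c D (real (m (\<tau> (G a r + k))) * x)\<bar> \<le> 64 * sqrt (VD 0 * 2 ^ (a - b) * ln (real (a - b)))"
    proof eventually_elim
      case (elim x)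
      then show ?case unfolding tp_cut_0
        by (subst eventually_sequentially_seg[of _ b, symmetric]) simp
    qed
  qed simp
  show ?thesis using grid incr
  proof eventually_elim
    case (elim x)
    from elim(1) have 1: "\<forall>\<^sub>F a in sequentially. \<forall>r\<in>{..<2 ^ b}. S (G a r) x < (1 + e) * sqrt v * sqrt (2 * real (G a r) * ln (real a))"
      by (simp add: eventually_ball_finite)
    from elim(2) have 2: "\<forall>\<^sub>F a in sequentially. \<forall>r\<in>{..<2 ^ b}. \<forall>j\<le>2 ^ (a - b).
     \<bar>\<Sum>k<j. tp c D (real (m (\<tau> (G a r + k))) * x)\<bar> \<le> 64 * sqrt (VD 0 * 2 ^ (a - b) * ln (real (a - b)))"
      by (simp add: eventually_ball_finite)
    have main: "\<forall>\<^sub>F a in sequentially. \<forall>N. 2 ^ a \<le> N \<longrightarrow> N < 2 ^ Suc a \<longrightarrow> S N x \<le> (y + eps) * lil N"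
      using 1 2 eventually_ln_le_scaled_ln[OF e0] eventually_ge_at_top[of "b + 2"]
    proof eventually_elim
      case (elim a)
      show ?case
      proof (intro allI impI)
        fix N :: nat assume N: "2 ^ a \<le> N" "N < 2 ^ Suc a"
        define r where "r = (N - 2 ^ a) div 2 ^ (a - b)"
        define j where "j = (N - 2 ^ a) mod 2 ^ (a - b)"
        have NG: "N = G a r + j" unfolding G_def r_def j_def using N div_mult_mod_eq[of "N - 2 ^ a" "2 ^ (a - b)"] by linarith
        have "r < 2 ^ b" unfolding r_def
        proof (rule less_mult_imp_div_less)
          have "2 ^ b * 2 ^ (a - b) = (2::nat) ^ a" using elim(4) by (simp flip: power_add)
          then show "N - 2 ^ a < 2 ^ b * 2 ^ (a - b)" using N by simp
        qed
        then have r: "r \<in> {..<2 ^ b}" by simp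
        have j: "j \<le> 2 ^ (a - b)" unfolding j_def by (rule less_imp_le[OF mod_less_divisor]) simp
        have lna: "0 < ln (real a)" using elim(4) by simp
        have split: "S N x = S (G a r) x + (\<Sum>k<j. tp c D (real (m (\<tau> (G a r + k))) * x))"
          unfolding S_def NG by (rule sum_lessThan_add)
        have N2a: "2 ^ a \<le> real N" using N(1) by (metis of_nat_le_iff of_nat_numeral of_nat_power)
        have N2b: "2 ^ a \<le> 2 * real N" using N2a by linarith
        define W where "W = sqrt (2 * real N * ln (real a))"
        have W0: "0 \<le> W" unfolding W_def using lna by simp
        have A: "S (G a r) x \<le> (1 + e) * (y + eps / 4) * W"
        proof -
          have "S (G a r) x \<le> (1 + e) * sqrt v * sqrt (2 * real (G a r) * ln (real a))" using elim(1) r by (simp add: less_imp_le)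
          also have "\<dots> \<le> (1 + e) * sqrt v * W"
            unfolding W_def using NG e0 v y0 eps lna by (intro mult_left_mono real_sqrt_le_mono mult_right_mono) auto
          finally show ?thesis unfolding v(3) .
        qed
        have "\<bar>\<Sum>k<j. tp c D (real (m (\<tau> (G a r + k))) * x)\<bar> \<le> 64 * sqrt (VD 0 * 2 ^ (a - b) * ln (real (a - b)))"
          using elim(2) r j by blast
        also have "\<dots> \<le> 64 * sqrt ((VD 0 / 2 ^ b) * (2 * real N * ln (real a)))"
        proof (intro mult_left_mono real_sqrt_le_mono)
          have e2: "(2::real) ^ (a - b) = 2 ^ a / 2 ^ b" using elim(4) by (simp add: power_diff)
          have "VD 0 * 2 ^ (a - b) * ln (real (a - b)) \<le> VD 0 * (2 * real N / 2 ^ b) * ln (real a)"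
            unfolding e2 using V0 elim(4) lna by (intro mult_mono mult_left_mono divide_right_mono N2b) auto
          then show "VD 0 * 2 ^ (a - b) * ln (real (a - b)) \<le> (VD 0 / 2 ^ b) * (2 * real N * ln (real a))" by simp
        qed simp
        also have "\<dots> = 64 * sqrt (VD 0 / 2 ^ b) * W" unfolding W_def by (simp only: real_sqrt_mult mult_ac)
        also have "\<dots> \<le> eps / 4 * W" using b W0 by (intro mult_right_mono)
        finally have B: "(\<Sum>k<j. tp c D (real (m (\<tau> (G a r + k))) * x)) \<le> eps / 4 * W" by linarith
        have WL: "W \<le> (1 + e) * lil N"
        proof -
          have "ln (real a) \<le> (1 + e)\<^sup>2 * ln (ln (real N))"
            using elim(3) mult_left_mono[OF ln_ln_ge[OF N(1)], of "(1 + e)\<^sup>2"] elim(4) by simp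
          then have "W \<le> sqrt ((1 + e)\<^sup>2 * (2 * real N * ln (ln (real N))))"
            unfolding W_def using mult_left_mono[of "ln (real a)" "(1 + e)\<^sup>2 * ln (ln (real N))" "2 * real N"]
            by (intro real_sqrt_le_mono) (simp add: mult_ac)
          then show ?thesis using e0 by (simp add: real_sqrt_mult lil_def)
        qed
        have lil0: "0 \<le> lil N" using WL W0 e0 by (smt (verit) mult_nonneg_nonneg zero_le_mult_iff)
        have "S N x \<le> ((1 + e) * (y + eps / 4) + eps / 4) * W" using A B split by (simp add: distrib_right)
        also have "\<dots> \<le> (y + 5 / 8 * eps) * W"
        proof (rule mult_right_mono[OF _ W0])
          have "(y + eps / 4) * e \<le> (y + eps) * e" using eps e0 by (intro mult_right_mono) auto
          then show "(1 + e) * (y + eps / 4) + eps / 4 \<le> y + 5 / 8 * eps" using ye by (simp add: algebra_simps add_divide_distrib)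
        qed
        also have "\<dots> \<le> (y + 5 / 8 * eps) * ((1 + e) * lil N)" using WL y0 eps by (intro mult_left_mono) auto
        also have "\<dots> = ((y + 5 / 8 * eps) * (1 + e)) * lil N" by simp
        also have "\<dots> \<le> (y + eps) * lil N"
        proof (rule mult_right_mono[OF _ lil0])
          have "(y + 5 / 8 * eps) * e \<le> (y + eps) * e" using eps e0 by (intro mult_right_mono) auto
          then show "(y + 5 / 8 * eps) * (1 + e) \<le> y + eps" using ye eps by (simp add: algebra_simps add_divide_distrib)
        qed
        finally show "S N x \<le> (y + eps) * lil N" .
      qed
    qed
    then show ?case unfolding S_def y_def by (rule eventually_dyadic)
  qed
qed

end

section \<open>The lower bound\<close>

lemma negative_power_tendsto_0: "b > 0 \<Longrightarrow> ((\<lambda>M::nat. 2 * exp (- b * ln (real M))) \<longlonglongrightarrow> 0)" for b :: real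
  by real_asymp

lemma power_div_linear_tendsto_0: "0 < b \<Longrightarrow> b < 1 \<Longrightarrow> ((\<lambda>M::nat. 2 * exp (b * ln (2 * real M)) / real M) \<longlonglongrightarrow> 0)" for b :: real
  by real_asymp

text \<open>Controls, without a sharp constant, the sum that precedes a long block in the lower
  bound.\<close>

lemma (in fourier_lac) AE_abs_upper:
  fixes D :: nat and \<tau> :: "nat \<Rightarrow> nat"
  assumes inj: "inj \<tau>"
  shows "AE x in U. \<forall>\<^sub>F N in sequentially. \<bar>\<Sum>k<N. tp (cut 0 c) D (real (m (\<tau> k)) * x)\<bar> \<le> 128 * sqrt (VD 0) * lil N"
  using AE_upper_tail[OF eventually_const_degree[of D] inj, of 0]
proof eventually_elim
  case (elim x)
  then show ?case by (rule eventually_dyadic')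
qed

text \<open>\<open>\<theta>\<close> is the ratio of consecutive block ends, to be taken large, and
  \<open>ka\<close> is the relative loss conceded in the target. The variance must be positive
  because block sums are normalised by it.\<close>

locale lil_blocks = fourier_lac_dioph +
  fixes D :: nat and \<tau> :: "nat \<Rightarrow> nat" and \<theta> :: nat and ka :: real
  assumes s_pos: "0 < s2 D" and inj: "inj \<tau>" and th2: "2 \<le> \<theta>" and ka: "0 < ka" "ka < 1"
begin

definition blk :: "nat \<Rightarrow> nat set" where "blk j = {\<theta> ^ j..<\<theta> ^ Suc j}"
definition h :: "nat \<Rightarrow> real" where "h j = real (card (blk j))"
definition T :: "nat \<Rightarrow> real \<Rightarrow> real" where "T j x = (\<Sum>k\<in>blk j. tp c D (real (m (\<tau> k)) * x))"
definition mu :: real where "mu = (1 - ka)\<^sup>2"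
text \<open>A Gaussian block sum of variance \<open>s2 D * h j\<close> would give \<open>Y j\<close>
  the variance \<open>2 * Ln j\<close>: then \<open>exp (Y j x - Ln j)\<close> has mean 1, and under
  this density \<open>Y j\<close> has mean \<open>2 * Ln j\<close>.\<close>

definition lam :: "nat \<Rightarrow> real" where "lam j = (1 - ka) * sqrt (2 * ln (real j) / (s2 D * h j))"
definition Ln :: "nat \<Rightarrow> real" where "Ln j = mu * ln (real j)"
definition Y :: "nat \<Rightarrow> real \<Rightarrow> real" where "Y j x = lam j * T j x"

lemma h_eq: "h j = real \<theta> ^ j * (real \<theta> - 1)"
proof -
  have "\<theta> ^ j \<le> \<theta> ^ Suc j" using th2 by simp
  then show ?thesis unfolding h_def blk_def by (simp add: of_nat_diff algebra_simps)
qed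

lemma h_ge: "2 ^ j \<le> h j"
proof -
  have "2 ^ j * 1 \<le> real \<theta> ^ j * (real \<theta> - 1)" using th2 by (intro mult_mono power_mono) auto
  then show ?thesis by (simp add: h_eq)
qed

lemma h_pos: "0 < h j" using h_ge[of j] by (rule less_le_trans[rotated]) simp

lemma h_le: "h j \<le> real \<theta> ^ Suc j"
  using th2 by (simp add: h_eq algebra_simps)

lemma mu01: "0 < mu" "mu < 1" "mu \<le> 1 - ka"
proof -
  show "0 < mu" unfolding mu_def using ka by simp
  have "(1 - ka) * (1 - ka) \<le> (1 - ka) * 1" using ka by (intro mult_left_mono) auto
  then show "mu \<le> 1 - ka" unfolding mu_def by (simp add: power2_eq_square)
  then show "mu < 1" using ka by simp
qed

lemma lam2: "1 \<le> j \<Longrightarrow> (lam j)\<^sup>2 * h j = 2 * Ln j / s2 D"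
  unfolding lam_def Ln_def mu_def using h_pos[of j] s_pos by (simp add: power_mult_distrib)

lemma disj_blk: "i \<noteq> j \<Longrightarrow> blk i \<inter> blk j = {}"
proof -
  have "blk i \<inter> blk j = {}" if "i < j" for i j
  proof -
    have "\<theta> ^ Suc i \<le> \<theta> ^ j" using that th2 by (intro power_increasing) auto
    then show ?thesis by (auto simp: blk_def)
  qed
  then show "i \<noteq> j \<Longrightarrow> blk i \<inter> blk j = {}" by (metis inf_commute linorder_neqE_nat)
qed

lemma Y_cont: "continuous_on UNIV (Y j)"
  unfolding Y_def[abs_def] T_def by (intro continuous_intros)

lemma ln_double: "1 \<le> M \<Longrightarrow> j \<in> {M<..2 * M} \<Longrightarrow> 2 \<le> M \<Longrightarrow> ln (real j) \<le> 2 * ln (real M)"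
proof -
  assume *: "1 \<le> M" "j \<in> {M<..2 * M}" "2 \<le> M"
  have "ln (real j) \<le> ln (2 * real M)" using * by (intro ln_mono) auto
  also have "\<dots> = ln 2 + ln (real M)" using * by (simp add: ln_mult)
  also have "ln 2 \<le> ln (real M)" using * by (intro ln_mono) auto
  finally show ?thesis by simp
qed

text \<open>Two blocks at a time suffice for second moments, and multipliers up to 2 leave room for
  the tilts \<open>1 + eta\<close> and \<open>1 - eta\<close>. Blocks are disjoint and
  \<open>\<tau>\<close> is injective, so pairs of block and position index distinct frequencies and
  the exact transform factorises. The 32 is 2 blocks times 16, from
  \<open>(\<alpha> j)\<^sup>2 \<le> 4\<close> and \<open>Ln j \<le> 2 * ln M\<close>.\<close>

lemma block_laplace:
  assumes r: "0 < r"
  shows "\<forall>\<^sub>F M in sequentially. \<forall>J \<alpha>. J \<subseteq> {M<..2 * M} \<longrightarrow> card J \<le> 2 \<longrightarrow> (\<forall>j. 0 \<le> \<alpha> j \<and> \<alpha> j \<le> 2) \<longrightarrow>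
    \<bar>exp (- (\<Sum>j\<in>J. (\<alpha> j)\<^sup>2 * Ln j)) * (\<integral>x. exp (\<Sum>j\<in>J. \<alpha> j * Y j x) \<partial>U) - 1\<bar> \<le> r"
proof -
  define s where "s = s2 D"
  have s: "0 < s" unfolding s_def by (rule s_pos)
  have A: "0 < 32 / s" using s by simp
  have R: "1 \<le> 2 * real \<theta> ^ 3"
  proof -
    have "1 \<le> real \<theta> ^ 3" using th2 by (intro one_le_power) auto
    then show ?thesis by simp
  qed
  have as: "\<forall>\<^sub>F M::nat in sequentially. 16 * ln (real M) / s \<le> (9 / 5) ^ M" using s by real_asymp
  show ?thesis
    using laplace_exact_perm[where 'i = "nat \<times> nat", OF A R r, of D] as eventually_ge_at_top[of 2]
  proof eventually_elim
    case (elim M)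
    show ?case
    proof (intro allI impI)
      fix J and \<alpha> :: "nat \<Rightarrow> real"
      assume J: "J \<subseteq> {M<..2 * M}" "card J \<le> 2" and \<alpha>: "\<forall>j. 0 \<le> \<alpha> j \<and> \<alpha> j \<le> 2"
      have fJ: "finite J" using J(1) by (rule finite_subset) simp
      have j1: "1 \<le> j" if "j \<in> J" for j using that J by auto
      have lnM: "0 < ln (real M)" using elim(3) by simp
      have Lnj: "0 \<le> Ln j" "Ln j \<le> 2 * ln (real M)" if "j \<in> J" for j
      proof -
        have lj: "0 \<le> ln (real j)" using j1[OF that] by simp
        then show "0 \<le> Ln j" unfolding Ln_def using mu01 by simp
        have "Ln j \<le> 1 * ln (real j)" unfolding Ln_def using mu01 lj by (intro mult_right_mono) auto
        also have "\<dots> \<le> 2 * ln (real M)" using ln_double[of M j] that J elim(3) by auto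
        finally show "Ln j \<le> 2 * ln (real M)" .
      qed
      define I where "I = Sigma J blk"
      define v where "v = (\<lambda>p::nat \<times> nat. \<alpha> (fst p) * lam (fst p))"
      define \<tau>' where "\<tau>' = (\<lambda>p::nat \<times> nat. \<tau> (snd p))"
      have fI: "finite I" unfolding I_def using fJ by (auto simp: blk_def)
      have injI: "inj_on \<tau>' I"
      proof (rule inj_onI)
        fix p p' assume p: "p \<in> I" "p' \<in> I" "\<tau>' p = \<tau>' p'"
        then have e: "snd p = snd p'" using inj unfolding \<tau>'_def by (simp add: inj_eq)
        have "fst p = fst p'"
        proof (rule ccontr)
          assume "fst p \<noteq> fst p'"
          from disj_blk[OF this] show False using p e by (auto simp: I_def)
        qed
        with e show "p = p'" by (simp add: prod_eq_iff)
      qed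
      have sumI: "(\<Sum>p\<in>I. F (fst p) * G (snd p)) = (\<Sum>j\<in>J. F j * (\<Sum>k\<in>blk j. G k))" for F G :: "nat \<Rightarrow> real"
        unfolding I_def by (subst sum.Sigma[symmetric, where g = "\<lambda>j k. F j * G k", unfolded case_prod_beta])
          (use fJ in \<open>auto simp: blk_def sum_distrib_left\<close>)
      have sumI1: "(\<Sum>p\<in>I. F (fst p)) = (\<Sum>j\<in>J. F j * h j)" for F :: "nat \<Rightarrow> real"
        using sumI[of F "\<lambda>_. 1"] by (simp add: h_def)
      have sq: "(\<Sum>p\<in>I. (v p)\<^sup>2) = (\<Sum>j\<in>J. (\<alpha> j)\<^sup>2 * (2 * Ln j / s))"
        unfolding v_def sumI1[of "\<lambda>j. (\<alpha> j * lam j)\<^sup>2"]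
      proof (rule sum.cong[OF refl])
        fix j assume "j \<in> J"
        then have "(\<alpha> j * lam j)\<^sup>2 * h j = (\<alpha> j)\<^sup>2 * ((lam j)\<^sup>2 * h j)" by (simp add: power_mult_distrib)
        then show "(\<alpha> j * lam j)\<^sup>2 * h j = (\<alpha> j)\<^sup>2 * (2 * Ln j / s)" using lam2[OF j1[OF \<open>j \<in> J\<close>]] by (simp add: s_def)
      qed
      have a2: "(\<alpha> j)\<^sup>2 \<le> 4" for j using power_mono[of "\<alpha> j" 2 2] \<alpha> by simp
      have W2: "(\<Sum>p\<in>I. (v p)\<^sup>2) \<le> 32 / s * ln (real M)"
      proof -
        have "(\<Sum>p\<in>I. (v p)\<^sup>2) \<le> (\<Sum>j\<in>J. 4 * (2 * (2 * ln (real M)) / s))"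
          unfolding sq using s Lnj a2 lnM by (intro sum_mono mult_mono divide_right_mono mult_left_mono) auto
        also have "\<dots> = real (card J) * (16 * ln (real M) / s)" by simp
        also have "\<dots> \<le> 2 * (16 * ln (real M) / s)" using J s lnM by (intro mult_right_mono) auto
        finally show ?thesis by simp
      qed
      have vb: "\<bar>v p\<bar> \<le> (19/20) ^ M" if p: "p \<in> I" for p
      proof -
        have j: "fst p \<in> J" "M < fst p" using p J by (auto simp: I_def)
        have "(v p)\<^sup>2 = (\<alpha> (fst p))\<^sup>2 * (2 * Ln (fst p) / s) / h (fst p)"
        proof -
          have "(lam (fst p))\<^sup>2 = 2 * Ln (fst p) / s2 D / h (fst p)"
          proof -
            have "(lam (fst p))\<^sup>2 = (lam (fst p))\<^sup>2 * h (fst p) / h (fst p)" using h_pos[of "fst p"] by simp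
            then show ?thesis by (simp only: lam2[OF j1[OF j(1)]])
          qed
          then show ?thesis by (simp add: v_def power_mult_distrib s_def)
        qed
        also have "\<dots> \<le> 4 * (2 * (2 * ln (real M)) / s) / 2 ^ M"
        proof (intro frac_le mult_mono divide_right_mono mult_left_mono)
          have "(2::real) ^ M \<le> 2 ^ fst p" using j by (intro power_increasing) auto
          then show "2 ^ M \<le> h (fst p)" using h_ge by (rule order_trans)
        qed (use s Lnj[OF j(1)] a2 lnM in auto)
        also have "\<dots> \<le> (9/5) ^ M / 2 ^ M" using elim(2) by (intro divide_right_mono) auto
        also have "\<dots> = (9/10) ^ M" by (simp flip: power_divide)
        also have "\<dots> \<le> ((19/20)\<^sup>2) ^ M" by (intro power_mono) (auto simp: power2_eq_square)
        also have "\<dots> = ((19/20) ^ M)\<^sup>2" by (simp add: mult.commute flip: power_mult)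
        finally show ?thesis by (rule power2_le_imp_le[of "\<bar>v p\<bar>", unfolded power2_abs]) simp
      qed
      have W1: "(\<Sum>p\<in>I. \<bar>v p\<bar>) \<le> (2 * real \<theta> ^ 3) ^ M"
      proof -
        have "(\<Sum>p\<in>I. \<bar>v p\<bar>) \<le> (\<Sum>p\<in>I. 1)"
        proof (rule sum_mono)
          fix p assume "p \<in> I"
          then show "\<bar>v p\<bar> \<le> 1" using vb[of p] power_le_one[of "19/20::real" M] by simp
        qed
        also have "\<dots> = (\<Sum>j\<in>J. h j)" using sumI1[of "\<lambda>_. 1"] by simp
        also have "\<dots> \<le> (\<Sum>j\<in>J. real \<theta> ^ (3 * M))"
        proof (rule sum_mono)
          fix j assume "j \<in> J"
          then have "Suc j \<le> 3 * M" using J elim(3) by auto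
          then have "real \<theta> ^ Suc j \<le> real \<theta> ^ (3 * M)" using th2 by (intro power_increasing) auto
          then show "h j \<le> real \<theta> ^ (3 * M)" using h_le[of j] by linarith
        qed
        also have "\<dots> = real (card J) * (real \<theta> ^ 3) ^ M" by (simp add: power_mult)
        also have "\<dots> \<le> 2 ^ M * (real \<theta> ^ 3) ^ M"
        proof (rule mult_right_mono)
          have "(2::real) \<le> 2 ^ M" using elim(3) power_increasing[of 1 M "2::real"] by simp
          moreover have "real (card J) \<le> 2" using J(2) by simp
          ultimately show "real (card J) \<le> 2 ^ M" by linarith
        qed simp
        finally show ?thesis by (simp add: power_mult_distrib)
      qed
      have e1: "s2 D * (\<Sum>p\<in>I. (v p)\<^sup>2) / 2 = (\<Sum>j\<in>J. (\<alpha> j)\<^sup>2 * Ln j)"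
        unfolding sq using s by (simp add: sum_distrib_left sum_divide_distrib s_def)
      have e2: "(\<Sum>p\<in>I. v p * tp c D (real (m (\<tau>' p)) * x)) = (\<Sum>j\<in>J. \<alpha> j * Y j x)" for x
        using sumI[of "\<lambda>j. \<alpha> j * lam j" "\<lambda>k. tp c D (real (m (\<tau> k)) * x)"]
        by (simp add: v_def \<tau>'_def Y_def T_def mult.assoc)
      show "\<bar>exp (- (\<Sum>j\<in>J. (\<alpha> j)\<^sup>2 * Ln j)) * (\<integral>x. exp (\<Sum>j\<in>J. \<alpha> j * Y j x) \<partial>U) - 1\<bar> \<le> r"
        using elim(1)[rule_format, of I \<tau>' v, OF fI injI vb W2 W1] e1 by (simp add: e2)
    qed
  qed
qed

section \<open>Truncated tilted densities of the blocks\<close>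

definition eta :: real where "eta = ka / 4"
definition E :: "nat \<Rightarrow> real set" where "E j = {x. \<bar>Y j x - 2 * Ln j\<bar> \<le> 2 * eta * Ln j}"
definition Z :: "nat \<Rightarrow> real \<Rightarrow> real" where "Z j x = exp (Y j x - Ln j)"
definition Z' :: "nat \<Rightarrow> real \<Rightarrow> real" where "Z' j x = Z j x * indicator (E j) x"

lemma Y_meas [measurable]: "Y j \<in> borel_measurable borel"
  by (rule borel_measurable_continuous_onI[OF Y_cont])

lemma E_meas [measurable]: "E j \<in> sets borel"
proof -
  have "{x \<in> space borel. \<bar>Y j x - 2 * Ln j\<bar> \<le> 2 * eta * Ln j} \<in> sets borel" by measurable
  then show ?thesis by (simp add: E_def)
qed

lemma Z_cont: "continuous_on UNIV (Z j)"
  unfolding Z_def[abs_def] by (intro continuous_intros Y_cont)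

lemma Z_meas [measurable]: "Z j \<in> borel_measurable borel"
  by (rule borel_measurable_continuous_onI[OF Z_cont])

lemma Z'_meas [measurable]: "Z' j \<in> borel_measurable borel"
  unfolding Z'_def[abs_def] by measurable

text \<open>The third bound is the purpose of the truncation: the second moment of
  \<open>Z j\<close> is of order \<open>j ^ (2 * mu)\<close>, possibly more than \<open>M\<close>
  terms can average out. On \<open>E j\<close> the density is at most \<open>j ^ (1 - ka)\<close>,
  because \<open>(1 + ka / 2) * (1 - ka) \<le> 1\<close>.\<close>

lemma Z'_bounds: "0 \<le> Z' j x" "Z' j x \<le> Z j x" "1 \<le> j \<Longrightarrow> Z' j x \<le> exp ((1 - ka) * ln (real j))"
proof -
  show "0 \<le> Z' j x" "Z' j x \<le> Z j x" by (auto simp: Z'_def Z_def indicator_def)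
  assume j: "1 \<le> j"
  show "Z' j x \<le> exp ((1 - ka) * ln (real j))"
  proof (cases "x \<in> E j")
    case True
    then have "Y j x - Ln j \<le> (1 + 2 * eta) * Ln j" by (auto simp: E_def abs_le_iff algebra_simps)
    also have "\<dots> \<le> (1 - ka) * ln (real j)"
    proof -
      have "(1 + 2 * eta) * mu \<le> 1 - ka"
      proof -
        have "(1 + ka / 2) * (1 - ka) \<le> 1" using ka by (simp add: algebra_simps)
        then have "((1 + ka / 2) * (1 - ka)) * (1 - ka) \<le> 1 * (1 - ka)" using ka by (intro mult_right_mono) auto
        then show ?thesis by (simp add: eta_def mu_def power2_eq_square mult_ac)
      qed
      then have "((1 + 2 * eta) * mu) * ln (real j) \<le> (1 - ka) * ln (real j)" using j by (intro mult_right_mono) auto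
      then show ?thesis by (simp add: Ln_def mult_ac)
    qed
    finally show ?thesis using True by (simp add: Z'_def Z_def)
  qed (simp add: Z'_def)
qed

text \<open>Outside \<open>E j\<close> an additional tilt by \<open>eta\<close> in the appropriate
  direction dominates \<open>Z j\<close>. Under the Gaussian transform both correction terms have
  expectation about \<open>exp (- eta\<^sup>2 * Ln j)\<close>, a negative power of
  \<open>j\<close>.\<close>

lemma Z'_lower: "Z j x - exp ((1 + eta) * Y j x - Ln j - 2 * eta * (1 + eta) * Ln j)
    - exp ((1 - eta) * Y j x - Ln j + 2 * eta * (1 - eta) * Ln j) \<le> Z' j x"
proof -
  have eta0: "0 < eta" unfolding eta_def using ka by simp
  consider "x \<in> E j" | "2 * (1 + eta) * Ln j < Y j x" | "Y j x < 2 * (1 - eta) * Ln j"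
    by (force simp: E_def abs_le_iff algebra_simps not_le)
  then show ?thesis
  proof cases
    case 1
    then have "Z' j x = Z j x" by (simp add: Z'_def)
    then show ?thesis using exp_ge_zero[of "(1 + eta) * Y j x - Ln j - 2 * eta * (1 + eta) * Ln j"]
      exp_ge_zero[of "(1 - eta) * Y j x - Ln j + 2 * eta * (1 - eta) * Ln j"] by linarith
  next
    case 2
    then have "eta * (2 * (1 + eta) * Ln j) \<le> eta * Y j x" using eta0 by (intro mult_left_mono) auto
    then have "Z j x \<le> exp ((1 + eta) * Y j x - Ln j - 2 * eta * (1 + eta) * Ln j)"
      unfolding Z_def by (simp add: algebra_simps)
    then show ?thesis using Z'_bounds(1)[of j x] exp_ge_zero[of "(1 - eta) * Y j x - Ln j + 2 * eta * (1 - eta) * Ln j"] by linarith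
  next
    case 3
    then have "eta * Y j x \<le> eta * (2 * (1 - eta) * Ln j)" using eta0 by (intro mult_left_mono) auto
    then have "Z j x \<le> exp ((1 - eta) * Y j x - Ln j + 2 * eta * (1 - eta) * Ln j)"
      unfolding Z_def by (simp add: algebra_simps)
    then show ?thesis using Z'_bounds(1)[of j x] exp_ge_zero[of "(1 + eta) * Y j x - Ln j - 2 * eta * (1 + eta) * Ln j"] by linarith
  qed
qed

lemma integrable_Z': "integrable U (Z' j)" "integrable U (\<lambda>x. Z' i x * Z' j x)"
proof -
  show "integrable U (Z' j)"
    by (rule Bochner_Integration.integrable_bound[OF integrable_U_cont[OF Z_cont[of j]]])
       (use Z'_bounds in \<open>auto simp: abs_of_nonneg intro!: order_trans[OF Z'_bounds(2) abs_ge_self]\<close>)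
  show "integrable U (\<lambda>x. Z' i x * Z' j x)"
    by (rule Bochner_Integration.integrable_bound[OF integrable_U_cont[OF continuous_on_mult[OF Z_cont[of i] Z_cont[of j]]]])
       (use Z'_bounds in \<open>auto simp: abs_mult abs_of_nonneg intro!: mult_mono order_trans[OF Z'_bounds(2) abs_ge_self]\<close>)
qed

text \<open>Second moment method: the truncated densities \<open>Z' j\<close>, \<open>M < j \<le> 2 * M\<close>, are nearly uncorrelated,
  so their average is close to 1 in mean square and cannot vanish on a set of positive measure.\<close>

lemma no_block_prob:
  assumes r: "0 < r" "r < 1"
  shows "\<forall>\<^sub>F M in sequentially. measure U {x. \<forall>j\<in>{M<..2 * M}. x \<notin> E j} \<le> 11 * r"
proof -
  have eta0: "0 < eta" "eta < 1" unfolding eta_def using ka by auto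
  have c0: "0 < mu * eta\<^sup>2" using mu01 eta0 by simp
  have as1: "\<forall>\<^sub>F M::nat in sequentially. 2 * exp (- (mu * eta\<^sup>2) * ln (real M)) < r"
  proof (rule order_tendstoD(2)[OF _ r(1)])
    show "((\<lambda>M::nat. 2 * exp (- (mu * eta\<^sup>2) * ln (real M))) \<longlonglongrightarrow> 0)"
      using negative_power_tendsto_0[OF c0] by simp
  qed
  have as2: "\<forall>\<^sub>F M::nat in sequentially. 2 * exp ((1 - ka) * ln (2 * real M)) / real M < r"
  proof (rule order_tendstoD(2)[OF _ r(1)])
    have "0 < 1 - ka" "1 - ka < 1" using ka by auto
    then show "((\<lambda>M::nat. 2 * exp ((1 - ka) * ln (2 * real M)) / real M) \<longlonglongrightarrow> 0)"
      by (rule power_div_linear_tendsto_0)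
  qed
  show ?thesis
    using block_laplace[OF r(1)] as1 as2 eventually_ge_at_top[of 2]
  proof eventually_elim
    case (elim M)
    let ?J = "{M<..2 * M}"
    let ?r = "real M"
    have M0: "0 < ?r" using elim(4) by simp
    note lap = elim(1)[rule_format]
    have j1: "1 \<le> j" if "j \<in> ?J" for j using that by auto
    have single: "\<bar>exp (- \<alpha>\<^sup>2 * Ln j) * (\<integral>x. exp (\<alpha> * Y j x) \<partial>U) - 1\<bar> \<le> r" if "j \<in> ?J" "0 \<le> \<alpha>" "\<alpha> \<le> 2" for \<alpha> j
      using lap[of "{j}" "\<lambda>_. \<alpha>"] that by simp
    have EZ: "\<bar>(\<integral>x. Z j x \<partial>U) - 1\<bar> \<le> r" if "j \<in> ?J" for j
      using single[OF that, of 1] by (simp add: Z_def exp_diff exp_minus divide_inverse mult.commute)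
    have EZZ: "(\<integral>x. Z i x * Z j x \<partial>U) \<le> 1 + r" if "i \<in> ?J" "j \<in> ?J" "i \<noteq> j" for i j
    proof -
      have "\<bar>exp (- (\<Sum>j\<in>{i, j}. 1\<^sup>2 * Ln j)) * (\<integral>x. exp (\<Sum>j\<in>{i, j}. 1 * Y j x) \<partial>U) - 1\<bar> \<le> r"
        by (rule lap[of "{i, j}" "\<lambda>_. 1"]) (use that in \<open>auto simp: card_insert_if\<close>)
      moreover have "(\<integral>x. Z i x * Z j x \<partial>U) = (\<integral>x. exp (- (Ln i + Ln j)) * exp (Y i x + Y j x) \<partial>U)"
        by (intro Bochner_Integration.integral_cong) (auto simp: Z_def simp flip: exp_add)
      ultimately show ?thesis using that by simp
    qed
    \<comment> \<open>The condition on \<open>b\<close> says that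
      \<open>- eta\<^sup>2 * Ln j\<close> is all that remains in the exponent after taking
      expectations; it holds for both tilts.\<close>
    have up: "(\<integral>x. exp (\<alpha> * Y j x - b) \<partial>U) \<le> r" if j: "j \<in> ?J" and \<alpha>: "0 \<le> \<alpha>" "\<alpha> \<le> 2" and b: "\<alpha>\<^sup>2 * Ln j - b = - (eta\<^sup>2 * Ln j)" for \<alpha> b j
    proof -
      have "(\<integral>x. exp (\<alpha> * Y j x - b) \<partial>U) = exp (- b) * (\<integral>x. exp (\<alpha> * Y j x) \<partial>U)"
        by (simp add: exp_diff exp_minus divide_inverse mult.commute)
      also have "\<dots> = exp (\<alpha>\<^sup>2 * Ln j - b) * (exp (- \<alpha>\<^sup>2 * Ln j) * (\<integral>x. exp (\<alpha> * Y j x) \<partial>U))"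
        by (simp flip: exp_add mult.assoc)
      also have "\<dots> \<le> exp (\<alpha>\<^sup>2 * Ln j - b) * 2"
        using single[OF j \<alpha>] r by (intro mult_left_mono) auto
      also have "\<alpha>\<^sup>2 * Ln j - b = - (mu * eta\<^sup>2) * ln (real j)" unfolding b by (simp add: Ln_def)
      also have "exp (- (mu * eta\<^sup>2) * ln (real j)) * 2 \<le> exp (- (mu * eta\<^sup>2) * ln (real M)) * 2"
      proof -
        have "ln (real M) \<le> ln (real j)" using j elim(4) by (intro ln_mono) auto
        then have "(mu * eta\<^sup>2) * ln (real M) \<le> (mu * eta\<^sup>2) * ln (real j)" using c0 by (intro mult_left_mono) auto
        then show ?thesis by simp
      qed
      also have "\<dots> \<le> r" using elim(2) by simp
      finally show ?thesis .
    qed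
    have EZ': "1 - 3 * r \<le> (\<integral>x. Z' j x \<partial>U)" if j: "j \<in> ?J" for j
    proof -
      let ?f = "\<lambda>x. exp ((1 + eta) * Y j x - (Ln j + 2 * eta * (1 + eta) * Ln j))"
      let ?g = "\<lambda>x. exp ((1 - eta) * Y j x - (Ln j - 2 * eta * (1 - eta) * Ln j))"
      have ic: "integrable U (Z j)" "integrable U ?f" "integrable U ?g"
        by (intro integrable_U_cont Z_cont continuous_intros Y_cont)+
      have "(\<integral>x. Z j x - ?f x - ?g x \<partial>U) \<le> (\<integral>x. Z' j x \<partial>U)"
      proof (rule integral_mono)
        fix x show "Z j x - ?f x - ?g x \<le> Z' j x" using Z'_lower[of j x] by (simp add: algebra_simps)
      qed (use ic integrable_Z' in auto)
      moreover have "(\<integral>x. Z j x - ?f x - ?g x \<partial>U) = (\<integral>x. Z j x \<partial>U) - (\<integral>x. ?f x \<partial>U) - (\<integral>x. ?g x \<partial>U)"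
        using ic by simp
      moreover have "(\<integral>x. ?f x \<partial>U) \<le> r" using eta0 by (intro up j) (auto simp: power2_eq_square algebra_simps)
      moreover have "(\<integral>x. ?g x \<partial>U) \<le> r" using eta0 by (intro up j) (auto simp: power2_eq_square algebra_simps)
      ultimately show ?thesis using EZ[OF j] by linarith
    qed
    define K where "K = exp ((1 - ka) * ln (2 * ?r))"
    have EZ'Z': "(\<integral>x. Z' i x * Z' j x \<partial>U) \<le> (if i = j then 2 * K else 1 + r)" if ij: "i \<in> ?J" "j \<in> ?J" for i j
    proof (cases "i = j")
      case False
      have "(\<integral>x. Z' i x * Z' j x \<partial>U) \<le> (\<integral>x. Z i x * Z j x \<partial>U)"
        by (intro integral_mono integrable_Z' integrable_U_cont continuous_intros Z_cont mult_mono Z'_bounds)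
           (simp add: Z_def)
      then show ?thesis using EZZ[OF ij False] False by simp
    next
      case True
      have "(\<integral>x. Z' i x * Z' j x \<partial>U) \<le> (\<integral>x. K * Z j x \<partial>U)"
      proof (intro integral_mono integrable_Z' integrable_U_cont continuous_intros Z_cont)
        fix x
        have "Z' i x \<le> exp ((1 - ka) * ln (real i))" using j1[OF ij(1)] by (rule Z'_bounds)
        also have "\<dots> \<le> K" unfolding K_def using ij ka by (auto intro!: mult_left_mono)
        finally have "Z' i x \<le> K" .
        then show "Z' i x * Z' j x \<le> K * Z j x" by (intro mult_mono Z'_bounds) (auto simp: K_def)
      qed
      also have "\<dots> = K * (\<integral>x. Z j x \<partial>U)" by simp
      also have "\<dots> \<le> K * 2" using EZ[OF ij(2)] r by (intro mult_left_mono) (auto simp: K_def)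
      finally show ?thesis using True by simp
    qed
    define W where "W = (\<lambda>x. (\<Sum>j\<in>?J. Z' j x))"
    have cardJ: "real (card ?J) = ?r" by simp
    have iW: "integrable U W" "integrable U (\<lambda>x. W x * W x)"
      unfolding W_def sum_product by (intro Bochner_Integration.integrable_sum integrable_Z')+
    have W1: "?r * (1 - 3 * r) \<le> (\<integral>x. W x \<partial>U)"
    proof -
      have "(\<integral>x. W x \<partial>U) = (\<Sum>j\<in>?J. \<integral>x. Z' j x \<partial>U)"
        unfolding W_def by (rule Bochner_Integration.integral_sum) (rule integrable_Z')
      moreover have "(\<Sum>j\<in>?J. 1 - 3 * r) \<le> (\<Sum>j\<in>?J. \<integral>x. Z' j x \<partial>U)" by (intro sum_mono EZ')
      ultimately show ?thesis using cardJ by simp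
    qed
    have W2: "(\<integral>x. W x * W x \<partial>U) \<le> ?r * (2 * K) + ?r * (?r * (1 + r))"
    proof -
      have "(\<integral>x. W x * W x \<partial>U) = (\<Sum>i\<in>?J. \<integral>x. (\<Sum>j\<in>?J. Z' i x * Z' j x) \<partial>U)"
        unfolding W_def sum_product by (rule Bochner_Integration.integral_sum) (intro Bochner_Integration.integrable_sum integrable_Z')
      also have "\<dots> = (\<Sum>i\<in>?J. \<Sum>j\<in>?J. \<integral>x. Z' i x * Z' j x \<partial>U)"
        by (intro sum.cong refl Bochner_Integration.integral_sum integrable_Z')
      also have "\<dots> \<le> (\<Sum>i\<in>?J. \<Sum>j\<in>?J. (if i = j then 2 * K else 0) + (1 + r))"
        using r by (intro sum_mono order_trans[OF EZ'Z']) auto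
      also have "\<dots> = (\<Sum>i\<in>?J. 2 * K + ?r * (1 + r))"
        by (intro sum.cong refl) (simp add: sum.distrib cardJ)
      also have "\<dots> = ?r * (2 * K + ?r * (1 + r))" by simp
      finally show ?thesis by (simp add: distrib_left)
    qed
    let ?F = "{x. \<forall>j\<in>?J. x \<notin> E j}"
    have Fm: "?F \<in> sets borel"
    proof -
      have "?F = space borel - (\<Union>j\<in>?J. E j)" by auto
      then show ?thesis by (simp only:) measurable
    qed
    \<comment> \<open>Chebyshev's argument: \<open>W\<close> vanishes on the bad set, so
      \<open>?r * ?r\<close> times its indicator is at most
      \<open>(W x - ?r)\<^sup>2\<close>.\<close>
    have "measure U ?F * (?r * ?r) = (\<integral>x. (?r * ?r) * indicator ?F x \<partial>U)"
      using Fm by simp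
    also have "\<dots> \<le> (\<integral>x. W x * W x - 2 * ?r * W x + ?r * ?r \<partial>U)"
    proof (rule integral_mono)
      show "integrable U (\<lambda>x. ?r * ?r * indicator ?F x)" using Fm by (intro integrable_mult_right) (simp add: U.emeasure_eq_measure)
      show "integrable U (\<lambda>x. W x * W x - 2 * ?r * W x + ?r * ?r)" using iW by simp
      fix x
      show "?r * ?r * indicator ?F x \<le> W x * W x - 2 * ?r * W x + ?r * ?r"
      proof (cases "x \<in> ?F")
        case True
        then have "W x = 0" unfolding W_def by (intro sum.neutral) (auto simp: Z'_def)
        then show ?thesis using True by simp
      next
        case False
        have "0 \<le> (W x - ?r)\<^sup>2" by simp
        then show ?thesis using False by (simp add: power2_eq_square algebra_simps)
      qed
    qed
    also have "\<dots> = (\<integral>x. W x * W x \<partial>U) - 2 * ?r * (\<integral>x. W x \<partial>U) + ?r * ?r"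
      using iW U.prob_space by simp
    also have "\<dots> \<le> ?r * (2 * K) + ?r * (?r * (1 + r)) - 2 * ?r * (?r * (1 - 3 * r)) + ?r * ?r"
      using W2 mult_left_mono[OF W1, of "2 * ?r"] by simp
    \<comment> \<open>The 7 consists of 1 from the off-diagonal product moments and 6 from the
      deficit \<open>3 * r\<close> of the mean, which is counted twice.\<close>
    also have "\<dots> = ?r * (2 * K) + 7 * r * (?r * ?r)" by (simp add: algebra_simps)
    also have "?r * (2 * K) \<le> ?r * (r * ?r)"
    proof -
      have "2 * K \<le> r * ?r" using elim(3) M0 unfolding K_def by (simp add: field_simps)
      then show ?thesis by (intro mult_left_mono) auto
    qed
    finally have "measure U ?F * (?r * ?r) \<le> (8 * r) * (?r * ?r)" by (simp add: algebra_simps)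
    then have "measure U ?F \<le> 8 * r" using M0 by simp
    then show ?case using r by simp
  qed
qed

text \<open>Missing all late blocks implies the bad event for every large \<open>M\<close>, whose
  probability can be made arbitrarily small; so it is a null event.\<close>

lemma AE_blocks: "AE x in U. \<exists>\<^sub>F j in sequentially. x \<in> E j"
proof -
  have "AE x in U. \<exists>j\<ge>n0. x \<in> E j" for n0
  proof -
    let ?F = "{x. \<forall>j\<ge>n0. x \<notin> E j}"
    have Fm: "?F \<in> sets borel"
    proof -
      have "?F = space borel - (\<Union>j\<in>{n0..}. E j)" by auto
      then show ?thesis by (simp only:) measurable
    qed
    have "measure U ?F \<le> e" if e: "0 < e" for e
    proof -
      define r where "r = min (1 / 2) (e / 11)"
      have r: "0 < r" "r < 1" "11 * r \<le> e" using e by (auto simp: r_def)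
      from no_block_prob[OF r(1,2)] eventually_ge_at_top[of n0]
      have "\<forall>\<^sub>F M in sequentially. measure U ?F \<le> 11 * r"
      proof eventually_elim
        case (elim M)
        have "measure U ?F \<le> measure U {x. \<forall>j\<in>{M<..2 * M}. x \<notin> E j}"
        proof (rule U.finite_measure_mono)
          show "?F \<subseteq> {x. \<forall>j\<in>{M<..2 * M}. x \<notin> E j}" using elim(2) by auto
          have "{x. \<forall>j\<in>{M<..2 * M}. x \<notin> E j} = space borel - (\<Union>j\<in>{M<..2 * M}. E j)" by auto
          then show "{x. \<forall>j\<in>{M<..2 * M}. x \<notin> E j} \<in> sets U" by (simp only:) measurable
        qed
        then show ?case using elim(1) by linarith
      qed
      then show ?thesis using r(3) by (auto dest: eventually_happens)
    qed
    then have "measure U ?F \<le> 0" by (rule field_le_epsilon[of _ 0, simplified])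
    then have "measure U ?F = 0" using measure_nonneg[of U ?F] by linarith
    then have "?F \<in> null_sets U" using Fm by (simp add: null_sets_def U.emeasure_eq_measure)
    then show ?thesis by (rule AE_I'[of ?F]) auto
  qed
  then have "AE x in U. \<forall>n0. \<exists>j\<ge>n0. x \<in> E j" by (simp add: AE_all_countable)
  then show ?thesis by (simp add: frequently_sequentially)
qed

end

lemma eventually_scaled_ln_le_ln: "0 < b \<Longrightarrow> b < 1 \<Longrightarrow> 0 < L \<Longrightarrow> \<forall>\<^sub>F j::nat in sequentially. b * ln ((real j + 1) * L) \<le> ln (real j)" for b L :: real
  by real_asymp

text \<open>For a large ratio \<open>\<theta>\<close> the block ending at
  \<open>N = \<theta> ^ Suc j\<close> contains almost all indices below \<open>N\<close>, while the
  sum before it is at most of order \<open>lil N / sqrt \<theta>\<close>. Infinitely many good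
  blocks therefore give infinitely many good \<open>N\<close>.\<close>

theorem (in fourier_lac_dioph) AE_lower_poly:
  fixes D :: nat and \<tau> :: "nat \<Rightarrow> nat"
  assumes inj: "inj \<tau>" and eps: "0 < eps" and s: "0 < s2 D"
  shows "AE x in U. \<exists>\<^sub>F N in sequentially. (sqrt (s2 D) - eps) * lil N \<le> (\<Sum>k<N. tp c D (real (m (\<tau> k)) * x))"
proof -
  define y where "y = sqrt (s2 D)"
  have y0: "0 < y" unfolding y_def using s by simp
  define ka where "ka = min (1 / 8) (eps / (8 * y))"
  have kae: "8 * y * ka \<le> eps" and ka: "0 < ka" "ka < 1"
  proof -
    have "ka \<le> eps / (8 * y)" unfolding ka_def by simp
    then show "8 * y * ka \<le> eps" using y0 by (simp add: field_simps)
  qed (use eps y0 in \<open>auto simp: ka_def\<close>)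
  define K where "K = 128 * sqrt (VD 0)"
  have K0: "0 \<le> K" unfolding K_def using VD_pos[of 0] by simp
  \<comment> \<open>The summand \<open>1 / ka\<close> makes the block length at least
    \<open>(1 - ka) * N\<close>; \<open>(2 * K / eps)\<^sup>2\<close> brings the contribution of the
    earlier sum below \<open>eps / 2\<close>.\<close>
  obtain \<theta> :: nat where \<theta>: "2 + 1 / ka + (2 * K / eps)\<^sup>2 \<le> real \<theta>" using real_arch_simple by blast
  have ik: "0 < 1 / ka" using ka by simp
  have t2: "2 \<le> real \<theta>" "1 / ka \<le> real \<theta>" "(2 * K / eps)\<^sup>2 \<le> real \<theta>"
    using \<theta> ik zero_le_power2[of "2 * K / eps"] by linarith+
  have th2: "2 \<le> \<theta>" using t2(1) by simp
  have Kth: "K / sqrt (real \<theta>) \<le> eps / 2"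
  proof -
    have "2 * K / eps \<le> sqrt (real \<theta>)" using t2(3) by (rule real_le_rsqrt)
    then have "2 * K \<le> sqrt (real \<theta>) * eps" using eps by (simp add: field_simps)
    then show ?thesis using t2(1) by (simp add: field_simps)
  qed
  interpret lil_blocks m q c C D \<tau> \<theta> ka
    by unfold_locales (use s inj th2 ka in auto)
  define S where "S = (\<lambda>N x. \<Sum>k<N. tp c D (real (m (\<tau> k)) * x))"
  have L0: "0 < ln (real \<theta>)" using t2 by simp
  have mu: "0 < (1 - ka)\<^sup>2" "(1 - ka)\<^sup>2 < 1" using mu01 unfolding mu_def by auto
  show ?thesis using AE_blocks AE_abs_upper[OF inj, of D]
  proof eventually_elim
    case (elim x)
    have "\<forall>\<^sub>F j in sequentially. \<bar>S (\<theta> ^ j) x\<bar> \<le> K * lil (\<theta> ^ j)"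
    proof -
      have "filterlim (\<lambda>j. \<theta> ^ j) sequentially sequentially"
        by (rule filterlim_at_top_mono[OF filterlim_ident])
           (use th2 in \<open>auto intro!: always_eventually less_imp_le[OF less_le_trans[OF less_exp power_mono]]\<close>)
      then show ?thesis
        using elim(2) unfolding filterlim_iff S_def K_def tp_cut_0 by blast
    qed
    with eventually_ge_at_top[of 2] eventually_scaled_ln_le_ln[OF mu L0]
    have "\<forall>\<^sub>F j in sequentially. \<bar>S (\<theta> ^ j) x\<bar> \<le> K * lil (\<theta> ^ j) \<and> 2 \<le> j \<and> (1 - ka)\<^sup>2 * ln ((real j + 1) * ln (real \<theta>)) \<le> ln (real j)"
      by eventually_elim auto
    from frequently_eventually_conj[OF elim(1) this]
    have fr: "\<exists>\<^sub>F j in sequentially. (sqrt (s2 D) - eps) * lil (\<theta> ^ Suc j) \<le> S (\<theta> ^ Suc j) x"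
    proof (rule frequently_elim1)
      fix j assume "(\<bar>S (\<theta> ^ j) x\<bar> \<le> K * lil (\<theta> ^ j) \<and> 2 \<le> j \<and> (1 - ka)\<^sup>2 * ln ((real j + 1) * ln (real \<theta>)) \<le> ln (real j)) \<and> x \<in> E j"
      then have j: "\<bar>S (\<theta> ^ j) x\<bar> \<le> K * lil (\<theta> ^ j)" "2 \<le> j" "(1 - ka)\<^sup>2 * ln ((real j + 1) * ln (real \<theta>)) \<le> ln (real j)" "x \<in> E j" by auto
      define N where "N = \<theta> ^ Suc j"
      have N: "real N = real \<theta> * real \<theta> ^ j" by (simp add: N_def)
      have lnN: "ln (real N) = (real j + 1) * ln (real \<theta>)"
        using t2(1) by (simp add: N_def ln_realpow ln_mult algebra_simps)
      have lnj: "0 < ln (real j)" using j(2) by simp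
      have j0: "1 \<le> j" using j(2) by simp
      have lam_pos: "0 < lam j" unfolding lam_def using ka lnj s h_pos[of j] by simp
      \<comment> \<open>The tilted mean of the block sum \<open>T j\<close>, that is, the value at
        which \<open>lam j * X = 2 * Ln j\<close>.\<close>
      define X where "X = (1 - ka) * sqrt (2 * s2 D * h j * ln (real j))"
      have lamX: "lam j * X = 2 * Ln j"
      proof -
        have "lam j * X = (1 - ka)\<^sup>2 * (sqrt (2 * ln (real j) / (s2 D * h j)) * sqrt (2 * s2 D * h j * ln (real j)))"
          unfolding lam_def X_def by (simp only: power2_eq_square mult_ac)
        also have "sqrt (2 * ln (real j) / (s2 D * h j)) * sqrt (2 * s2 D * h j * ln (real j)) =
            sqrt ((2 * ln (real j) / (s2 D * h j)) * (2 * s2 D * h j * ln (real j)))" by (rule real_sqrt_mult[symmetric])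
        also have "(2 * ln (real j) / (s2 D * h j)) * (2 * s2 D * h j * ln (real j)) = (2 * ln (real j))\<^sup>2"
          using s h_pos[of j] by (simp add: power2_eq_square)
        also have "sqrt ((2 * ln (real j))\<^sup>2) = 2 * ln (real j)" by (rule real_sqrt_unique) (use lnj in auto)
        finally show ?thesis by (simp add: Ln_def mu_def)
      qed
      have "2 * Ln j - 2 * eta * Ln j \<le> Y j x" using j(4) by (simp add: E_def abs_le_iff)
      then have "(1 - eta) * (lam j * X) \<le> lam j * T j x" unfolding lamX Y_def by (simp add: algebra_simps)
      then have "lam j * ((1 - eta) * X) \<le> lam j * T j x" by (simp add: mult_ac)
      then have T1: "(1 - eta) * X \<le> T j x" using lam_pos by simp
      have lnlnN: "(1 - ka)\<^sup>2 * ln (ln (real N)) \<le> ln (real j)" using j(3) unfolding lnN by simp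
      have hN: "(1 - ka) * real N \<le> h j"
      proof -
        have "1 \<le> ka * real \<theta>" using t2(2) ka by (simp add: field_simps)
        then have "(1 - ka) * real \<theta> \<le> real \<theta> - 1" by (simp add: algebra_simps)
        then have "real \<theta> ^ j * ((1 - ka) * real \<theta>) \<le> real \<theta> ^ j * (real \<theta> - 1)" by (rule mult_left_mono) simp
        then show ?thesis by (simp add: h_eq N mult_ac)
      qed
      have sq2: "(1 - ka)\<^sup>2 * lil N \<le> sqrt (2 * h j * ln (real j))"
      proof -
        have "(1 - ka)\<^sup>2 \<le> 1 - ka" using mu01(3) unfolding mu_def .
        then have "(1 - ka)\<^sup>2 * real N \<le> (1 - ka) * real N" by (intro mult_right_mono) auto
        then have hN2: "(1 - ka)\<^sup>2 * real N \<le> h j" using hN by linarith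
        have "((1 - ka)\<^sup>2 * real N) * ((1 - ka)\<^sup>2 * ln (ln (real N))) \<le> ((1 - ka)\<^sup>2 * real N) * ln (real j)"
          using lnlnN by (intro mult_left_mono) auto
        also have "\<dots> \<le> h j * ln (real j)" using hN2 lnj by (intro mult_right_mono) auto
        finally have "((1 - ka)\<^sup>2)\<^sup>2 * (2 * real N * ln (ln (real N))) \<le> 2 * h j * ln (real j)"
          by (simp add: power2_eq_square mult_ac)
        then have "sqrt (((1 - ka)\<^sup>2)\<^sup>2 * (2 * real N * ln (ln (real N)))) \<le> sqrt (2 * h j * ln (real j))"
          by (rule real_sqrt_le_mono)
        then show ?thesis by (simp only: real_sqrt_mult[of "((1 - ka)\<^sup>2)\<^sup>2"] real_sqrt_abs lil_def abs_of_nonneg zero_le_power2)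
      qed
      have lilN0: "0 \<le> lil N"
      proof -
        have "1 \<le> ln (real N)"
        proof -
          have "ln 2 \<le> ln (real \<theta>)" using t2 by (intro ln_mono) auto
          moreover have "1 / 2 \<le> ln (2::real)" using ln2_ge_two_thirds by linarith
          ultimately have "3 * (1 / 2) \<le> (real j + 1) * ln (real \<theta>)" using j(2) by (intro mult_mono) auto
          then show ?thesis unfolding lnN by simp
        qed
        then show ?thesis unfolding lil_def by simp
      qed
      have X1: "(1 - ka) ^ 3 * y * lil N \<le> X"
      proof -
        have "X = (1 - ka) * y * sqrt (2 * h j * ln (real j))"
          unfolding X_def y_def by (simp add: real_sqrt_mult mult_ac)
        moreover have "(1 - ka) * y * ((1 - ka)\<^sup>2 * lil N) \<le> (1 - ka) * y * sqrt (2 * h j * ln (real j))"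
          using sq2 ka y0 by (intro mult_left_mono) auto
        ultimately show ?thesis by (simp add: power2_eq_square power3_eq_cube mult_ac)
      qed
      have T2: "(y - eps / 2) * lil N \<le> T j x"
      proof -
        \<comment> \<open>Three factors \<open>1 - ka\<close> come from \<open>X1\<close> and a
          fourth one covers \<open>1 - eta\<close>; Bernoulli's inequality and
          \<open>8 * y * ka \<le> eps\<close> bound their total loss by
          \<open>eps / 2\<close>.\<close>
        have "y - eps / 2 \<le> (1 - ka) ^ 4 * y"
        proof -
          have "1 + real 4 * (- ka) \<le> (1 + (- ka)) ^ 4" by (rule Bernoulli_inequality) (use ka in simp)
          then have "(1 - 4 * ka) * y \<le> (1 - ka) ^ 4 * y" using y0 by (intro mult_right_mono) auto
          then show ?thesis using kae by (simp add: algebra_simps)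
        qed
        then have "(y - eps / 2) * lil N \<le> (1 - ka) ^ 4 * y * lil N" using lilN0 by (rule mult_right_mono)
        also have "\<dots> = (1 - ka) * ((1 - ka) ^ 3 * y * lil N)" by (simp add: eval_nat_numeral)
        also have "\<dots> \<le> (1 - eta) * X"
          using X1 ka y0 lilN0 by (intro mult_mono) (auto simp: eta_def)
        finally show ?thesis using T1 by linarith
      qed
      have lil1: "K * lil (\<theta> ^ j) \<le> eps / 2 * lil N"
      proof -
        have "ln (ln (real (\<theta> ^ j))) \<le> ln (ln (real N))"
        proof (rule ln_mono)
          show "0 < ln (real (\<theta> ^ j))" using L0 j0 t2(1) by (simp add: ln_realpow)
          show "ln (real (\<theta> ^ j)) \<le> ln (real N)" using t2(1) L0 by (simp add: N ln_mult)
        qed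
        then have "2 * real (\<theta> ^ j) * ln (ln (real (\<theta> ^ j))) \<le> 2 * real (\<theta> ^ j) * ln (ln (real N))"
          by (intro mult_left_mono) auto
        also have "\<dots> = (2 * real N * ln (ln (real N))) / real \<theta>" using t2(1) by (simp add: N)
        finally have "lil (\<theta> ^ j) \<le> lil N / sqrt (real \<theta>)"
          unfolding lil_def real_sqrt_divide[symmetric] by (rule real_sqrt_le_mono)
        then have "K * lil (\<theta> ^ j) \<le> K * (lil N / sqrt (real \<theta>))" using K0 by (rule mult_left_mono)
        also have "\<dots> = (K / sqrt (real \<theta>)) * lil N" by simp
        also have "\<dots> \<le> eps / 2 * lil N" using Kth lilN0 by (rule mult_right_mono)
        finally show ?thesis .
      qed
      have "\<theta> ^ j \<le> \<theta> ^ Suc j" using th2 by simp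
      then have "S N x = S (\<theta> ^ j) x + T j x"
        unfolding S_def T_def blk_def N_def lessThan_atLeast0
        by (intro sum.atLeastLessThan_concat[symmetric]) auto
      then have "(y - eps) * lil N \<le> S N x" using T2 lil1 j(1) by (simp add: algebra_simps)
      then show "(sqrt (s2 D) - eps) * lil (\<theta> ^ Suc j) \<le> S (\<theta> ^ Suc j) x" unfolding N_def y_def .
    qed
    show ?case unfolding frequently_sequentially
    proof
      fix n0 :: nat
      from fr obtain j where j: "n0 \<le> j" "(sqrt (s2 D) - eps) * lil (\<theta> ^ Suc j) \<le> S (\<theta> ^ Suc j) x"
        unfolding frequently_sequentially by blast
      have "j < 2 ^ j" by (rule less_exp)
      also have "(2::nat) ^ j \<le> \<theta> ^ j" using th2 by (rule power_mono) simp
      also have "\<dots> \<le> \<theta> ^ Suc j" using th2 by simp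
      finally have "n0 \<le> \<theta> ^ Suc j" using j(1) by simp
      with j(2) show "\<exists>N\<ge>n0. (sqrt (s2 D) - eps) * lil N \<le> (\<Sum>k<N. tp c D (real (m (\<tau> k)) * x))"
        unfolding S_def by blast
    qed
  qed
qed

section \<open>Fourier coefficients of periodic functions of bounded variation\<close>

text \<open>Jordan's inequality: \<open>sin\<close> is concave on this interval and lies above its
  chord.\<close>

lemma sin_ge_linear: "0 \<le> x \<Longrightarrow> x \<le> pi / 2 \<Longrightarrow> 2 / pi * x \<le> sin x"
proof -
  assume x: "0 \<le> x" "x \<le> pi / 2"
  have cv: "convex_on {0..pi / 2} (\<lambda>x. - sin x)"
  proof (rule f''_ge0_imp_convex)
    show "((\<lambda>x. - sin x) has_real_derivative - cos x) (at x)" for x :: real by (auto intro!: derivative_eq_intros)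
    show "((\<lambda>x. - cos x) has_real_derivative sin x) (at x)" for x :: real by (auto intro!: derivative_eq_intros)
    show "x \<in> {0..pi / 2} \<Longrightarrow> 0 \<le> sin x" for x using pi_half_le_two by (intro sin_ge_zero) auto
  qed auto
  define t where "t = 2 / pi * x"
  have t: "0 \<le> t" "t \<le> 1" unfolding t_def using x by (auto simp: field_simps)
  have xt: "t * (pi / 2) = x" unfolding t_def by simp
  have "- sin ((1 - t) *\<^sub>R 0 + t *\<^sub>R (pi / 2)) \<le> (1 - t) * (- sin 0) + t * (- sin (pi / 2))"
    by (rule convex_onD[OF cv]) (use t in auto)
  then have "t \<le> sin (t * (pi / 2))" by simp
  then show ?thesis unfolding xt unfolding t_def .
qed

text \<open>\<open>G\<close> is the variation function of \<open>f\<close>, continued over a second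
  period and then frozen. The range up to 2 is required because \<open>x + h\<close>, with both
  numbers in the unit interval, is compared with \<open>x\<close>. A monotone majorant turns
  integrated increments of \<open>f\<close> into telescoping integrals.\<close>

lemma bv_majorant:
  assumes per: "\<And>x. f (x + 1) = f x" and bv: "total_variation f 0 1 < \<infinity>"
  obtains G :: "real \<Rightarrow> real" and W where "mono G" "\<And>x. 0 \<le> G x" "\<And>x. G x \<le> W"
    "\<And>x y. 0 \<le> x \<Longrightarrow> x \<le> y \<Longrightarrow> y \<le> 2 \<Longrightarrow> \<bar>f y - f x\<bar> \<le> G y - G x"
proof -
  define vs where "vs = (\<lambda>(n::nat) t. \<Sum>i<n. \<bar>f (t (Suc i)) - f (t i)\<bar>)"
  define ch where "ch = (\<lambda>x (n::nat) (t::nat \<Rightarrow> real). t 0 = 0 \<and> t n = x \<and> (\<forall>i<n. t i \<le> t (Suc i)))"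
  define VS where "VS = (\<lambda>x. {vs n t | n t. ch x n t})"
  have vs0: "0 \<le> vs n t" for n t unfolding vs_def by (intro sum_nonneg) auto
  have ext: "\<exists>n' t'. ch y n' t' \<and> vs n' t' = vs n t + \<bar>f y - f x\<bar>" if "ch x n t" "x \<le> y" for x y n t
  proof (intro exI conjI)
    let ?t = "\<lambda>i. if i \<le> n then t i else y"
    show "ch y (Suc n) ?t" using that by (auto simp: ch_def le_Suc_eq less_Suc_eq_le not_less_eq_eq dest: le_antisym)
    have "(\<Sum>i<n. \<bar>f (?t (Suc i)) - f (?t i)\<bar>) = vs n t" unfolding vs_def by (intro sum.cong) auto
    moreover have "t n = x" using that by (simp add: ch_def)
    ultimately show "vs (Suc n) ?t = vs n t + \<bar>f y - f x\<bar>" by (simp add: vs_def)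
  qed
  have "\<exists>V. \<forall>n t. ch 1 n t \<longrightarrow> vs n t \<le> V"
  proof -
    have le: "ereal (vs n t) \<le> total_variation f 0 1" if "ch 1 n t" for n t
      unfolding total_variation_def vs_def
      by (rule SUP_upper2[of "(n, t)"]) (use that in \<open>auto simp: ch_def\<close>)
    have "\<exists>V. total_variation f 0 1 \<le> ereal V"
      using bv by (cases "total_variation f 0 1") auto
    then obtain V where "total_variation f 0 1 \<le> ereal V" by blast
    then have "vs n t \<le> V" if "ch 1 n t" for n t
      using order_trans[OF le[OF that]] by (metis ereal_less_eq(3))
    then show ?thesis by blast
  qed
  then obtain V where V: "\<And>n t. ch 1 n t \<Longrightarrow> vs n t \<le> V" by blast
  have bdd: "v \<le> V" if "v \<in> VS x" "x \<le> 1" for v x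
  proof -
    from that obtain n t where nt: "v = vs n t" "ch x n t" by (auto simp: VS_def)
    from ext[OF nt(2) that(2)] obtain n' t' where "ch 1 n' t'" "vs n' t' = vs n t + \<bar>f 1 - f x\<bar>" by blast
    with V[of n' t'] show ?thesis using nt(1) by linarith
  qed
  have ba: "bdd_above (VS x)" if "x \<le> 1" for x using bdd[OF _ that] by (auto simp: bdd_above_def)
  have ne: "VS x \<noteq> {}" if "0 \<le> x" for x
  proof -
    have "ch x 1 (\<lambda>i. if i = 0 then 0 else x)" using that by (auto simp: ch_def)
    then show ?thesis by (auto simp: VS_def)
  qed
  define vf where "vf = (\<lambda>x. Sup (VS x))"
  have vf_inc: "vf x + \<bar>f y - f x\<bar> \<le> vf y" if "0 \<le> x" "x \<le> y" "y \<le> 1" for x y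
  proof -
    have "vf x \<le> vf y - \<bar>f y - f x\<bar>" unfolding vf_def
    proof (rule cSup_least[OF ne[OF that(1)]])
      fix v assume "v \<in> VS x"
      then obtain n t where nt: "v = vs n t" "ch x n t" by (auto simp: VS_def)
      from ext[OF nt(2) that(2)] obtain n' t' where "ch y n' t'" "vs n' t' = vs n t + \<bar>f y - f x\<bar>" by blast
      then have "v + \<bar>f y - f x\<bar> \<in> VS y" using nt(1) by (auto simp: VS_def) metis
      then have "v + \<bar>f y - f x\<bar> \<le> Sup (VS y)" by (rule cSup_upper) (rule ba[OF that(3)])
      then show "v \<le> Sup (VS y) - \<bar>f y - f x\<bar>" by linarith
    qed
    then show ?thesis by linarith
  qed
  have vf0: "0 \<le> vf x" if x: "0 \<le> x" "x \<le> 1" for x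
  proof -
    obtain v where v: "v \<in> VS x" using ne[OF x(1)] by blast
    then have "0 \<le> v" using vs0 by (auto simp: VS_def)
    also have "v \<le> vf x" unfolding vf_def by (rule cSup_upper[OF v ba[OF x(2)]])
    finally show ?thesis .
  qed
  \<comment> \<open>Since \<open>f 1 = f 0\<close>, the variation over the first period is simply
    added; an increment across the point 1 is split there.\<close>
  define G0 where "G0 = (\<lambda>x. if x \<le> 1 then vf x else vf 1 + vf (x - 1))"
  have G0: "\<bar>f y - f x\<bar> \<le> G0 y - G0 x" if "0 \<le> x" "x \<le> y" "y \<le> 2" for x y
  proof -
    consider "y \<le> 1" | "1 < x" | "x \<le> 1" "1 < y" by linarith
    then show ?thesis
    proof cases
      case 1 then show ?thesis using vf_inc[of x y] that by (simp add: G0_def)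
    next
      case 2
      then show ?thesis using vf_inc[of "x - 1" "y - 1"] that per[of "x - 1"] per[of "y - 1"] by (simp add: G0_def)
    next
      case 3
      have "f 1 = f 0" using per[of 0] by simp
      moreover have "f y = f (y - 1)" using per[of "y - 1"] by simp
      moreover have "vf x + \<bar>f 1 - f x\<bar> \<le> vf 1" by (rule vf_inc) (use that 3 in auto)
      moreover have "vf 0 + \<bar>f (y - 1) - f 0\<bar> \<le> vf (y - 1)" by (rule vf_inc) (use that 3 in auto)
      moreover have "0 \<le> vf 0" by (rule vf0) auto
      ultimately show ?thesis using 3 by (simp add: G0_def)
    qed
  qed
  \<comment> \<open>Clamping the argument makes the function monotone and bounded on the whole
    line.\<close>
  define G where "G = (\<lambda>x. G0 (max 0 (min 2 x)))"
  have Gm: "mono G"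
  proof (rule monoI)
    fix x y :: real assume "x \<le> y"
    then have "\<bar>f (max 0 (min 2 y)) - f (max 0 (min 2 x))\<bar> \<le> G y - G x" unfolding G_def by (intro G0) auto
    then show "G x \<le> G y" by linarith
  qed
  show ?thesis
  proof
    show "mono G" by (rule Gm)
    show "0 \<le> G x" for x
      unfolding G_def G0_def using vf0[of 1] vf0[of "max 0 (min 2 x)"] vf0[of "max 0 (min 2 x) - 1"] by auto
    show "G x \<le> G 2" for x
    proof -
      have "G x \<le> G (max x 2)" using Gm by (auto simp: mono_def)
      also have "G (max x 2) = G 2" by (simp add: G_def)
      finally show ?thesis .
    qed
    show "\<bar>f y - f x\<bar> \<le> G y - G x" if "0 \<le> x" "x \<le> y" "y \<le> 2" for x y
    proof -
      have "max 0 (min 2 x) = x" "max 0 (min 2 y) = y" using that by auto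
      then show ?thesis unfolding G_def using G0[OF that] by simp
    qed
  qed
qed

section \<open>Integrals of periodic functions over one period\<close>

lemma integral_U_half_open:
  fixes g :: "real \<Rightarrow> 'a::{banach, second_countable_topology}"
  assumes [measurable]: "g \<in> borel_measurable borel"
  shows "integral\<^sup>L U g = (\<integral>x. indicator {0..<1} x *\<^sub>R g x \<partial>lborel)"
proof -
  have "integral\<^sup>L U g = (\<integral>x. indicator {0..1} x *\<^sub>R g x \<partial>lborel)"
    unfolding integral_U[OF assms] set_lebesgue_integral_def ..
  also have "\<dots> = (\<integral>x. indicator {0..<1} x *\<^sub>R g x \<partial>lborel)"
  proof (rule integral_cong_AE)
    have "AE x in lborel. x \<noteq> (1::real)" by (rule AE_lborel_singleton)
    then show "AE x in lborel. indicator {0..1} x *\<^sub>R g x = indicator {0..<1} x *\<^sub>R g x"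
      by eventually_elim (auto simp: indicator_def)
  qed auto
  finally show ?thesis .
qed

lemma integrable_piece:
  fixes g :: "real \<Rightarrow> 'a::{banach, second_countable_topology}"
  assumes [measurable]: "g \<in> borel_measurable borel" and B: "\<And>x. norm (g x) \<le> B"
  shows "integrable lborel (\<lambda>x. indicator {a..<b} x *\<^sub>R g x)"
proof (rule Bochner_Integration.integrable_bound)
  show "integrable lborel (\<lambda>x. indicator {a..<b} x *\<^sub>R B)"
    by (intro integrable_scaleR_left integrable_real_indicator emeasure_bounded_finite bounded_subset[of "{a..b}" "{a..<b}"]) auto
  show "AE x in lborel. norm (indicator {a..<b} x *\<^sub>R g x) \<le> norm (indicator {a..<b} x *\<^sub>R B)"
    using B order_trans[OF B abs_ge_self] by (auto simp: indicator_def)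
qed simp

lemma integrable_U_bounded:
  fixes g :: "real \<Rightarrow> 'a::{banach, second_countable_topology}"
  assumes "g \<in> borel_measurable borel" "\<And>x. norm (g x) \<le> B"
  shows "integrable U g"
  by (rule U.integrable_const_bound[of _ B]) (use assms in auto)

lemma integral_U_shift:
  fixes g :: "real \<Rightarrow> 'a::{banach, second_countable_topology}"
  assumes gm[measurable]: "g \<in> borel_measurable borel" and B: "\<And>x. norm (g x) \<le> B" and per: "\<And>x. g (x + 1) = g x"
    and h: "0 \<le> h" "h \<le> 1"
  shows "(\<integral>x. g (x + h) \<partial>U) = (\<integral>x. g x \<partial>U)"
proof -
  note ip = integrable_piece[OF gm B]
  have sh: "(\<integral>x. indicator {a..<b} x *\<^sub>R g (x + t) \<partial>lborel) = (\<integral>x. indicator {a + t..<b + t} x *\<^sub>R g x \<partial>lborel)" for a b t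
    using lborel_integral_real_affine[of 1 "\<lambda>x. indicator {a + t..<b + t} x *\<^sub>R g x" t]
    by (simp add: indicator_def add.commute)
  have "(\<integral>x. g (x + h) \<partial>U) = (\<integral>x. indicator {0..<1} x *\<^sub>R g (x + h) \<partial>lborel)"
    by (rule integral_U_half_open) measurable
  also have "\<dots> = (\<integral>x. indicator {h..<1 + h} x *\<^sub>R g x \<partial>lborel)" using sh[of 0 1 h] by simp
  also have "\<dots> = (\<integral>x. indicator {h..<1} x *\<^sub>R g x + indicator {1..<1 + h} x *\<^sub>R g x \<partial>lborel)"
    by (intro Bochner_Integration.integral_cong) (use h in \<open>auto simp: indicator_def\<close>)
  also have "\<dots> = (\<integral>x. indicator {h..<1} x *\<^sub>R g x \<partial>lborel) + (\<integral>x. indicator {1..<1 + h} x *\<^sub>R g x \<partial>lborel)"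
    by (rule Bochner_Integration.integral_add[OF ip ip])
  also have "(\<integral>x. indicator {1..<1 + h} x *\<^sub>R g x \<partial>lborel) = (\<integral>x. indicator {0..<h} x *\<^sub>R g x \<partial>lborel)"
    using sh[of 0 h 1] by (simp add: per add.commute)
  also have "(\<integral>x. indicator {h..<1} x *\<^sub>R g x \<partial>lborel) + \<dots> = (\<integral>x. indicator {h..<1} x *\<^sub>R g x + indicator {0..<h} x *\<^sub>R g x \<partial>lborel)"
    by (rule Bochner_Integration.integral_add[OF ip ip, symmetric])
  also have "\<dots> = (\<integral>x. indicator {0..<1} x *\<^sub>R g x \<partial>lborel)"
    by (intro Bochner_Integration.integral_cong) (use h in \<open>auto simp: indicator_def\<close>)
  also have "\<dots> = (\<integral>x. g x \<partial>U)" by (rule integral_U_half_open[symmetric]) measurable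
  finally show ?thesis .
qed

text \<open>Dilation by \<open>n\<close> runs through \<open>n\<close> full periods, each
  contributing the same integral. It makes the error of approximating \<open>f (m k * x)\<close>
  independent of \<open>k\<close>.\<close>

lemma integral_U_dilate:
  fixes g :: "real \<Rightarrow> real"
  assumes gm[measurable]: "g \<in> borel_measurable borel" and B: "\<And>x. norm (g x) \<le> B" and per: "\<And>x. g (x + 1) = g x"
    and n: "0 < (n::nat)"
  shows "(\<integral>x. g (real n * x) \<partial>U) = (\<integral>x. g x \<partial>U)"
proof -
  note ip = integrable_piece[OF gm B]
  have pern: "g (x + real k) = g x" for x k
    by (induction k) (use per in \<open>auto simp: add.assoc[symmetric] add.commute[of 1]\<close>)
  have piece: "(\<integral>x. indicator {real i..<real i + 1} x *\<^sub>R g x \<partial>lborel) = (\<integral>x. g x \<partial>U)" for i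
  proof -
    have "(\<integral>x. indicator {real i..<real i + 1} x *\<^sub>R g x \<partial>lborel) = (\<integral>x. indicator {0..<1} x *\<^sub>R g (x + real i) \<partial>lborel)"
      using lborel_integral_real_affine[of 1 "\<lambda>x. indicator {real i..<real i + 1} x *\<^sub>R g x" "real i"]
      by (simp add: indicator_def add.commute)
    then show ?thesis using integral_U_half_open[OF gm] by (simp add: pern)
  qed
  have "(\<integral>x. g x \<partial>U) * real n = (\<Sum>i<n. (\<integral>x. indicator {real i..<real i + 1} x *\<^sub>R g x \<partial>lborel))"
    unfolding piece by simp
  also have "\<dots> = (\<integral>x. (\<Sum>i<n. indicator {real i..<real i + 1} x *\<^sub>R g x) \<partial>lborel)"
    by (rule Bochner_Integration.integral_sum[symmetric]) (rule ip)
  also have "\<dots> = (\<integral>x. indicator {0..<real n} x *\<^sub>R g x \<partial>lborel)"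
  proof (intro Bochner_Integration.integral_cong refl)
    fix x
    have "(\<Sum>i<n. indicator {real i..<real i + 1} x) = (indicator {0..<real n} x :: real)"
      by (induction n) (auto simp: indicator_def)
    then show "(\<Sum>i<n. indicator {real i..<real i + 1} x *\<^sub>R g x) = indicator {0..<real n} x *\<^sub>R g x"
      by (simp flip: sum_distrib_right)
  qed
  also have "\<dots> = real n * (\<integral>x. indicator {0..<1} x *\<^sub>R g (real n * x) \<partial>lborel)"
    using lborel_integral_real_affine[of "real n" "\<lambda>x. indicator {0..<real n} x *\<^sub>R g x" 0] n
    by (simp add: indicator_def zero_le_mult_iff)
  also have "(\<integral>x. indicator {0..<1} x *\<^sub>R g (real n * x) \<partial>lborel) = (\<integral>x. g (real n * x) \<partial>U)"
    by (rule integral_U_half_open[symmetric]) measurable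
  finally show ?thesis using n by simp
qed

section \<open>Fourier coefficients of a function with a monotone majorant\<close>

locale bv_periodic =
  fixes f :: "real \<Rightarrow> real" and G :: "real \<Rightarrow> real" and W :: real
  assumes f_meas [measurable]: "f \<in> borel_measurable borel" and per: "\<And>x. f (x + 1) = f x"
    and mean0: "(\<integral>x. f x \<partial>U) = 0"
    and Gm: "mono G" and G0: "\<And>x. 0 \<le> G x" and GW: "\<And>x. G x \<le> W"
    and fG: "\<And>x y. 0 \<le> x \<Longrightarrow> x \<le> y \<Longrightarrow> y \<le> 2 \<Longrightarrow> \<bar>f y - f x\<bar> \<le> G y - G x"
begin

definition F :: real where "F = \<bar>f 0\<bar> + W"

lemma W0: "0 \<le> W" using G0[of 0] GW[of 0] by linarith

lemma per_int: "f (x + of_int k) = f x"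
proof -
  have n: "f (x + real n) = f x" for x n
    by (induction n) (use per in \<open>auto simp: add.assoc[symmetric] add.commute[of 1]\<close>)
  show ?thesis
  proof (cases "0 \<le> k")
    case True
    then show ?thesis using n[of x "nat k"] by simp
  next
    case False
    then show ?thesis using n[of "x + of_int k" "nat (- k)"] by simp
  qed
qed

lemma f_bound: "\<bar>f x\<bar> \<le> F"
proof -
  have "f x = f (frac x)" using per_int[of x "- \<lfloor>x\<rfloor>"] by (simp add: frac_def)
  moreover have "\<bar>f (frac x) - f 0\<bar> \<le> G (frac x) - G 0"
    using frac_lt_1[of x] by (intro fG) auto
  ultimately show ?thesis using G0[of 0] GW[of "frac x"] unfolding F_def by linarith
qed

lemma F0: "0 \<le> F" using f_bound[of 0] by linarith

lemma G_meas [measurable]: "G \<in> borel_measurable borel"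
  by (rule borel_measurable_mono[OF Gm])

text \<open>The integral of \<open>G (x + h) - G x\<close> collapses to the integral of
  \<open>G\<close> from 1 to \<open>1 + h\<close> minus that from 0 to \<open>h\<close>, which is at
  most \<open>W * h\<close>.\<close>

lemma L1_shift:
  assumes h: "0 \<le> h" "h \<le> 1"
  shows "(\<integral>x. \<bar>f (x + h) - f x\<bar> \<partial>U) \<le> W * h"
proof -
  have Gb: "norm (G x) \<le> W" for x using G0[of x] GW[of x] by simp
  note ip = integrable_piece[OF G_meas Gb]
  have fb: "integrable U (\<lambda>x. \<bar>f (x + h) - f x\<bar>)"
  proof (rule integrable_U_bounded)
    show "norm \<bar>f (x + h) - f x\<bar> \<le> 2 * F" for x using f_bound[of x] f_bound[of "x + h"] by simp
  qed measurable
  have Gi: "integrable U (\<lambda>x. G (x + h) - G x)"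
  proof (rule integrable_U_bounded)
    show "norm (G (x + h) - G x) \<le> W" for x using G0[of x] GW[of x] G0[of "x + h"] GW[of "x + h"] by auto
  qed measurable
  have "(\<integral>x. \<bar>f (x + h) - f x\<bar> \<partial>U) \<le> (\<integral>x. G (x + h) - G x \<partial>U)"
  proof (rule integral_mono_AE[OF fb Gi])
    show "AE x in U. \<bar>f (x + h) - f x\<bar> \<le> G (x + h) - G x"
      unfolding AE_U using h by (auto intro!: always_eventually fG)
  qed
  also have "\<dots> = (\<integral>x. indicator {0..<1} x *\<^sub>R (G (x + h) - G x) \<partial>lborel)"
    by (rule integral_U_half_open) measurable
  also have "\<dots> = (\<integral>x. indicator {h..<1 + h} (h + x) *\<^sub>R G (h + x) - indicator {0..<1} x *\<^sub>R G x \<partial>lborel)"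
    by (intro Bochner_Integration.integral_cong) (auto simp: indicator_def add.commute)
  also have "\<dots> = (\<integral>x. indicator {h..<1 + h} (h + x) *\<^sub>R G (h + x) \<partial>lborel) - (\<integral>x. indicator {0..<1} x *\<^sub>R G x \<partial>lborel)"
    by (rule Bochner_Integration.integral_diff)
       (use lborel_integrable_real_affine[OF ip, of 1 h "1 + h" h] ip in \<open>auto simp: mult.commute\<close>)
  also have "(\<integral>x. indicator {h..<1 + h} (h + x) *\<^sub>R G (h + x) \<partial>lborel) = (\<integral>x. indicator {h..<1 + h} x *\<^sub>R G x \<partial>lborel)"
    using lborel_integral_real_affine[of 1 "\<lambda>x. indicator {h..<1 + h} x *\<^sub>R G x" h] by simp
  also have "(\<integral>x. indicator {h..<1 + h} x *\<^sub>R G x \<partial>lborel) - (\<integral>x. indicator {0..<1} x *\<^sub>R G x \<partial>lborel)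
     = (\<integral>x. indicator {h..<1 + h} x *\<^sub>R G x - indicator {0..<1} x *\<^sub>R G x \<partial>lborel)"
    by (rule Bochner_Integration.integral_diff[symmetric, OF ip ip])
  also have "\<dots> \<le> (\<integral>x. indicator {1..<1 + h} x *\<^sub>R W \<partial>lborel)"
  proof (rule integral_mono)
    show "integrable lborel (\<lambda>x. indicator {1..<1 + h} x *\<^sub>R W)"
      by (rule integrable_piece[where B = "\<bar>W\<bar>"]) auto
    show "indicator {h..<1 + h} x *\<^sub>R G x - indicator {0..<1} x *\<^sub>R G x \<le> indicator {1..<1 + h} x *\<^sub>R W" for x
      using G0[of x] GW[of x] h W0 by (auto simp: indicator_def)
  qed (intro Bochner_Integration.integrable_diff ip)
  also have "\<dots> = W * h" using h by simp
  finally show ?thesis .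
qed

definition cf :: "int \<Rightarrow> complex" where "cf j = (\<integral>x. of_real (f x) * ee (- j) x \<partial>U)"

lemma f_ee_bound: "cmod (of_real (f x) * ee j x) \<le> F"
  using f_bound[of x] by (simp add: norm_mult)

lemma f_ee_int: "integrable U (\<lambda>x. of_real (f x) * ee j x)"
  by (rule integrable_U_bounded[OF _ f_ee_bound]) measurable

lemma cf_cnj: "cf (- j) = cnj (cf j)"
proof -
  have "cnj (cf j) = (\<integral>x. cnj (of_real (f x) * ee (- j) x) \<partial>U)"
    unfolding cf_def by (rule Bochner_Integration.integral_cnj[symmetric])
  then show ?thesis by (simp add: cf_def cnj_ee)
qed

lemma cf_0: "cf 0 = 0"
proof -
  have "cf 0 = (\<integral>x. complex_of_real (f x) \<partial>U)" by (simp add: cf_def)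
  also have "\<dots> = of_real (\<integral>x. f x \<partial>U)" by (rule integral_complex_of_real)
  finally show ?thesis using mean0 by simp
qed

text \<open>A shift by half a wavelength changes the sign of the character, so
  \<open>2 * cf j\<close> is the integral of the difference between \<open>f\<close> and its shift
  against that character, and \<open>L1_shift\<close> applies.\<close>

lemma cf_decay:
  assumes j: "j \<noteq> 0" shows "cmod (cf j) \<le> W / \<bar>of_int j\<bar>"
proof -
  define h where "h = 1 / (2 * \<bar>real_of_int j\<bar>)"
  have h: "0 \<le> h" "h \<le> 1" using j by (auto simp: h_def field_simps)
  have eh: "ee (- j) (x + h) = - ee (- j) x" for x
  proof -
    have "ee (- j) (x + h) = ee (- j) x * cis (2 * pi * of_int (- j) * h)"
      by (simp add: ee_def cis_mult distrib_left)
    also have "cis (2 * pi * of_int (- j) * h) = - 1"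
    proof (cases "0 < j")
      case True
      then have "2 * pi * of_int (- j) * h = - pi" by (simp add: h_def)
      then show ?thesis by (simp only:) (simp add: complex_eq_iff)
    next
      case False
      then have "2 * pi * of_int (- j) * h = pi" using j by (simp add: h_def)
      then show ?thesis by (simp only:) (simp add: complex_eq_iff)
    qed
    finally show ?thesis by simp
  qed
  have "cf j = (\<integral>x. of_real (f (x + h)) * ee (- j) (x + h) \<partial>U)"
    unfolding cf_def
    by (rule integral_U_shift[OF _ f_ee_bound _ h, symmetric]) (auto simp: per ee_periodic)
  also have "\<dots> = - (\<integral>x. of_real (f (x + h)) * ee (- j) x \<partial>U)" by (simp add: eh)
  finally have c2: "cf j = - (\<integral>x. of_real (f (x + h)) * ee (- j) x \<partial>U)" .
  have i1: "integrable U (\<lambda>x. of_real (f (x + h)) * ee (- j) x)"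
    by (rule integrable_U_bounded[of _ F]) (auto simp: norm_mult f_bound)
  have "2 * cf j = (\<integral>x. of_real (f x) * ee (- j) x \<partial>U) - (\<integral>x. of_real (f (x + h)) * ee (- j) x \<partial>U)"
    using c2 unfolding cf_def[of j, symmetric] by simp
  also have "\<dots> = (\<integral>x. of_real (f x) * ee (- j) x - of_real (f (x + h)) * ee (- j) x \<partial>U)"
    by (rule Bochner_Integration.integral_diff[symmetric, OF f_ee_int i1])
  finally have "cmod (2 * cf j) = cmod (\<integral>x. of_real (f x) * ee (- j) x - of_real (f (x + h)) * ee (- j) x \<partial>U)" by simp
  also have "\<dots> \<le> (\<integral>x. cmod (of_real (f x) * ee (- j) x - of_real (f (x + h)) * ee (- j) x) \<partial>U)"
    by (rule integral_norm_bound)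
  also have "\<dots> = (\<integral>x. \<bar>f (x + h) - f x\<bar> \<partial>U)"
  proof (intro Bochner_Integration.integral_cong refl)
    fix x
    have "of_real (f x) * ee (- j) x - of_real (f (x + h)) * ee (- j) x = of_real (f x - f (x + h)) * ee (- j) x"
      by (simp add: left_diff_distrib)
    then show "cmod (of_real (f x) * ee (- j) x - of_real (f (x + h)) * ee (- j) x) = \<bar>f (x + h) - f x\<bar>"
      by (simp only: norm_mult norm_ee norm_of_real mult_1_right abs_minus_commute)
  qed
  also have "\<dots> \<le> W * h" by (rule L1_shift[OF h])
  finally have "2 * cmod (cf j) \<le> W / (2 * \<bar>of_int j\<bar>)" by (simp add: h_def norm_mult)
  moreover have "W / (2 * \<bar>of_int j\<bar>) \<le> 2 * (W / \<bar>of_int j\<bar>)" using W0 j by (simp add: field_simps)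
  ultimately show ?thesis by linarith
qed

definition s2f :: "nat \<Rightarrow> real" where "s2f n = (\<Sum>j\<in>freqs n. (cmod (cf j))\<^sup>2)"

lemma tp_cf: "of_real (tp cf n x) = (\<Sum>j\<in>freqs n. cf j * ee j x)"
  by (rule tp_complex[of cf, OF cf_cnj])

lemma uminus_freqs: "- j \<in> freqs n \<longleftrightarrow> j \<in> freqs n" by (auto simp: freqs_def)

lemma cf_mult: "cf (- j) * cf j = of_real ((cmod (cf j))\<^sup>2)"
  unfolding cf_cnj complex_norm_square by (simp add: mult.commute)

lemma integral_f_tp: "(\<integral>x. f x * tp cf n x \<partial>U) = s2f n"
proof -
  have "complex_of_real (\<integral>x. f x * tp cf n x \<partial>U) = (\<integral>x. of_real (f x * tp cf n x) \<partial>U)"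
    by (rule integral_complex_of_real[symmetric])
  also have "\<dots> = (\<integral>x. (\<Sum>j\<in>freqs n. cf j * (of_real (f x) * ee j x)) \<partial>U)"
    by (intro Bochner_Integration.integral_cong) (auto simp: tp_cf sum_distrib_left mult_ac)
  also have "\<dots> = (\<Sum>j\<in>freqs n. cf j * (\<integral>x. of_real (f x) * ee j x \<partial>U))"
    by (subst Bochner_Integration.integral_sum) (auto intro: f_ee_int)
  also have "\<dots> = (\<Sum>j\<in>freqs n. of_real ((cmod (cf j))\<^sup>2))"
  proof (rule sum.cong[OF refl])
    fix j
    have "(\<integral>x. of_real (f x) * ee j x \<partial>U) = cf (- j)" by (simp add: cf_def)
    then show "cf j * (\<integral>x. of_real (f x) * ee j x \<partial>U) = of_real ((cmod (cf j))\<^sup>2)"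
      using cf_mult[of j] by (simp add: mult.commute)
  qed
  finally show ?thesis unfolding s2f_def by (metis of_real_eq_iff of_real_sum)
qed

lemma integral_tp_tp: "(\<integral>x. (tp cf n x)\<^sup>2 \<partial>U) = s2f n"
proof -
  have "complex_of_real (\<integral>x. (tp cf n x)\<^sup>2 \<partial>U) = (\<integral>x. of_real ((tp cf n x)\<^sup>2) \<partial>U)"
    by (rule integral_complex_of_real[symmetric])
  also have "\<dots> = (\<integral>x. (\<Sum>i\<in>freqs n. \<Sum>j\<in>freqs n. cf i * cf j * ee (i + j) x) \<partial>U)"
    by (intro Bochner_Integration.integral_cong) (auto simp: tp_cf power2_eq_square sum_product ee_add mult_ac)
  also have "\<dots> = (\<Sum>i\<in>freqs n. \<integral>x. (\<Sum>j\<in>freqs n. cf i * cf j * ee (i + j) x) \<partial>U)"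
    by (rule Bochner_Integration.integral_sum) (intro integrable_U_cont continuous_intros)
  also have "\<dots> = (\<Sum>i\<in>freqs n. \<Sum>j\<in>freqs n. \<integral>x. cf i * cf j * ee (i + j) x \<partial>U)"
    by (intro sum.cong refl Bochner_Integration.integral_sum integrable_U_cont continuous_intros)
  also have "\<dots> = (\<Sum>i\<in>freqs n. \<Sum>j\<in>freqs n. if j = - i then cf i * cf j else 0)"
  proof (intro sum.cong refl)
    fix i j
    have "(\<integral>x. cf i * cf j * ee (i + j) x \<partial>U) = cf i * cf j * (if i + j = 0 then 1 else 0)"
      by (simp only: integral_mult_right_zero integral_ee)
    moreover have "i + j = 0 \<longleftrightarrow> j = - i" by auto
    ultimately show "(\<integral>x. cf i * cf j * ee (i + j) x \<partial>U) = (if j = - i then cf i * cf j else 0)"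
      by (simp only:) simp
  qed
  also have "\<dots> = (\<Sum>i\<in>freqs n. of_real ((cmod (cf i))\<^sup>2))"
  proof (rule sum.cong[OF refl])
    fix i assume "i \<in> freqs n"
    then have "(\<Sum>j\<in>freqs n. if j = - i then cf i * cf j else 0) = cf i * cf (- i)"
      by (simp add: sum.delta uminus_freqs)
    then show "(\<Sum>j\<in>freqs n. if j = - i then cf i * cf j else 0) = of_real ((cmod (cf i))\<^sup>2)"
      using cf_mult[of i] by (simp only: mult.commute)
  qed
  finally show ?thesis unfolding s2f_def by (metis of_real_eq_iff of_real_sum)
qed

lemma f_tp_int: "integrable U (\<lambda>x. f x * tp cf n x)"
proof (rule Bochner_Integration.integrable_bound)
  show "integrable U (\<lambda>x. F * tp cf n x)" by (intro integrable_U_cont continuous_intros)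
  show "AE x in U. norm (f x * tp cf n x) \<le> norm (F * tp cf n x)"
    using f_bound F0 by (auto simp: abs_mult intro!: mult_right_mono)
qed measurable

lemma f2_int: "integrable U (\<lambda>x. (f x)\<^sup>2)"
proof (rule integrable_U_bounded[of _ "F\<^sup>2"])
  show "norm ((f x)\<^sup>2) \<le> F\<^sup>2" for x using power_mono[OF f_bound, of x 2] by simp
qed measurable

lemma L2_error: "(\<integral>x. (f x - tp cf n x)\<^sup>2 \<partial>U) = (\<integral>x. (f x)\<^sup>2 \<partial>U) - s2f n"
proof -
  have t: "integrable U (\<lambda>x. (tp cf n x)\<^sup>2)" by (intro integrable_U_cont continuous_intros)
  have "(\<integral>x. (f x - tp cf n x)\<^sup>2 \<partial>U) = (\<integral>x. (f x)\<^sup>2 - 2 * (f x * tp cf n x) + (tp cf n x)\<^sup>2 \<partial>U)"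
    by (intro Bochner_Integration.integral_cong) (auto simp: power2_diff)
  also have "\<dots> = (\<integral>x. (f x)\<^sup>2 \<partial>U) - 2 * s2f n + s2f n"
    using f2_int f_tp_int t by (simp add: integral_f_tp integral_tp_tp)
  finally show ?thesis by simp
qed

text \<open>The rate of mean square convergence needs of the Fejer kernel only its mass, its positivity
  and the bound \<open>fejer n h * d\<^sup>2 \<le> 1 / (4 * n)\<close>, where \<open>d\<close> is the distance from \<open>h\<close> to the nearest integer.\<close>

definition fejer :: "nat \<Rightarrow> real \<Rightarrow> real" where
  "fejer n h = (cmod (\<Sum>r<n. ee (int r) h))\<^sup>2 / real n"

lemma fejer_cont: "continuous_on UNIV (fejer n)"
  unfolding fejer_def[abs_def] by (cases "n = 0") (auto intro!: continuous_intros)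

lemma fejer_meas [measurable]: "fejer n \<in> borel_measurable borel"
  by (rule borel_measurable_continuous_onI[OF fejer_cont])

lemma fejer_nonneg: "0 \<le> fejer n h" by (simp add: fejer_def)

lemma fejer_sum: "complex_of_real (fejer n h) = (\<Sum>r<n. \<Sum>s<n. ee (int r - int s) h) / of_nat n"
proof -
  let ?S = "\<Sum>r<n. ee (int r) h"
  have "complex_of_real ((cmod ?S)\<^sup>2) = ?S * cnj ?S" by (rule complex_norm_square)
  also have "cnj ?S = (\<Sum>s<n. ee (- int s) h)" by (simp add: cnj_ee)
  also have "?S * \<dots> = (\<Sum>r<n. \<Sum>s<n. ee (int r - int s) h)"
    by (simp add: sum_product flip: ee_add)
  finally show ?thesis unfolding fejer_def by simp
qed

text \<open>The geometric sum times \<open>1 - ee 1 h\<close> has modulus at most 2, and the modulus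
  of \<open>1 - ee 1 h\<close> is \<open>2 * sin (pi * d)\<close>, which is at least
  \<open>4 * d\<close>.\<close>

lemma fejer_bound: "0 \<le> h \<Longrightarrow> h \<le> 1 \<Longrightarrow> fejer n h * (min h (1 - h))\<^sup>2 \<le> 1 / (4 * real n)"
proof -
  assume h: "0 \<le> h" "h \<le> 1"
  define d where "d = min h (1 - h)"
  have d: "0 \<le> d" "d \<le> 1 / 2" using h unfolding d_def min_def by auto
  let ?S = "\<Sum>r<n. ee (int r) h"
  have pw: "ee (int r) h = ee 1 h ^ r" for r
    unfolding ee_def Complex.DeMoivre by (simp add: mult_ac)
  have "(1 - ee 1 h) * ?S = 1 - ee 1 h ^ n"
    unfolding pw by (rule one_diff_power_eq[symmetric])
  then have "cmod (1 - ee 1 h) * cmod ?S = cmod (1 - ee 1 h ^ n)" by (metis norm_mult)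
  also have "\<dots> \<le> cmod 1 + cmod (ee 1 h ^ n)" by (rule norm_triangle_ineq4)
  also have "\<dots> = 2" by (simp add: norm_power)
  finally have 1: "cmod (1 - ee 1 h) * cmod ?S \<le> 2" .
  have 2: "4 * d \<le> cmod (1 - ee 1 h)"
  proof (rule power2_le_imp_le)
    have cs: "cos (2 * pi * h) = 1 - 2 * (sin (pi * d))\<^sup>2"
    proof -
      have "sin (pi * d) = sin (pi * h)"
      proof (cases "h \<le> 1 - h")
        case False
        then have "pi * d = pi - pi * h" by (simp add: d_def algebra_simps)
        then show ?thesis by simp
      qed (simp add: d_def)
      moreover have "cos (2 * (pi * h)) = 1 - 2 * (sin (pi * h))\<^sup>2" by (rule cos_double_sin)
      ultimately show ?thesis by (simp add: mult.assoc)
    qed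
    have "(cmod (1 - ee 1 h))\<^sup>2 = (1 - cos (2 * pi * h))\<^sup>2 + (sin (2 * pi * h))\<^sup>2"
      by (simp add: ee_def cmod_power2)
    also have "\<dots> = 2 * (1 - cos (2 * pi * h))"
      using sin_cos_squared_add[of "2 * pi * h"] by (simp add: power2_diff)
    also have "\<dots> = (2 * sin (pi * d))\<^sup>2" unfolding cs by (simp add: power2_eq_square)
    finally have e: "(cmod (1 - ee 1 h))\<^sup>2 = (2 * sin (pi * d))\<^sup>2" .
    have "pi * d \<le> pi * (1 / 2)" by (intro mult_left_mono d) auto
    then have "2 / pi * (pi * d) \<le> sin (pi * d)" using d by (intro sin_ge_linear) auto
    then have "4 * d \<le> 2 * sin (pi * d)" by simp
    then show "(4 * d)\<^sup>2 \<le> (cmod (1 - ee 1 h))\<^sup>2" unfolding e using d by (intro power_mono) auto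
  qed simp
  have "4 * d * cmod ?S \<le> cmod (1 - ee 1 h) * cmod ?S" using 2 by (intro mult_right_mono) auto
  then have "2 * (d * cmod ?S) \<le> 1" using 1 by linarith
  then have "(2 * (d * cmod ?S))\<^sup>2 \<le> 1" using d by (intro power_le_one) auto
  then have "(cmod ?S)\<^sup>2 * d\<^sup>2 \<le> 1 / 4" by (simp add: power_mult_distrib mult.commute)
  then have "(cmod ?S)\<^sup>2 * d\<^sup>2 / real n \<le> (1 / 4) / real n" by (intro divide_right_mono) auto
  then show ?thesis unfolding d_def fejer_def by simp
qed

lemma fejer_integral: "0 < n \<Longrightarrow> (\<integral>h. fejer n h \<partial>U) = 1"
proof -
  assume n: "0 < n"
  have "complex_of_real (\<integral>h. fejer n h \<partial>U) = (\<integral>h. (\<Sum>r<n. \<Sum>s<n. ee (int r - int s) h) / of_nat n \<partial>U)"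
    unfolding integral_complex_of_real[symmetric] fejer_sum ..
  also have "\<dots> = (\<integral>h. (\<Sum>r<n. \<Sum>s<n. ee (int r - int s) h) \<partial>U) / of_nat n" by simp
  also have "(\<integral>h. (\<Sum>r<n. \<Sum>s<n. ee (int r - int s) h) \<partial>U) = (\<Sum>r<n. \<integral>h. (\<Sum>s<n. ee (int r - int s) h) \<partial>U)"
    by (rule Bochner_Integration.integral_sum) (intro integrable_U_cont continuous_intros)
  also have "\<dots> = (\<Sum>r<n. \<Sum>s<n. \<integral>h. ee (int r - int s) h \<partial>U)"
    by (intro sum.cong refl Bochner_Integration.integral_sum integrable_U_cont continuous_intros)
  also have "\<dots> = (\<Sum>r<n. \<Sum>s<n. if s = r then 1 else 0)"
    by (intro sum.cong refl) (simp add: integral_ee)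
  also have "\<dots> = of_nat n" by (simp add: sum.delta)
  finally show ?thesis using n by (simp add: complex_eq_iff)
qed

text \<open>The autocorrelation of \<open>f\<close>. Its Fourier coefficients are the squared moduli
  of those of \<open>f\<close>, which translates continuity of \<open>f\<close> under shifts into
  smallness of the mean square tail.\<close>

definition A :: "real \<Rightarrow> real" where "A h = (\<integral>x. f x * f (x + h) \<partial>U)"

lemma ff_bound: "\<bar>f x * f y\<bar> \<le> F * F"
  unfolding abs_mult by (intro mult_mono f_bound F0) auto

lemma A_meas [measurable]: "A \<in> borel_measurable borel"
  unfolding A_def[abs_def] by (rule U.borel_measurable_lebesgue_integral) measurable

lemma A_bound: "\<bar>A h\<bar> \<le> F * F"
proof -
  have i: "integrable U (\<lambda>x. f x * f (x + h))" by (rule integrable_U_bounded[of _ "F * F"]) (auto simp: ff_bound)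
  have "norm (A h) \<le> (\<integral>x. norm (f x * f (x + h)) \<partial>U)" unfolding A_def by (rule integral_norm_bound)
  also have "\<dots> \<le> (\<integral>x. F * F \<partial>U)"
    by (rule integral_mono[OF integrable_norm[OF i]]) (auto simp: ff_bound)
  finally have "norm (A h) \<le> (\<integral>x. F * F \<partial>U)" .
  then show ?thesis using U.prob_space by simp
qed

lemma A_fourier: "(\<integral>h. ee k h * of_real (A h) \<partial>U) = of_real ((cmod (cf k))\<^sup>2)"
proof -
  interpret P: pair_sigma_finite U U ..
  have mm: "(\<lambda>p. ee k (snd p) * of_real (f (fst p) * f (fst p + snd p))) \<in> borel_measurable (U \<Otimes>\<^sub>M U)"
    by measurable
  have bb: "cmod (ee k (snd p) * of_real (f (fst p) * f (fst p + snd p))) \<le> F * F" for p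
    using ff_bound[of "fst p" "fst p + snd p"] by (simp add: norm_mult abs_mult)
  interpret UU: prob_space "U \<Otimes>\<^sub>M U"
    by (intro prob_space_pair U.prob_space_axioms)
  have ip: "integrable (U \<Otimes>\<^sub>M U) (\<lambda>(x, h). ee k h * of_real (f x * f (x + h)))"
    unfolding case_prod_beta by (rule UU.integrable_const_bound[OF AE_I2[OF bb] mm])
  have "(\<integral>h. ee k h * of_real (A h) \<partial>U) = (\<integral>h. (\<integral>x. ee k h * of_real (f x * f (x + h)) \<partial>U) \<partial>U)"
    unfolding A_def by (simp only: integral_complex_of_real[symmetric] integral_mult_right_zero)
  also have "\<dots> = (\<integral>x. (\<integral>h. ee k h * of_real (f x * f (x + h)) \<partial>U) \<partial>U)"
    by (rule P.Fubini_integral[OF ip])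
  also have "\<dots> = (\<integral>x. cf (- k) * (of_real (f x) * ee (- k) x) \<partial>U)"
  proof (rule integral_cong_AE)
    have "(\<integral>h. ee k h * of_real (f x * f (x + h)) \<partial>U) = cf (- k) * (of_real (f x) * ee (- k) x)" if x: "0 \<le> x" "x \<le> 1" for x
    proof -
      have "(\<integral>h. of_real (f (h + x)) * ee k (h + x) \<partial>U) = (\<integral>h. of_real (f h) * ee k h \<partial>U)"
        by (rule integral_U_shift[OF _ f_ee_bound _ x]) (auto simp: per ee_periodic)
      also have "\<dots> = cf (- k)" by (simp add: cf_def)
      finally have s: "(\<integral>h. of_real (f (h + x)) * ee k (h + x) \<partial>U) = cf (- k)" .
      have e: "ee k h = ee (- k) x * ee k (h + x)" for h
      proof -
        have "ee (- k) x * ee k x = 1" using ee_add[of "- k" k x] by simp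
        moreover have "ee k (h + x) = ee k h * ee k x" by (simp add: ee_def cis_mult distrib_left)
        ultimately show ?thesis by simp
      qed
      have "(\<integral>h. ee k h * of_real (f x * f (x + h)) \<partial>U) = (\<integral>h. (of_real (f x) * ee (- k) x) * (of_real (f (h + x)) * ee k (h + x)) \<partial>U)"
      proof (intro Bochner_Integration.integral_cong refl)
        fix h
        show "ee k h * of_real (f x * f (x + h)) = (of_real (f x) * ee (- k) x) * (of_real (f (h + x)) * ee k (h + x))"
          by (simp only: e[of h] of_real_mult add.commute[of x h]) (simp only: mult_ac)
      qed
      also have "\<dots> = (of_real (f x) * ee (- k) x) * cf (- k)" by (simp only: integral_mult_right_zero s)
      finally show ?thesis by (simp add: mult.commute)
    qed
    then show "AE x in U. (\<integral>h. ee k h * of_real (f x * f (x + h)) \<partial>U) = cf (- k) * (of_real (f x) * ee (- k) x)"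
      by (auto simp: AE_U intro!: always_eventually)
    show "(\<lambda>x. \<integral>h. ee k h * of_real (f x * f (x + h)) \<partial>U) \<in> borel_measurable U"
      by (rule U.borel_measurable_lebesgue_integral) measurable
  qed measurable
  also have "\<dots> = cf (- k) * cf k" by (simp only: integral_mult_right_zero cf_def)
  finally show ?thesis by (simp only: cf_mult)
qed

text \<open>The integral is the average over \<open>r < n\<close> of the sums of squared
  coefficients over windows of \<open>n\<close> consecutive frequencies; each window lies in
  \<open>freqs n\<close> together with 0, and \<open>cf 0\<close> vanishes.\<close>

lemma fejer_A: "0 < n \<Longrightarrow> (\<integral>h. fejer n h * A h \<partial>U) \<le> s2f n"
proof -
  assume n: "0 < n"
  have i: "integrable U (\<lambda>h. ee k h * of_real (A h))" for k
    by (rule integrable_U_bounded[of _ "F * F"]) (auto simp: norm_mult A_bound)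
  have "complex_of_real (\<integral>h. fejer n h * A h \<partial>U) = (\<integral>h. of_real (fejer n h) * of_real (A h) \<partial>U)"
    by (simp flip: integral_complex_of_real)
  also have "\<dots> = (\<integral>h. (\<Sum>r<n. \<Sum>s<n. ee (int r - int s) h * of_real (A h)) / of_nat n \<partial>U)"
    unfolding fejer_sum by (simp add: sum_distrib_right)
  also have "\<dots> = (\<integral>h. (\<Sum>r<n. \<Sum>s<n. ee (int r - int s) h * of_real (A h)) \<partial>U) / of_nat n" by simp
  also have "(\<integral>h. (\<Sum>r<n. \<Sum>s<n. ee (int r - int s) h * of_real (A h)) \<partial>U) = (\<Sum>r<n. \<integral>h. (\<Sum>s<n. ee (int r - int s) h * of_real (A h)) \<partial>U)"
    by (rule Bochner_Integration.integral_sum) (intro Bochner_Integration.integrable_sum i)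
  also have "\<dots> = (\<Sum>r<n. \<Sum>s<n. \<integral>h. ee (int r - int s) h * of_real (A h) \<partial>U)"
    by (intro sum.cong refl Bochner_Integration.integral_sum i)
  also have "\<dots> = of_real (\<Sum>r<n. \<Sum>s<n. (cmod (cf (int r - int s)))\<^sup>2)"
    by (simp add: A_fourier)
  finally have "complex_of_real (\<integral>h. fejer n h * A h \<partial>U) = of_real ((\<Sum>r<n. \<Sum>s<n. (cmod (cf (int r - int s)))\<^sup>2) / real n)"
    by simp
  then have "(\<integral>h. fejer n h * A h \<partial>U) = (\<Sum>r<n. \<Sum>s<n. (cmod (cf (int r - int s)))\<^sup>2) / real n"
    by (simp only: of_real_eq_iff)
  also have "\<dots> \<le> (\<Sum>r<n. s2f n) / real n"
  proof (intro divide_right_mono sum_mono)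
    fix r assume "r \<in> {..<n}"
    then have r: "r < n" by simp
    have "(\<Sum>s<n. (cmod (cf (int r - int s)))\<^sup>2) = (\<Sum>k\<in>(\<lambda>s. int r - int s) ` {..<n}. (cmod (cf k))\<^sup>2)"
      by (subst sum.reindex) (auto simp: inj_on_def)
    also have "\<dots> \<le> (\<Sum>k\<in>insert 0 (freqs n). (cmod (cf k))\<^sup>2)"
      by (rule sum_mono2) (use r in \<open>auto simp: freqs_def\<close>)
    also have "\<dots> = s2f n" unfolding s2f_def by (subst sum.insert) (auto simp: cf_0 freqs_def)
    finally show "(\<Sum>s<n. (cmod (cf (int r - int s)))\<^sup>2) \<le> s2f n" .
  qed simp
  also have "\<dots> = s2f n" using n by simp
  finally show ?thesis .
qed

text \<open>Twice the left side is the squared \<open>L^2\<close> distance between \<open>f\<close>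
  and its shift, at most \<open>2 * F\<close> times the \<open>L^1\<close> distance. Periodicity
  allows \<open>h\<close> to be exchanged with \<open>1 - h\<close>.\<close>

lemma A_defect:
  assumes h: "0 \<le> h" "h \<le> 1"
  shows "(\<integral>x. (f x)\<^sup>2 \<partial>U) - A h \<le> F * W * min h (1 - h)"
proof -
  have sh: "(\<integral>x. (f (x + t) - f x)\<^sup>2 \<partial>U) \<le> 2 * F * (W * t)" if t: "0 \<le> t" "t \<le> 1" for t
  proof -
    have "(\<integral>x. (f (x + t) - f x)\<^sup>2 \<partial>U) \<le> (\<integral>x. 2 * F * \<bar>f (x + t) - f x\<bar> \<partial>U)"
    proof (rule integral_mono)
      have b: "\<bar>f (x + t) - f x\<bar> \<le> 2 * F" for x using f_bound[of x] f_bound[of "x + t"] by linarith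
      show "(f (x + t) - f x)\<^sup>2 \<le> 2 * F * \<bar>f (x + t) - f x\<bar>" for x
        using mult_right_mono[OF b[of x] abs_ge_zero[of "f (x + t) - f x"]] by (simp add: power2_eq_square)
      show "integrable U (\<lambda>x. (f (x + t) - f x)\<^sup>2)"
        by (rule integrable_U_bounded[of _ "(2 * F)\<^sup>2"]) (use power_mono[OF b, of _ 2] in auto)
      show "integrable U (\<lambda>x. 2 * F * \<bar>f (x + t) - f x\<bar>)"
        by (rule integrable_mult_right, rule integrable_U_bounded[of _ "2 * F"]) (use b in auto)
    qed
    also have "\<dots> = 2 * F * (\<integral>x. \<bar>f (x + t) - f x\<bar> \<partial>U)" by simp
    also have "\<dots> \<le> 2 * F * (W * t)" using F0 by (intro mult_left_mono L1_shift t) auto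
    finally show ?thesis .
  qed
  have i: "integrable U (\<lambda>x. (f (x + h))\<^sup>2)" "integrable U (\<lambda>x. f x * f (x + h))"
    using power_mono[OF f_bound, of _ 2] by (auto intro!: integrable_U_bounded[of _ "F\<^sup>2"] simp: ff_bound[folded power2_eq_square])
  have "(\<integral>x. (f (x + h) - f x)\<^sup>2 \<partial>U) = (\<integral>x. (f (x + h))\<^sup>2 - 2 * (f x * f (x + h)) + (f x)\<^sup>2 \<partial>U)"
    by (intro Bochner_Integration.integral_cong) (auto simp: power2_diff)
  also have "\<dots> = (\<integral>x. (f (x + h))\<^sup>2 \<partial>U) - 2 * A h + (\<integral>x. (f x)\<^sup>2 \<partial>U)"
    using i f2_int by (simp add: A_def)
  also have "(\<integral>x. (f (x + h))\<^sup>2 \<partial>U) = (\<integral>x. (f x)\<^sup>2 \<partial>U)"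
    by (rule integral_U_shift[of "\<lambda>x. (f x)\<^sup>2" "F\<^sup>2", OF _ _ _ h]) (use power_mono[OF f_bound, of _ 2] in \<open>auto simp: per\<close>)
  finally have eq: "(\<integral>x. (f (x + h) - f x)\<^sup>2 \<partial>U) = 2 * ((\<integral>x. (f x)\<^sup>2 \<partial>U) - A h)" by simp
  have "(\<integral>x. (f (x + h) - f x)\<^sup>2 \<partial>U) = (\<integral>x. (f (x + (1 - h) + h) - f (x + (1 - h)))\<^sup>2 \<partial>U)"
  proof (rule integral_U_shift[of "\<lambda>x. (f (x + h) - f x)\<^sup>2" "(2 * F)\<^sup>2" "1 - h", symmetric])
    show "norm ((f (x + h) - f x)\<^sup>2) \<le> (2 * F)\<^sup>2" for x
    proof -
      have "\<bar>f (x + h) - f x\<bar> \<le> 2 * F" using f_bound[of x] f_bound[of "x + h"] by linarith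
      from power_mono[OF this, of 2] show ?thesis by simp
    qed
    show "(f (x + 1 + h) - f (x + 1))\<^sup>2 = (f (x + h) - f x)\<^sup>2" for x
      using per[of x] per[of "x + h"] by (simp add: add_ac)
  qed (use h in auto)
  also have "\<dots> = (\<integral>x. (f (x + (1 - h)) - f x)\<^sup>2 \<partial>U)"
    by (intro Bochner_Integration.integral_cong refl) (use per in \<open>simp add: power2_commute\<close>)
  finally have "(\<integral>x. (f (x + h) - f x)\<^sup>2 \<partial>U) \<le> 2 * F * (W * (1 - h))" using sh[of "1 - h"] h by simp
  moreover have "(\<integral>x. (f (x + h) - f x)\<^sup>2 \<partial>U) \<le> 2 * F * (W * h)" by (rule sh[OF h])
  ultimately show ?thesis using eq unfolding min_def by (auto simp: mult.assoc)
qed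

text \<open>The mean square error is at most the \<open>fejer\<close>-average of the defect of
  \<open>A\<close>, hence of \<open>F * W * d\<close>. With \<open>fejer n h = k * k\<close>, one
  factor \<open>k\<close> times \<open>d\<close> is at most \<open>1 / (2 * sqrt n)\<close>, and the
  other is at most \<open>(1 + fejer n h) / 2\<close>, whose integral is 1.\<close>

theorem L2_rate: "0 < n \<Longrightarrow> (\<integral>x. (f x - tp cf n x)\<^sup>2 \<partial>U) \<le> F * W / (2 * sqrt (real n))"
proof -
  assume n: "0 < n"
  let ?I = "\<integral>x. (f x)\<^sup>2 \<partial>U"
  have iK: "integrable U (fejer n)" by (rule integrable_U_cont[OF fejer_cont])
  have iKA: "integrable U (\<lambda>h. fejer n h * A h)"
  proof (rule Bochner_Integration.integrable_bound)
    show "integrable U (\<lambda>h. fejer n h * (F * F))" using iK by simp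
    show "AE h in U. norm (fejer n h * A h) \<le> norm (fejer n h * (F * F))"
      using A_bound order_trans[OF A_bound abs_ge_self] by (auto simp: abs_mult intro!: mult_left_mono)
  qed measurable
  have "?I - s2f n \<le> ?I * (\<integral>h. fejer n h \<partial>U) - (\<integral>h. fejer n h * A h \<partial>U)"
    using fejer_A[OF n] fejer_integral[OF n] by simp
  also have "\<dots> = (\<integral>h. fejer n h * (?I - A h) \<partial>U)"
    using iK iKA by (simp add: right_diff_distrib mult.commute)
  also have "\<dots> \<le> (\<integral>h. F * W / (4 * sqrt (real n)) * (1 + fejer n h) \<partial>U)"
  proof (rule integral_mono_AE)
    show "integrable U (\<lambda>h. fejer n h * (?I - A h))" using iK iKA by (simp add: right_diff_distrib)
    show "integrable U (\<lambda>h. F * W / (4 * sqrt (real n)) * (1 + fejer n h))" using iK by simp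
    have "fejer n h * (?I - A h) \<le> F * W / (4 * sqrt (real n)) * (1 + fejer n h)" if h: "0 \<le> h" "h \<le> 1" for h
    proof -
      define d where "d = min h (1 - h)"
      have d: "0 \<le> d" using h by (simp add: d_def)
      define k where "k = sqrt (fejer n h)"
      have k: "0 \<le> k" "k\<^sup>2 = fejer n h" using fejer_nonneg[of n h] by (auto simp: k_def)
      have sn: "0 < sqrt (real n)" using n by simp
      have "(k * d)\<^sup>2 \<le> (1 / (2 * sqrt (real n)))\<^sup>2"
        using fejer_bound[OF h, of n] n by (simp add: power_mult_distrib k power_divide flip: d_def)
      then have kd: "k * d \<le> 1 / (2 * sqrt (real n))" by (rule power2_le_imp_le) simp
      have k1: "k \<le> (1 + fejer n h) / 2"
      proof -
        have "0 \<le> (k - 1)\<^sup>2" by simp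
        then show ?thesis using k(2) by (simp add: power2_diff)
      qed
      have "fejer n h * (?I - A h) \<le> fejer n h * (F * W * d)"
        unfolding d_def using A_defect[OF h] fejer_nonneg by (intro mult_left_mono)
      also have "\<dots> = F * W * (k * (k * d))" by (simp add: k(2)[symmetric] power2_eq_square)
      also have "\<dots> \<le> F * W * ((1 + fejer n h) / 2 * (1 / (2 * sqrt (real n))))"
        using F0 W0 kd k1 k d fejer_nonneg[of n h] by (intro mult_left_mono mult_mono) auto
      finally show ?thesis by (simp add: mult_ac)
    qed
    then show "AE h in U. fejer n h * (?I - A h) \<le> F * W / (4 * sqrt (real n)) * (1 + fejer n h)"
      by (auto simp: AE_U intro!: always_eventually)
  qed
  also have "\<dots> = F * W / (4 * sqrt (real n)) * (1 + 1)"
  proof -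
    have "(\<integral>h. 1 + fejer n h \<partial>U) = 1 + 1" using iK fejer_integral[OF n] U.prob_space by simp
    then show ?thesis by (simp only: integral_mult_right_zero)
  qed
  finally show ?thesis unfolding L2_error by (simp add: mult.commute)
qed

end

section \<open>The law of the iterated logarithm\<close>

lemma lil_at_top: "filterlim lil at_top sequentially"
  unfolding lil_def[abs_def] by real_asymp

text \<open>In the degenerate case all coefficients up to \<open>D\<close> vanish, and the claim
  reduces to the eventual positivity of \<open>lil\<close>.\<close>

lemma (in fourier_lac_dioph) AE_lower_poly':
  fixes D :: nat and \<tau> :: "nat \<Rightarrow> nat"
  assumes inj: "inj \<tau>" and eps: "0 < eps"
  shows "AE x in U. \<exists>\<^sub>F N in sequentially. (sqrt (s2 D) - eps) * lil N \<le> (\<Sum>k<N. tp c D (real (m (\<tau> k)) * x))"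
proof (cases "s2 D = 0")
  case True
  have "c j = 0" if "j \<in> freqs D" for j
    using True that unfolding s2_def by (subst (asm) sum_nonneg_eq_0_iff) auto
  then have z: "tp c D y = 0" for y unfolding tp_def by simp
  have "\<forall>\<^sub>F N in sequentially. 0 \<le> lil N" using lil_at_top by (auto simp: filterlim_at_top)
  then have "\<forall>\<^sub>F N in sequentially. (sqrt (s2 D) - eps) * lil N \<le> 0"
    by eventually_elim (use True eps in \<open>simp add: mult_le_0_iff\<close>)
  then have "\<exists>\<^sub>F N in sequentially. (sqrt (s2 D) - eps) * lil N \<le> 0"
    by (rule eventually_frequently[rotated]) simp
  then show ?thesis by (simp add: z)
next
  case False
  then show ?thesis using s2_nonneg[of D] by (intro AE_lower_poly inj eps) simp
qed

lemma limsup_ge_frequently: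
  fixes u :: "nat \<Rightarrow> ereal"
  assumes "\<exists>\<^sub>F N in sequentially. b \<le> u N"
  shows "b \<le> limsup u"
proof (rule ccontr)
  assume "\<not> b \<le> limsup u"
  then have "\<forall>\<^sub>F N in sequentially. u N < b" by (intro Limsup_lessD) simp
  then show False using assms by (simp add: frequently_def not_le)
qed

lemma ereal_le_if_le_add_eps:
  fixes z :: ereal
  assumes "\<And>e. 0 < e \<Longrightarrow> z \<le> ereal (y + e)"
  shows "z \<le> ereal y"
proof (rule ereal_le_epsilon2)
  fix e :: real assume "0 < e"
  then show "z \<le> ereal y + ereal e" using assms by simp
qed

context bv_periodic
begin

lemma tp_cf_bound: "\<bar>tp cf n x\<bar> \<le> (\<Sum>j\<in>freqs n. cmod (cf j))"
proof -
  have "\<bar>tp cf n x\<bar> \<le> (\<Sum>j\<in>freqs n. cmod (cf j * ee j x))"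
    unfolding tp_def by (rule order_trans[OF abs_Re_le_cmod norm_sum])
  then show ?thesis by (simp add: norm_mult)
qed

lemma tp_periodic: "tp d n (x + 1) = tp d n x"
  by (simp add: tp_def ee_periodic)

text \<open>The exponent 8 is fixed here: at degree \<open>2 ^ (8 * a)\<close> the mean square error
  is of order \<open>(1/16) ^ a\<close>, hence each term is of order \<open>(1/4) ^ a\<close> in
  \<open>L^1\<close>, and even the sum of \<open>2 ^ a\<close> absolute values has a summable
  expectation. By \<open>integral_U_dilate\<close> the estimate is the same for every
  \<open>k\<close>.\<close>

lemma AE_remainder:
  fixes m \<tau> :: "nat \<Rightarrow> nat"
  assumes m: "\<And>k. 0 < m k"
  shows "AE x in U. \<forall>\<^sub>F a in sequentially. (\<Sum>k<2 ^ a. \<bar>f (real (m (\<tau> k)) * x) - tp cf (2 ^ (8 * a)) (real (m (\<tau> k)) * x)\<bar>) \<le> 1"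
proof -
  define g where "g = (\<lambda>a y. f y - tp cf (2 ^ (8 * a)) y)"
  have gm [measurable]: "g a \<in> borel_measurable borel" for a unfolding g_def by measurable
  define Bd where "Bd = (\<lambda>a. F + (\<Sum>j\<in>freqs (2 ^ (8 * a)). cmod (cf j)))"
  have gb: "\<bar>g a y\<bar> \<le> Bd a" for a y
    unfolding g_def Bd_def using f_bound[of y] tp_cf_bound[of "2 ^ (8 * a)" y] by linarith
  have gper: "g a (y + 1) = g a y" for a y by (simp add: g_def per tp_periodic)
  define S where "S = (\<lambda>a x. \<Sum>k<2 ^ a. \<bar>g a (real (m (\<tau> k)) * x)\<bar>)"
  have Sm [measurable]: "S a \<in> borel_measurable borel" for a unfolding S_def by measurable
  define B where "B = (\<lambda>a. {x \<in> space U. 1 \<le> S a x})"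
  have "AE x in U. \<forall>\<^sub>F a in sequentially. x \<notin> B a"
  proof (rule borel_cantelli_U)
    show "B a \<in> sets borel" for a
    proof -
      have "B a \<in> sets U" unfolding B_def by measurable
      then show ?thesis by simp
    qed
    show "summable (\<lambda>a. (1 + F * W / 2) * (1 / 2) ^ a)" by (intro summable_mult summable_geometric) simp
    show "\<forall>\<^sub>F a in sequentially. measure U (B a) \<le> (1 + F * W / 2) * (1 / 2) ^ a"
    proof (rule always_eventually, rule allI)
      fix a
      have one: "(\<integral>x. \<bar>g a (real (m (\<tau> k)) * x)\<bar> \<partial>U) \<le> (1 + F * W / 2) * (1 / 4) ^ a"
        and inte: "integrable U (\<lambda>x. \<bar>g a (real (m (\<tau> k)) * x)\<bar>)" for k
      proof -
        show i1: "integrable U (\<lambda>x. \<bar>g a (real (m (\<tau> k)) * x)\<bar>)"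
          by (rule integrable_U_bounded[of _ "Bd a"]) (use gb in auto)
        have b2: "norm ((g a y)\<^sup>2) \<le> (Bd a)\<^sup>2" for y using power_mono[OF gb, of a y 2] by simp
        have i2: "integrable U (\<lambda>x. (g a (real (m (\<tau> k)) * x))\<^sup>2)"
          by (rule integrable_U_bounded[of _ "(Bd a)\<^sup>2"]) (use b2 in auto)
        \<comment> \<open>The passage from mean square to mean is balanced by \<open>4 ^ a\<close>,
          the square root of the rate \<open>16 ^ a\<close>.\<close>
        have "(\<integral>x. \<bar>g a (real (m (\<tau> k)) * x)\<bar> \<partial>U) \<le> (\<integral>x. (1 / 4) ^ a + 4 ^ a * (g a (real (m (\<tau> k)) * x))\<^sup>2 \<partial>U)"
        proof (rule integral_mono[OF i1])
          show "integrable U (\<lambda>x. (1 / 4) ^ a + 4 ^ a * (g a (real (m (\<tau> k)) * x))\<^sup>2)" using i2 by simp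
          fix x
          let ?z = "\<bar>g a (real (m (\<tau> k)) * x)\<bar>" and ?r = "(4::real) ^ a"
          show "?z \<le> (1 / 4) ^ a + ?r * (g a (real (m (\<tau> k)) * x))\<^sup>2"
          proof -
            have "0 \<le> (?r * ?z - 1)\<^sup>2" by simp
            then have "2 * (?r * ?z) \<le> ?r\<^sup>2 * ?z\<^sup>2 + 1" by (simp add: power2_diff power_mult_distrib)
            moreover have "0 \<le> ?r * ?z" by simp
            moreover have "?r * (1 / ?r + ?r * ?z\<^sup>2) = 1 + ?r\<^sup>2 * ?z\<^sup>2" by (simp add: power2_eq_square distrib_left)
            ultimately have "?r * ?z \<le> ?r * (1 / ?r + ?r * ?z\<^sup>2)" by linarith
            then have "?z \<le> 1 / ?r + ?r * ?z\<^sup>2" by (simp only: mult_le_cancel_left_pos zero_less_power zero_less_numeral)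
            then show ?thesis by (simp add: power_one_over)
          qed
        qed
        also have "\<dots> = (1 / 4) ^ a + 4 ^ a * (\<integral>x. (g a (real (m (\<tau> k)) * x))\<^sup>2 \<partial>U)"
          using i2 U.prob_space by simp
        also have "(\<integral>x. (g a (real (m (\<tau> k)) * x))\<^sup>2 \<partial>U) = (\<integral>x. (g a x)\<^sup>2 \<partial>U)"
          by (rule integral_U_dilate[of "\<lambda>y. (g a y)\<^sup>2", OF _ b2]) (auto simp: gper m)
        also have "\<dots> \<le> F * W / (2 * sqrt (real (2 ^ (8 * a))))"
          unfolding g_def by (rule L2_rate) simp
        also have "sqrt (real (2 ^ (8 * a))) = 16 ^ a"
        proof (rule real_sqrt_unique)
          have "((16::real) ^ a)\<^sup>2 = (16\<^sup>2) ^ a" by (simp only: power_mult[symmetric] mult.commute)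
          also have "\<dots> = (2 ^ 8) ^ a" by simp
          finally show "((16::real) ^ a)\<^sup>2 = real (2 ^ (8 * a))" by (simp add: power_mult)
        qed simp
        also have "4 ^ a * (F * W / (2 * 16 ^ a)) = F * W / 2 * (1 / 4) ^ a"
        proof -
          have "(16::real) ^ a = 4 ^ a * 4 ^ a" by (simp flip: power_mult_distrib)
          then show ?thesis by (simp add: power_one_over)
        qed
        finally show "(\<integral>x. \<bar>g a (real (m (\<tau> k)) * x)\<bar> \<partial>U) \<le> (1 + F * W / 2) * (1 / 4) ^ a"
          by (simp add: distrib_right)
      qed
      have "measure U (B a) \<le> (\<integral>x. S a x \<partial>U) / 1"
        unfolding B_def
        by (rule integral_Markov_inequality_measure[where A = UNIV])
           (auto simp: S_def intro!: inte sum_nonneg)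
      also have "\<dots> = (\<Sum>k<2 ^ a. \<integral>x. \<bar>g a (real (m (\<tau> k)) * x)\<bar> \<partial>U)"
        unfolding S_def div_by_1 by (rule Bochner_Integration.integral_sum) (rule inte)
      also have "\<dots> \<le> (\<Sum>k<(2::nat) ^ a. (1 + F * W / 2) * (1 / 4) ^ a)" by (intro sum_mono one)
      also have "\<dots> = (1 + F * W / 2) * (2 ^ a * (1 / 4) ^ a)" by simp
      also have "(2::real) ^ a * (1 / 4) ^ a = (1 / 2) ^ a" by (simp flip: power_mult_distrib)
      finally show "measure U (B a) \<le> (1 + F * W / 2) * (1 / 2) ^ a" .
    qed
  qed
  then show ?thesis
    by eventually_elim (auto elim!: eventually_mono simp: B_def S_def g_def not_le)
qed

text \<open>The almost sure statements are collected for all degrees \<open>D\<close> and all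
  tolerances \<open>1 / Suc j\<close>, countably many, so that a single null set serves. For fixed
  \<open>x\<close> the degree is then taken large: the tail constant
  \<open>128 * sqrt (L.VD D)\<close> tends to 0 and \<open>v D\<close> to the norm.\<close>

theorem law_of_iterated_logarithm:
  fixes m \<tau> :: "nat \<Rightarrow> nat"
  assumes L: "fourier_lac_dioph m q cf C" and inj: "inj \<tau>"
  shows "AE x in U. limsup (\<lambda>N. ereal ((\<Sum>k<N. f (real (m (\<tau> k)) * x)) / lil N)) = ereal (sqrt (\<integral>x. (f x)\<^sup>2 \<partial>U))"
proof -
  interpret L: fourier_lac_dioph m q cf C by (rule L)
  define y where "y = sqrt (\<integral>x. (f x)\<^sup>2 \<partial>U)"
  define v where "v = (\<lambda>D. sqrt (L.s2 D))"
  define S where "S = (\<lambda>x N. \<Sum>k<N. f (real (m (\<tau> k)) * x))"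
  define P where "P = (\<lambda>D x N. \<Sum>k<N. tp cf D (real (m (\<tau> k)) * x))"
  have s2: "L.s2 D = s2f D" for D by (simp add: L.s2_def s2f_def)
  have vy: "v D \<le> y" for D
  proof -
    have "0 \<le> (\<integral>x. (f x - tp cf D x)\<^sup>2 \<partial>U)" by (rule Bochner_Integration.integral_nonneg) simp
    then show ?thesis unfolding v_def y_def s2 L2_error by simp
  qed
  have vlim: "v \<longlonglongrightarrow> y"
  proof -
    have "((\<lambda>n::nat. 1 / (2 * sqrt (real n))) \<longlonglongrightarrow> 0)" by real_asymp
    then have "((\<lambda>n::nat. F * W * (1 / (2 * sqrt (real n)))) \<longlonglongrightarrow> F * W * 0)" by (intro tendsto_intros)
    then have lim0: "((\<lambda>n::nat. F * W / (2 * sqrt (real n))) \<longlonglongrightarrow> 0)" by simp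
    have "(\<lambda>n. (\<integral>x. (f x)\<^sup>2 \<partial>U) - s2f n) \<longlonglongrightarrow> 0"
    proof (rule tendsto_sandwich[OF _ _ tendsto_const lim0])
      show "\<forall>\<^sub>F n in sequentially. 0 \<le> (\<integral>x. (f x)\<^sup>2 \<partial>U) - s2f n"
        unfolding L2_error[symmetric] by (intro always_eventually allI Bochner_Integration.integral_nonneg) simp
      show "\<forall>\<^sub>F n in sequentially. (\<integral>x. (f x)\<^sup>2 \<partial>U) - s2f n \<le> F * W / (2 * sqrt (real n))"
        unfolding L2_error[symmetric] using eventually_gt_at_top[of 0] by eventually_elim (rule L2_rate)
    qed
    then have "(\<lambda>n. (\<integral>x. (f x)\<^sup>2 \<partial>U) - ((\<integral>x. (f x)\<^sup>2 \<partial>U) - s2f n)) \<longlonglongrightarrow> (\<integral>x. (f x)\<^sup>2 \<partial>U) - 0"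
      by (intro tendsto_intros)
    then have "s2f \<longlonglongrightarrow> (\<integral>x. (f x)\<^sup>2 \<partial>U)" by simp
    then show ?thesis unfolding v_def y_def s2 by (rule tendsto_real_sqrt)
  qed
  have VDlim: "(\<lambda>D. 128 * sqrt (L.VD D)) \<longlonglongrightarrow> 0"
  proof -
    have "(\<lambda>D. 1 / (real D + 1)) \<longlonglongrightarrow> 0" by real_asymp
    then have "(\<lambda>D. 128 * sqrt (4 * C\<^sup>2 * (1 / 2 + 2 / (q - 1)) * (1 / (real D + 1)))) \<longlonglongrightarrow> 128 * sqrt (4 * C\<^sup>2 * (1 / 2 + 2 / (q - 1)) * 0)"
      by (intro tendsto_intros)
    then show ?thesis by (simp add: L.VD_def)
  qed
  have "AE x in U. \<forall>D. \<forall>\<^sub>F a in sequentially. \<forall>N. 2 ^ (a - 1) \<le> N \<longrightarrow> N \<le> 2 ^ a \<longrightarrow>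
     \<bar>\<Sum>k<N. tp (cut D cf) (2 ^ (8 * a)) (real (m (\<tau> k)) * x)\<bar> \<le> 128 * sqrt (L.VD D) * lil N"
    unfolding AE_all_countable by (intro allI L.AE_upper_tail inj) simp
  moreover have "AE x in U. \<forall>D j. \<forall>\<^sub>F N in sequentially. P D x N \<le> (v D + 1 / real (Suc j)) * lil N"
    unfolding AE_all_countable P_def v_def by (intro allI L.AE_upper_poly inj) simp
  moreover have "AE x in U. \<forall>D j. \<exists>\<^sub>F N in sequentially. (v D - 1 / real (Suc j)) * lil N \<le> P D x N"
    unfolding AE_all_countable P_def v_def by (intro allI L.AE_lower_poly' inj) simp
  moreover note AE_remainder[of m \<tau>, OF L.m_pos]
  ultimately show ?thesis
  proof eventually_elim
    case (elim x)
    have cmp: "\<forall>\<^sub>F N in sequentially. \<bar>S x N - P D x N\<bar> \<le> 128 * sqrt (L.VD D) * lil N + 1" for D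
    proof -
      from elim(1)[rule_format, of D] elim(4) eventually_const_degree[of D]
      have "\<forall>\<^sub>F a in sequentially. \<forall>N. 2 ^ (a - 1) \<le> N \<longrightarrow> N \<le> 2 ^ a \<longrightarrow> \<bar>S x N - P D x N\<bar> \<le> 128 * sqrt (L.VD D) * lil N + 1"
      proof eventually_elim
        case (elim a)
        show ?case
        proof (intro allI impI)
          fix N :: nat assume N: "2 ^ (a - 1) \<le> N" "N \<le> 2 ^ a"
          let ?H = "2 ^ (8 * a) :: nat" and ?y = "\<lambda>k. real (m (\<tau> k)) * x"
          \<comment> \<open>The first part collects the degrees beyond \<open>2 ^ (8 * a)\<close>,
            the second those between \<open>D\<close> and \<open>2 ^ (8 * a)\<close>.\<close>
          have "S x N - P D x N = (\<Sum>k<N. (f (?y k) - tp cf ?H (?y k)) + tp (cut D cf) ?H (?y k))"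
          proof -
            have t: "tp cf ?H z = tp cf D z + tp (cut D cf) ?H z" for z by (rule tp_cut[OF elim(3)])
            have "f z - tp cf D z = (f z - tp cf ?H z) + tp (cut D cf) ?H z" for z using t[of z] by linarith
            then show ?thesis unfolding S_def P_def sum_subtractf[symmetric] by (rule sum.cong[OF refl])
          qed
          also have "\<dots> = (\<Sum>k<N. f (?y k) - tp cf ?H (?y k)) + (\<Sum>k<N. tp (cut D cf) ?H (?y k))" by (rule sum.distrib)
          finally have "\<bar>S x N - P D x N\<bar> \<le> \<bar>\<Sum>k<N. f (?y k) - tp cf ?H (?y k)\<bar> + \<bar>\<Sum>k<N. tp (cut D cf) ?H (?y k)\<bar>"
            by linarith
          moreover have "\<bar>\<Sum>k<N. tp (cut D cf) ?H (?y k)\<bar> \<le> 128 * sqrt (L.VD D) * lil N" using elim(1) N by blast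
          moreover have "\<bar>\<Sum>k<N. f (?y k) - tp cf ?H (?y k)\<bar> \<le> 1"
          proof -
            have "\<bar>\<Sum>k<N. f (?y k) - tp cf ?H (?y k)\<bar> \<le> (\<Sum>k<N. \<bar>f (?y k) - tp cf ?H (?y k)\<bar>)" by (rule sum_abs)
            also have "\<dots> \<le> (\<Sum>k<2 ^ a. \<bar>f (?y k) - tp cf ?H (?y k)\<bar>)" using N by (intro sum_mono2) auto
            also have "\<dots> \<le> 1" by (rule elim(2))
            finally show ?thesis .
          qed
          ultimately show "\<bar>S x N - P D x N\<bar> \<le> 128 * sqrt (L.VD D) * lil N + 1" by linarith
        qed
      qed
      then show ?thesis by (rule eventually_dyadic')
    qed
    have pick: "\<exists>D j. 128 * sqrt (L.VD D) \<le> e \<and> y - e \<le> v D \<and> 1 / real (Suc j) \<le> e" if e: "0 < e" for e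
    proof -
      have "\<forall>\<^sub>F D in sequentially. 128 * sqrt (L.VD D) < e" using VDlim e by (rule order_tendstoD)
      moreover have "\<forall>\<^sub>F D in sequentially. y - e < v D" using vlim by (rule order_tendstoD) (use e in simp)
      ultimately have "\<forall>\<^sub>F D in sequentially. 128 * sqrt (L.VD D) \<le> e \<and> y - e \<le> v D" by eventually_elim simp
      then obtain D where "128 * sqrt (L.VD D) \<le> e \<and> y - e \<le> v D" by (auto dest: eventually_happens)
      moreover obtain j where "inverse (real (Suc j)) < e" using reals_Archimedean[OF e] by blast
      then have "1 / real (Suc j) \<le> e" by (simp add: inverse_eq_divide)
      ultimately show ?thesis by blast
    qed
    have lilpos: "\<forall>\<^sub>F N in sequentially. 0 < lil N \<and> 1 \<le> e * lil N" if e: "0 < e" for e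
    proof -
      have "\<forall>\<^sub>F N in sequentially. 1 / e \<le> lil N" using lil_at_top by (simp add: filterlim_at_top)
      then show ?thesis
      proof eventually_elim
        case (elim N)
        have "0 < 1 / e" using e by simp
        then have "0 < lil N" using elim by linarith
        moreover have "1 \<le> e * lil N" using elim e by (simp add: field_simps)
        ultimately show ?case by blast
      qed
    qed
    have up: "limsup (\<lambda>N. ereal (S x N / lil N)) \<le> ereal (y + e)" if e: "0 < e" for e
    proof -
      have e3: "0 < e / 3" using e by simp
      obtain D j where Dj: "128 * sqrt (L.VD D) \<le> e / 3" "1 / real (Suc j) \<le> e / 3" using pick[OF e3] by blast
      have "\<forall>\<^sub>F N in sequentially. ereal (S x N / lil N) \<le> ereal (y + e)"
        using cmp[of D] elim(2)[rule_format, of D j] lilpos[OF e3]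
      proof eventually_elim
        case (elim N)
        have "128 * sqrt (L.VD D) * lil N \<le> e / 3 * lil N" using Dj elim by (intro mult_right_mono) auto
        moreover have "(v D + 1 / real (Suc j)) * lil N \<le> (y + e / 3) * lil N"
          using Dj elim vy[of D] by (intro mult_right_mono) auto
        moreover have "(y + e) * lil N = (y + e / 3) * lil N + e / 3 * lil N + e / 3 * lil N"
          by (simp add: algebra_simps)
        ultimately have "S x N \<le> (y + e) * lil N" using elim by linarith
        then show ?case using elim by (simp add: divide_le_eq)
      qed
      then show ?thesis by (rule Limsup_bounded)
    qed
    have lo: "ereal (y - e) \<le> limsup (\<lambda>N. ereal (S x N / lil N))" if e: "0 < e" for e
    proof -
      have e4: "0 < e / 4" using e by simp
      obtain D j where Dj: "128 * sqrt (L.VD D) \<le> e / 4" "y - e / 4 \<le> v D" "1 / real (Suc j) \<le> e / 4" using pick[OF e4] by blast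
      have ev: "\<forall>\<^sub>F N in sequentially. \<bar>S x N - P D x N\<bar> \<le> 128 * sqrt (L.VD D) * lil N + 1 \<and> 0 < lil N \<and> 1 \<le> e / 4 * lil N"
        using cmp[of D] lilpos[OF e4] by eventually_elim simp
      have "\<exists>\<^sub>F N in sequentially. ereal (y - e) \<le> ereal (S x N / lil N)"
      proof (rule frequently_elim1[OF frequently_eventually_conj[OF elim(3)[rule_format, of D j] ev]])
        fix N assume N: "(\<bar>S x N - P D x N\<bar> \<le> 128 * sqrt (L.VD D) * lil N + 1 \<and> 0 < lil N \<and> 1 \<le> e / 4 * lil N) \<and> (v D - 1 / real (Suc j)) * lil N \<le> P D x N"
        have "128 * sqrt (L.VD D) * lil N \<le> e / 4 * lil N" using Dj N by (intro mult_right_mono) auto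
        moreover have "(y - e / 4 - e / 4) * lil N \<le> (v D - 1 / real (Suc j)) * lil N"
          using Dj N by (intro mult_right_mono) auto
        moreover have "(y - e / 4 - e / 4) * lil N = (y - e) * lil N + e / 4 * lil N + e / 4 * lil N"
          by (simp add: algebra_simps)
        ultimately have "(y - e) * lil N \<le> S x N" using N by linarith
        then show "ereal (y - e) \<le> ereal (S x N / lil N)" using N by (simp add: le_divide_eq)
      qed
      then show ?thesis by (rule limsup_ge_frequently)
    qed
    have "limsup (\<lambda>N. ereal (S x N / lil N)) \<le> ereal y" by (rule ereal_le_if_le_add_eps[OF up])
    moreover have "ereal y \<le> limsup (\<lambda>N. ereal (S x N / lil N))"
    proof (rule ereal_le_epsilon2)
      fix e :: real assume "0 < e"
      from lo[OF this] have "ereal (y - e) + ereal e \<le> limsup (\<lambda>N. ereal (S x N / lil N)) + ereal e" by (rule add_right_mono)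
      then show "ereal y \<le> limsup (\<lambda>N. ereal (S x N / lil N)) + ereal e" by simp
    qed
    ultimately show ?case unfolding S_def y_def by (rule antisym)
  qed
qed

end

theorem theorem1:
  fixes n :: "nat \<Rightarrow> nat" and q :: real and f :: "real \<Rightarrow> real"
  assumes pos: "\<forall>k\<ge>1. n k > 0"
    and q: "q > 1"
    and gap: "\<forall>k\<ge>1. real (n (Suc k)) / real (n k) \<ge> q"
    and dioph: "\<forall>a b :: int. a \<noteq> 0 \<longrightarrow> b \<noteq> 0 \<longrightarrow>
        (\<exists>K :: nat. \<forall>(c::int) (N::nat). N \<ge> 1 \<longrightarrow>
          card {(k, l). k \<in> {1..N} \<and> l \<in> {1..N} \<and>
                 a * int (n k) + b * int (n l) = c \<and> (c = 0 \<longrightarrow> k \<noteq> l)} \<le> K)"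
    and meas: "f \<in> borel_measurable lborel"
    and per: "\<forall>x. f (x + 1) = f x"
    and mean0: "(LBINT x:{0..1}. f x) = 0"
    and bv: "total_variation f 0 1 < \<infinity>"
  shows "\<forall>\<sigma> :: nat \<Rightarrow> nat. bij_betw \<sigma> {1..} {1..} \<longrightarrow>
           (AE x in lborel. x \<in> {0<..<1} \<longrightarrow>
              limsup (\<lambda>N. ereal ((\<Sum>k=1..N. f (real (n (\<sigma> k)) * x))
                                 / sqrt (2 * real N * ln (ln (real N)))))
                = ereal (L2_01_norm f))"
proof (intro allI impI)
  fix \<sigma> :: "nat \<Rightarrow> nat" assume \<sigma>: "bij_betw \<sigma> {1..} {1..}"
  have fm [measurable]: "f \<in> borel_measurable borel" using meas by simp
  obtain G W where G: "mono G" "\<And>x. 0 \<le> G x" "\<And>x. G x \<le> W"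
    "\<And>x y. 0 \<le> x \<Longrightarrow> x \<le> y \<Longrightarrow> y \<le> 2 \<Longrightarrow> \<bar>f y - f x\<bar> \<le> G y - G x"
    using bv_majorant[OF per[rule_format] bv] by blast
  interpret bv_periodic f G W
    by unfold_locales (use G per mean0 integral_U[OF fm] in auto)
  \<comment> \<open>Indices start at 1 in the statement and at 0 in the proof; since
    \<open>\<sigma>\<close> takes values at least 1 there, the subtraction in \<open>\<tau>\<close>
    is never truncated.\<close>
  define m where "m = (\<lambda>k. n (Suc k))"
  define \<tau> where "\<tau> = (\<lambda>i. \<sigma> (Suc i) - 1)"
  have \<sigma>1: "1 \<le> \<sigma> (Suc i)" for i using bij_betwE[OF \<sigma>] by auto
  have m\<tau>: "m (\<tau> i) = n (\<sigma> (Suc i))" for i using \<sigma>1[of i] by (simp add: m_def \<tau>_def)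
  have inj: "inj \<tau>"
  proof (rule injI)
    fix i j assume "\<tau> i = \<tau> j"
    then have "\<sigma> (Suc i) = \<sigma> (Suc j)" using \<sigma>1[of i] \<sigma>1[of j] by (simp add: \<tau>_def)
    then have "Suc i = Suc j" using bij_betw_imp_inj_on[OF \<sigma>] by (auto dest: inj_onD)
    then show "i = j" by simp
  qed
  have L: "fourier_lac_dioph m q cf (max 1 W)"
  proof unfold_locales
    show "0 < m k" for k using pos by (simp add: m_def)
    show "1 < q" by (rule q)
    show "q * real (m k) \<le> real (m (Suc k))" for k
      using gap[rule_format, of "Suc k"] pos[rule_format, of "Suc k"] by (simp add: m_def le_divide_eq)
    show "cf (- j) = cnj (cf j)" for j by (rule cf_cnj)
    show "cmod (cf j) \<le> max 1 W / \<bar>of_int j\<bar>" if "j \<noteq> 0" for j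
      by (rule order_trans[OF cf_decay[OF that] divide_right_mono]) auto
    show "1 \<le> max 1 W" by simp
    fix i j :: int assume ij: "i \<noteq> 0" "j \<noteq> 0"
    then obtain K where K: "\<And>c N. N \<ge> 1 \<Longrightarrow> card {(k, l). k \<in> {1..N} \<and> l \<in> {1..N} \<and>
       i * int (n k) + j * int (n l) = c \<and> (c = 0 \<longrightarrow> k \<noteq> l)} \<le> K" using dioph by meson
    show "\<exists>N::nat. \<forall>v K. card {(k, l). k < K \<and> l < k \<and> i * int (m k) + j * int (m l) = v} \<le> N"
    proof (intro exI allI)
      fix v :: int and M :: nat
      let ?A = "{(k, l). k < M \<and> l < k \<and> i * int (m k) + j * int (m l) = v}"
      let ?B = "{(k, l). k \<in> {1..Suc M} \<and> l \<in> {1..Suc M} \<and> i * int (n k) + j * int (n l) = v \<and> (v = 0 \<longrightarrow> k \<noteq> l)}"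
      have "finite ?B" by (rule finite_subset[of _ "{1..Suc M} \<times> {1..Suc M}"]) auto
      \<comment> \<open>Pairs with \<open>l < k\<close> are off the diagonal, so the extra clause
        for \<open>v = 0\<close> holds for each of them.\<close>
      moreover have "(\<lambda>(k, l). (Suc k, Suc l)) ` ?A \<subseteq> ?B" by (auto simp: m_def)
      moreover have "inj_on (\<lambda>(k, l). (Suc k, Suc l)) ?A" by (auto simp: inj_on_def)
      ultimately have "card ?A \<le> card ?B" by (metis (no_types, lifting) card_inj_on_le)
      also have "\<dots> \<le> K" by (rule K) simp
      finally show "card ?A \<le> K" .
    qed
  qed
  have norm: "sqrt (\<integral>x. (f x)\<^sup>2 \<partial>U) = L2_01_norm f"
    unfolding L2_01_norm_def by (subst integral_U) auto
  have sums: "(\<Sum>k=1..N. f (real (n (\<sigma> k)) * x)) = (\<Sum>k<N. f (real (m (\<tau> k)) * x))" for N x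
    unfolding m\<tau> by (rule sum.reindex_bij_witness[of _ Suc "\<lambda>k. k - 1"]) auto
  have "AE x in U. limsup (\<lambda>N. ereal ((\<Sum>k=1..N. f (real (n (\<sigma> k)) * x)) / lil N)) = ereal (L2_01_norm f)"
    using law_of_iterated_logarithm[OF L inj] unfolding sums norm .
  then have "AE x in lborel. x \<in> {0..1} \<longrightarrow> limsup (\<lambda>N. ereal ((\<Sum>k=1..N. f (real (n (\<sigma> k)) * x)) / lil N)) = ereal (L2_01_norm f)"
    unfolding AE_U .
  then show "AE x in lborel. x \<in> {0<..<1} \<longrightarrow>
              limsup (\<lambda>N. ereal ((\<Sum>k=1..N. f (real (n (\<sigma> k)) * x))
                                 / sqrt (2 * real N * ln (ln (real N)))))
                = ereal (L2_01_norm f)"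
    by eventually_elim (auto simp: lil_def)
qed

end
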